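(* Let $\xi=\sup\{0\leq t\leq 1: W_1-2W_t=0\}$ and let $\mathbb{G}$ be the progressive enlargement of $\mathbb{F}$ with the random time $\xi$. The random measure $$ d\chi_t =\mathbf{1}_{\{\xi<t<1\}}\,\frac{\frac{W_t}{1-t}\exp\{-\frac{W_t^2}{2(1-t)}\}-\frac{W_t-W_1}{1-t}\exp\{-\frac{(W_t-W_1)^2}{2(1-t)}\}}{-\exp\{-\frac{W_t^2}{2(1-t)}\}+\exp\{-\frac{(W_t-W_1)^2}{2(1-t)}\}}\, dt $$ has a distribution function $\chi$, that is, $\int_0^t|d\chi|_s<\infty$ for all $t\geq 0$ almost surely and $\chi_t=\int_0^t d\chi_s$. Moreover the process $(W_t-W_{t\wedge\xi})_{t\geq 0}$ is a $(\mathbb{P},\mathbb{G})$ special semimartingale with drift $\chi$.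
   Context: $W$ is a standard linear Brownian motion (issued from $0$) on a probability space $(\Omega,\mathcal{B},\mathbb{P})$, where $\Omega$ is a Polish space with Borel $\sigma$-algebra $\mathcal{B}$. $\mathbb{F}^\circ$ is the natural filtration of $W$, $\mathcal{N}$ is the family of $(\mathbb{P},\mathcal{B})$-negligible sets, and $\mathcal{F}_t=\mathcal{F}^\circ_{t+}\vee\mathcal{N}$. With the process $I=\mathbf{1}_{[\xi,\infty)}$, the progressive enlargement $\mathbb{G}=(\mathcal{G}_t)_{t\geq 0}$ is given by $\mathcal{G}_t=\mathcal{G}^\circ_{t+}\vee\mathcal{N}$, where $\mathcal{G}^\circ_t=\mathcal{F}^\circ_t\vee\sigma(I_s:s\leq t)$. The drift of a special semimartingale $X=M+A$ ($M$ a local martingale, $A$ predictable with finite variation, null at $0$) is the process $A$. *)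

theory Defs
  imports "HOL-Probability.Probability"
begin

text \<open>
  Processes are functions \<open>X :: real \<Rightarrow> 'a \<Rightarrow> real\<close> of which only the times \<open>t \<ge> 0\<close> matter.
  Filtrations are indexed by all of \<open>real\<close> so that the library notions \<^const>\<open>filtration\<close> and
  \<^const>\<open>stopping_time\<close> apply; at negative times the filtrations below contain only the trivial
  events (and, after augmentation, the negligible sets and their complements).
\<close>

section \<open>Filtrations\<close>

definition natural_filtration :: "'a set \<Rightarrow> (real \<Rightarrow> 'a \<Rightarrow> real) \<Rightarrow> real \<Rightarrow> 'a measure" where
  "natural_filtration \<Omega> X t =
     sigma \<Omega> (\<Union>s\<in>{0..t}. {X s -` B \<inter> \<Omega> | B. B \<in> sets borel})"

text \<open>\<open>null_sets (completion M)\<close> consists of all subsets of the events of probability zero; such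
  a subset need not be Borel, which is why the
  semimartingale notions below are to be used over \<open>completion M\<close>.\<close>

definition augmentation :: "'a measure \<Rightarrow> (real \<Rightarrow> 'a measure) \<Rightarrow> real \<Rightarrow> 'a measure" where
  "augmentation M F t = sigma (space M) ((\<Inter>s\<in>{t<..}. sets (F s)) \<union> null_sets (completion M))"

definition raw_progressive_enlargement ::
    "'a set \<Rightarrow> (real \<Rightarrow> 'a measure) \<Rightarrow> ('a \<Rightarrow> real) \<Rightarrow> real \<Rightarrow> 'a measure" where
  "raw_progressive_enlargement \<Omega> F \<xi> t =
     sigma \<Omega> (sets (F t) \<union> sets (natural_filtration \<Omega> (\<lambda>s \<omega>. indicator {\<xi> \<omega>..} s) t))"

definition progressive_enlargement ::
    "'a measure \<Rightarrow> (real \<Rightarrow> 'a \<Rightarrow> real) \<Rightarrow> ('a \<Rightarrow> real) \<Rightarrow> real \<Rightarrow> 'a measure" where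
  "progressive_enlargement M W \<xi> =
     augmentation M (raw_progressive_enlargement (space M) (natural_filtration (space M) W) \<xi>)"

section \<open>Brownian motion\<close>

definition standard_brownian_motion :: "'a measure \<Rightarrow> (real \<Rightarrow> 'a \<Rightarrow> real) \<Rightarrow> bool" where
  "standard_brownian_motion M W \<longleftrightarrow>
     (\<forall>t\<ge>0. W t \<in> borel_measurable M) \<and>
     (AE \<omega> in M. W 0 \<omega> = 0) \<and>
     (AE \<omega> in M. continuous_on {0..} (\<lambda>t. W t \<omega>)) \<and>
     (\<forall>s\<ge>0. \<forall>t>s. distributed M lborel (\<lambda>\<omega>. W t \<omega> - W s \<omega>) (normal_density 0 (sqrt (t - s)))) \<and>
     (\<forall>n. \<forall>u :: nat \<Rightarrow> real. 0 \<le> u 0 \<longrightarrow> (\<forall>i<n. u i \<le> u (Suc i)) \<longrightarrow>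
        prob_space.indep_vars M (\<lambda>_. borel) (\<lambda>i \<omega>. W (u (Suc i)) \<omega> - W (u i) \<omega>) {..<n})"

section \<open>Local martingales and special semimartingales\<close>

definition adapted :: "(real \<Rightarrow> 'a measure) \<Rightarrow> (real \<Rightarrow> 'a \<Rightarrow> real) \<Rightarrow> bool" where
  "adapted F X \<longleftrightarrow> (\<forall>t\<ge>0. X t \<in> borel_measurable (F t))"

definition cadlag :: "(real \<Rightarrow> real) \<Rightarrow> bool" where
  "cadlag f \<longleftrightarrow> (\<forall>t\<ge>0. continuous (at_right t) f) \<and> (\<forall>t>0. \<exists>l. (f \<longlongrightarrow> l) (at_left t))"

definition locally_finite_variation :: "(real \<Rightarrow> real) \<Rightarrow> bool" where
  "locally_finite_variation f \<longleftrightarrow>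
     (\<forall>t\<ge>0. \<exists>C. \<forall>n. \<forall>u :: nat \<Rightarrow> real.
        0 \<le> u 0 \<longrightarrow> (\<forall>i<n. u i \<le> u (Suc i)) \<longrightarrow> u n \<le> t \<longrightarrow>
        (\<Sum>i<n. \<bar>f (u (Suc i)) - f (u i)\<bar>) \<le> C)"

definition martingale :: "'a measure \<Rightarrow> (real \<Rightarrow> 'a measure) \<Rightarrow> (real \<Rightarrow> 'a \<Rightarrow> real) \<Rightarrow> bool" where
  "martingale P F X \<longleftrightarrow>
     filtration (space P) F \<and> (\<forall>t. subalgebra P (F t)) \<and>
     adapted F X \<and> (\<forall>t\<ge>0. integrable P (X t)) \<and>
     (\<forall>s\<ge>0. \<forall>t\<ge>s. AE \<omega> in P. real_cond_exp P (F s) (X t) \<omega> = X s \<omega>)"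

text \<open>The localizing stopping times are finite-valued. This is no restriction: an extended
  sequence \<open>T n\<close> may be replaced by \<open>min (T n) n\<close>. The factor \<open>1\<^bsub>{T n > 0}\<^esub>\<close> allows for a
  non-integrable initial value.\<close>

definition local_martingale ::
    "'a measure \<Rightarrow> (real \<Rightarrow> 'a measure) \<Rightarrow> (real \<Rightarrow> 'a \<Rightarrow> real) \<Rightarrow> bool" where
  "local_martingale P F X \<longleftrightarrow>
     adapted F X \<and> (AE \<omega> in P. cadlag (\<lambda>t. X t \<omega>)) \<and>
     (\<exists>T :: nat \<Rightarrow> 'a \<Rightarrow> real.
        (\<forall>n. stopping_time F (T n) \<and> (\<forall>\<omega>\<in>space P. 0 \<le> T n \<omega>)) \<and>
        (AE \<omega> in P. incseq (\<lambda>n. T n \<omega>) \<and> filterlim (\<lambda>n. T n \<omega>) at_top sequentially) \<and>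
        (\<forall>n. martingale P F (\<lambda>t \<omega>. indicator {\<omega>. 0 < T n \<omega>} \<omega> * X (min t (T n \<omega>)) \<omega>)))"

definition predictable_sigma :: "'a set \<Rightarrow> (real \<Rightarrow> 'a measure) \<Rightarrow> (real \<times> 'a) measure" where
  "predictable_sigma \<Omega> F =
     sigma ({0..} \<times> \<Omega>)
       ({{0} \<times> A | A. A \<in> sets (F 0)} \<union> {{s<..t} \<times> A | s t A. 0 \<le> s \<and> s \<le> t \<and> A \<in> sets (F s)})"

definition predictable :: "'a set \<Rightarrow> (real \<Rightarrow> 'a measure) \<Rightarrow> (real \<Rightarrow> 'a \<Rightarrow> real) \<Rightarrow> bool" where
  "predictable \<Omega> F A \<longleftrightarrow> (\<lambda>(t, \<omega>). A t \<omega>) \<in> borel_measurable (predictable_sigma \<Omega> F)"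

definition special_semimartingale_with_drift ::
    "'a measure \<Rightarrow> (real \<Rightarrow> 'a measure) \<Rightarrow> (real \<Rightarrow> 'a \<Rightarrow> real) \<Rightarrow> (real \<Rightarrow> 'a \<Rightarrow> real) \<Rightarrow> bool" where
  "special_semimartingale_with_drift P F X A \<longleftrightarrow>
     predictable (space P) F A \<and>
     (AE \<omega> in P. A 0 \<omega> = 0 \<and> cadlag (\<lambda>t. A t \<omega>) \<and> locally_finite_variation (\<lambda>t. A t \<omega>)) \<and>
     (\<exists>N. local_martingale P F N \<and> (AE \<omega> in P. \<forall>t\<ge>0. X t \<omega> = N t \<omega> + A t \<omega>))"

section \<open>The random time and the random measure\<close>

text \<open>The set is almost surely non-empty, by the intermediate value theorem.\<close>

definition xi :: "(real \<Rightarrow> 'a \<Rightarrow> real) \<Rightarrow> 'a \<Rightarrow> real" where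
  "xi W \<omega> = Sup {t. 0 \<le> t \<and> t \<le> 1 \<and> W 1 \<omega> - 2 * W t \<omega> = 0}"

definition chi_density :: "(real \<Rightarrow> 'a \<Rightarrow> real) \<Rightarrow> real \<Rightarrow> 'a \<Rightarrow> real" where
  "chi_density W t \<omega> =
     indicator {xi W \<omega><..<1} t *
     ((W t \<omega> / (1 - t) * exp (- ((W t \<omega>)\<^sup>2 / (2 * (1 - t))))
        - (W t \<omega> - W 1 \<omega>) / (1 - t) * exp (- ((W t \<omega> - W 1 \<omega>)\<^sup>2 / (2 * (1 - t)))))
      / (- exp (- ((W t \<omega>)\<^sup>2 / (2 * (1 - t))))
         + exp (- ((W t \<omega> - W 1 \<omega>)\<^sup>2 / (2 * (1 - t))))))"

definition chi :: "(real \<Rightarrow> 'a \<Rightarrow> real) \<Rightarrow> real \<Rightarrow> 'a \<Rightarrow> real" where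
  "chi W t \<omega> = set_lebesgue_integral lborel {0..t} (\<lambda>s. chi_density W s \<omega>)"

end

theory Submission
  imports Defs "HOL-Real_Asymp.Real_Asymp"
begin

text \<open>Write \<open>y = W\<^sub>1\<close>. After \<open>\<xi>\<close> the path stays strictly on one side of the level \<open>y / 2\<close>, and because
\<open>- W\<close> is again a Brownian motion with the same \<open>\<xi>\<close> only \<open>y > 0\<close> needs an argument. For \<open>q \<le> v < 1\<close> the
event that \<open>\<xi> < q\<close> and \<open>W\<^sub>1 \<in> dy\<close> says that \<open>W\<close> stays above \<open>y / 2\<close> on \<open>[q, v]\<close> and then runs from \<open>W\<^sub>v\<close>
to \<open>y\<close> without meeting \<open>y / 2\<close>. Reflection at \<open>y / 2\<close> exchanges \<open>y\<close> and \<open>0\<close>, so the density of the second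
part is \<open>kern y v w = p (w - y) - p w\<close> at \<open>w = W\<^sub>v\<close>, where \<open>p\<close> is the density of \<open>N(0, 1 - v)\<close>. Given
\<open>W\<^sub>1 = y\<close> and \<open>\<xi> < q\<close>, the path after \<open>q\<close> is thus the Doob transform, by the function \<open>kern\<close>, of
Brownian motion killed at \<open>y / 2\<close>, and its drift is the logarithmic derivative \<open>kern' / kern\<close>: this is the
density of \<open>\<chi>\<close> (\<open>chi_density_eq\<close>).

No stochastic calculus is involved. Gaussian convolutions show that \<open>kern y v W\<^sub>v\<close> is a martingale and
that \<open>(W\<^sub>v - y / 2) kern y v W\<^sub>v\<close> has drift \<open>kern' y v W\<^sub>v\<close> (\<open>kern_one_step\<close>). Both processes vanish at
the level \<open>y / 2\<close>, so killing there changes neither statement (\<open>killed_identity\<close>). The first one gives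
the joint law of the past and of \<open>W\<^sub>1\<close> on \<open>{\<xi> < q, W\<^sub>1 > 0}\<close> (\<open>distr_pos_last\<close>); integrating the second one over \<open>y\<close>
turns it into the statement that \<open>W - \<chi>\<close> has centred increments on \<open>{\<xi> < q}\<close>, tested against the past of \<open>W\<close>
(\<open>drift_identity_pos\<close>). The same law gives \<open>E |\<chi>'\<^sub>u| \<le> 10 / sqrt (1 - u)\<close>, whence \<open>\<chi>\<close> has integrable variation.

Let \<open>N\<^sub>t = W\<^sub>t - W\<^bsub>min t \<xi>\<^esub> - \<chi>\<^sub>t\<close>, which is \<open>0\<close> up to \<open>\<xi>\<close>. On \<open>{\<xi> \<le> s}\<close> an event of \<open>\<G>\<^sub>s\<close> is generated by events
of the past of \<open>W\<close> and by the events \<open>{\<xi> \<le> q}\<close> with \<open>q \<le> s\<close>, so the preceding statement shows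
that \<open>N\<close> has centred increments there (\<open>N_increment_after_xi\<close>). On \<open>{s < \<xi> \<le> t}\<close> the expectation of \<open>N\<^sub>t\<close> can be
computed from the value of \<open>N\<close> at the first point after \<open>\<xi>\<close> of a fine grid, which tends to \<open>N\<^sub>\<xi> = 0\<close>
(\<open>N_integral_xi_between\<close>). Hence \<open>N\<close> is a martingale.

All this is done for a process with everywhere continuous paths. The given process is modified on a
negligible set, and the result is carried back, which the completeness of the filtration permits. The predictability
of \<open>\<chi>\<close> concerns every path and needs a separate look at those exceptional ones on which the density is not integrable.\<close>

section \<open>Gaussian densities\<close>

abbreviation gauss :: "real \<Rightarrow> real \<Rightarrow> real" where
  "gauss \<tau> \<equiv> normal_density 0 (sqrt \<tau>)"

definition gauss' :: "real \<Rightarrow> real \<Rightarrow> real" where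
  "gauss' \<tau> x = - (x / \<tau>) * gauss \<tau> x"

lemma gauss_eq: "0 < \<tau> \<Longrightarrow> gauss \<tau> x = exp (- (x\<^sup>2 / (2 * \<tau>))) / sqrt (2 * pi * \<tau>)"
  by (simp add: normal_density_def)

lemma gauss_minus [simp]: "gauss \<tau> (- x) = gauss \<tau> x"
  by (simp add: normal_density_def)

lemma gauss_commute: "gauss \<tau> (x - y) = gauss \<tau> (y - x)"
  by (simp add: normal_density_def power2_commute)

lemma borel_measurable_gauss2 [measurable]:
  assumes [measurable]: "f \<in> borel_measurable M" "g \<in> borel_measurable M"
  shows "(\<lambda>x. gauss (f x) (g x)) \<in> borel_measurable M"
  unfolding normal_density_def by measurable

lemma borel_measurable_gauss' [measurable]:
  assumes [measurable]: "f \<in> borel_measurable M" "g \<in> borel_measurable M"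
  shows "(\<lambda>x. gauss' (f x) (g x)) \<in> borel_measurable M"
  unfolding gauss'_def by measurable

text \<open>Completing the square in \<open>z\<close>. The second factor is a probability density in \<open>z\<close>, so the convolution
identities below reduce to its mass and its mean.\<close>

lemma gauss_mult:
  assumes "0 < \<sigma>" "0 < \<tau>"
  shows "gauss \<sigma> z * gauss \<tau> (x + z) =
    gauss (\<sigma> + \<tau>) x * normal_density (- (\<sigma> * x / (\<sigma> + \<tau>))) (sqrt (\<sigma> * \<tau> / (\<sigma> + \<tau>))) z"
proof -
  define \<rho> where "\<rho> = \<sigma> * \<tau> / (\<sigma> + \<tau>)"
  have \<rho>: "0 < \<rho>" "2 * pi * \<sigma> * (2 * pi * \<tau>) = 2 * pi * (\<sigma> + \<tau>) * (2 * pi * \<rho>)"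
    using assms by (auto simp: \<rho>_def field_simps)
  have 1: "sqrt (2 * pi * \<sigma>) * sqrt (2 * pi * \<tau>) = sqrt (2 * pi * (\<sigma> + \<tau>)) * sqrt (2 * pi * \<rho>)"
    using \<rho>(2) by (metis real_sqrt_mult)
  have 2: "z\<^sup>2 / (2 * \<sigma>) + (x + z)\<^sup>2 / (2 * \<tau>) = x\<^sup>2 / (2 * (\<sigma> + \<tau>)) + (z + \<sigma> * x / (\<sigma> + \<tau>))\<^sup>2 / (2 * \<rho>)"
  proof -
    have n0: "\<sigma> + \<tau> \<noteq> 0" "\<sigma> \<noteq> 0" "\<tau> \<noteq> 0" using assms by auto
    have "z + \<sigma> * x / (\<sigma> + \<tau>) = ((\<sigma> + \<tau>) * z + \<sigma> * x) / (\<sigma> + \<tau>)"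
      using n0 by (simp add: field_simps)
    then have "(z + \<sigma> * x / (\<sigma> + \<tau>))\<^sup>2 / (2 * \<rho>) = ((\<sigma> + \<tau>) * z + \<sigma> * x)\<^sup>2 / (2 * \<sigma> * \<tau> * (\<sigma> + \<tau>))"
      using n0 unfolding \<rho>_def by (simp add: power_divide) (simp add: power2_eq_square)
    moreover have "z\<^sup>2 / (2 * \<sigma>) + (x + z)\<^sup>2 / (2 * \<tau>) =
        (z\<^sup>2 * \<tau> * (\<sigma> + \<tau>) + (x + z)\<^sup>2 * \<sigma> * (\<sigma> + \<tau>)) / (2 * \<sigma> * \<tau> * (\<sigma> + \<tau>))"
      using n0 by (simp add: divide_simps) (simp add: algebra_simps)
    moreover have "x\<^sup>2 / (2 * (\<sigma> + \<tau>)) = x\<^sup>2 * \<sigma> * \<tau> / (2 * \<sigma> * \<tau> * (\<sigma> + \<tau>))"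
      using n0 by (simp add: divide_simps)
    moreover have "z\<^sup>2 * \<tau> * (\<sigma> + \<tau>) + (x + z)\<^sup>2 * \<sigma> * (\<sigma> + \<tau>) = x\<^sup>2 * \<sigma> * \<tau> + ((\<sigma> + \<tau>) * z + \<sigma> * x)\<^sup>2"
      by (simp add: power2_eq_square algebra_simps)
    ultimately show ?thesis by (simp add: add_divide_distrib)
  qed
  have "gauss \<sigma> z * gauss \<tau> (x + z) = exp (- (z\<^sup>2 / (2 * \<sigma>) + (x + z)\<^sup>2 / (2 * \<tau>))) / (sqrt (2 * pi * \<sigma>) * sqrt (2 * pi * \<tau>))"
    using assms by (simp add: gauss_eq flip: exp_add)
  also have "\<dots> = exp (- (x\<^sup>2 / (2 * (\<sigma> + \<tau>)))) / sqrt (2 * pi * (\<sigma> + \<tau>)) *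
     (exp (- ((z + \<sigma> * x / (\<sigma> + \<tau>))\<^sup>2 / (2 * \<rho>))) / sqrt (2 * pi * \<rho>))"
    unfolding 1 2 by (simp flip: exp_add)
  also have "\<dots> = gauss (\<sigma> + \<tau>) x * normal_density (- (\<sigma> * x / (\<sigma> + \<tau>))) (sqrt \<rho>) z"
    using assms \<rho>(1) by (simp add: normal_density_def)
  finally show ?thesis unfolding \<rho>_def .
qed

lemma gauss_conv:
  assumes "0 < \<sigma>" "0 < \<tau>"
  shows "has_bochner_integral lborel (\<lambda>z. gauss \<sigma> z * gauss \<tau> (x + z)) (gauss (\<sigma> + \<tau>) x)"
proof -
  have "has_bochner_integral lborel (\<lambda>z. gauss (\<sigma> + \<tau>) x * normal_density (- (\<sigma> * x / (\<sigma> + \<tau>))) (sqrt (\<sigma> * \<tau> / (\<sigma> + \<tau>))) z)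
     (gauss (\<sigma> + \<tau>) x * 1)"
    using assms by (intro has_bochner_integral_mult_right) (auto simp: has_bochner_integral_iff)
  then show ?thesis using assms by (simp add: gauss_mult)
qed

lemma gauss_conv_moment:
  assumes "0 < \<sigma>" "0 < \<tau>"
  shows "has_bochner_integral lborel (\<lambda>z. z * (gauss \<sigma> z * gauss \<tau> (x + z))) (\<sigma> * gauss' (\<sigma> + \<tau>) x)"
proof -
  have "has_bochner_integral lborel (\<lambda>z. gauss (\<sigma> + \<tau>) x *
       (normal_density (- (\<sigma> * x / (\<sigma> + \<tau>))) (sqrt (\<sigma> * \<tau> / (\<sigma> + \<tau>))) z * z))
     (gauss (\<sigma> + \<tau>) x * (- (\<sigma> * x / (\<sigma> + \<tau>))))"
    using assms by (intro has_bochner_integral_mult_right normal_moment_nz_1) simp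
  moreover have "gauss (\<sigma> + \<tau>) x * (- (\<sigma> * x / (\<sigma> + \<tau>))) = \<sigma> * gauss' (\<sigma> + \<tau>) x"
    by (simp add: gauss'_def)
  moreover have "(\<lambda>z. gauss (\<sigma> + \<tau>) x * (normal_density (- (\<sigma> * x / (\<sigma> + \<tau>))) (sqrt (\<sigma> * \<tau> / (\<sigma> + \<tau>))) z * z)) =
      (\<lambda>z. z * (gauss \<sigma> z * gauss \<tau> (x + z)))"
    using assms by (simp add: gauss_mult fun_eq_iff)
  ultimately show ?thesis by metis
qed

lemma gauss'_conv:
  assumes "0 < \<sigma>" "0 < \<tau>"
  shows "has_bochner_integral lborel (\<lambda>z. gauss \<sigma> z * gauss' \<tau> (x + z)) (gauss' (\<sigma> + \<tau>) x)"
proof -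
  have "has_bochner_integral lborel (\<lambda>z. - (1 / \<tau>) * (x * (gauss \<sigma> z * gauss \<tau> (x + z)) + z * (gauss \<sigma> z * gauss \<tau> (x + z))))
     (- (1 / \<tau>) * (x * gauss (\<sigma> + \<tau>) x + \<sigma> * gauss' (\<sigma> + \<tau>) x))"
    by (intro has_bochner_integral_mult_right has_bochner_integral_add gauss_conv gauss_conv_moment assms)
  moreover have "- (1 / \<tau>) * (x * gauss (\<sigma> + \<tau>) x + \<sigma> * gauss' (\<sigma> + \<tau>) x) = gauss' (\<sigma> + \<tau>) x"
    using assms by (simp add: gauss'_def field_simps)
  moreover have "(\<lambda>z. - (1 / \<tau>) * (x * (gauss \<sigma> z * gauss \<tau> (x + z)) + z * (gauss \<sigma> z * gauss \<tau> (x + z)))) =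
      (\<lambda>z. gauss \<sigma> z * gauss' \<tau> (x + z))"
    using assms by (auto simp: gauss'_def fun_eq_iff field_simps)
  ultimately show ?thesis by simp
qed

lemma sq_mult_exp_le: "x\<^sup>2 * exp (- (x\<^sup>2 / 2)) \<le> (2::real)"
proof -
  have "x\<^sup>2 / 2 \<le> exp (x\<^sup>2 / 2)" using exp_ge_add_one_self[of "x\<^sup>2/2"] by linarith
  then have "x\<^sup>2 \<le> 2 * exp (x\<^sup>2 / 2)" by (simp add: field_simps)
  then show ?thesis by (simp add: exp_minus divide_le_eq flip: divide_inverse)
qed

lemma abs_mult_exp_le: "\<bar>x\<bar> * exp (- (x\<^sup>2 / 2)) \<le> (1::real)"
proof -
  have "\<bar>x\<bar> \<le> 1 + x\<^sup>2 / 2"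
    using zero_le_power2[of "\<bar>x\<bar> - 1"] by (simp add: power2_eq_square algebra_simps)
  also have "\<dots> \<le> exp (x\<^sup>2 / 2)" using exp_ge_add_one_self[of "x\<^sup>2/2"] by simp
  finally show ?thesis by (simp add: exp_minus field_simps)
qed

lemma sqrt_2pi_ge: "0 \<le> \<tau> \<Longrightarrow> sqrt \<tau> \<le> sqrt (2 * pi * \<tau>)"
  using pi_gt3 by (intro real_sqrt_le_mono) (simp add: mult_le_cancel_right1)

lemma gauss_le: "0 < \<tau> \<Longrightarrow> gauss \<tau> x \<le> 1 / sqrt \<tau>"
  unfolding gauss_eq
  by (intro frac_le sqrt_2pi_ge) auto

lemma gauss_scale: "0 < \<tau> \<Longrightarrow> gauss \<tau> x = exp (- ((x / sqrt \<tau>)\<^sup>2 / 2)) / sqrt (2 * pi * \<tau>)"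
  by (simp add: gauss_eq power_divide ac_simps)

lemma abs_gauss'_le: "0 < \<tau> \<Longrightarrow> \<bar>gauss' \<tau> x\<bar> \<le> 1 / \<tau>"
proof -
  assume \<tau>: "0 < \<tau>"
  have "\<bar>gauss' \<tau> x\<bar> = (\<bar>x / sqrt \<tau>\<bar> * exp (- ((x / sqrt \<tau>)\<^sup>2 / 2))) / (sqrt \<tau> * sqrt (2 * pi * \<tau>))"
    using \<tau> by (simp add: gauss'_def gauss_scale abs_mult field_simps flip: power2_eq_square)
  also have "\<dots> \<le> 1 / (sqrt \<tau> * sqrt \<tau>)"
    using \<tau> by (intro frac_le abs_mult_exp_le mult_left_mono sqrt_2pi_ge) auto
  finally show ?thesis using \<tau> by simp
qed

lemma abs_mult_gauss_le: "0 < \<tau> \<Longrightarrow> \<bar>x\<bar> * gauss \<tau> x \<le> 1"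
  using abs_gauss'_le[of \<tau> x] by (simp add: gauss'_def abs_mult field_simps)

lemma sq_mult_gauss_le: "0 < \<tau> \<Longrightarrow> x\<^sup>2 * gauss \<tau> x \<le> 2 * sqrt \<tau>"
proof -
  assume \<tau>: "0 < \<tau>"
  have "x\<^sup>2 * gauss \<tau> x = \<tau> * ((x / sqrt \<tau>)\<^sup>2 * exp (- ((x / sqrt \<tau>)\<^sup>2 / 2))) / sqrt (2 * pi * \<tau>)"
    using \<tau> by (simp add: gauss_scale power_divide)
  also have "\<dots> \<le> \<tau> * 2 / sqrt \<tau>"
    using \<tau> by (intro frac_le mult_left_mono sq_mult_exp_le sqrt_2pi_ge) auto
  also have "\<tau> * 2 / sqrt \<tau> = 2 * (\<tau> / sqrt \<tau>)" by simp
  also have "\<dots> = 2 * sqrt \<tau>" using \<tau> by (subst real_div_sqrt) auto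
  finally show ?thesis .
qed

lemma has_derivative_gauss:
  "0 < \<tau> \<Longrightarrow> (gauss \<tau> has_real_derivative gauss' \<tau> x) (at x)"
  unfolding normal_density_def gauss'_def
  by (auto intro!: derivative_eq_intros simp: field_simps)

lemma gauss_diff_le:
  assumes "0 < \<tau>"
  shows "\<bar>gauss \<tau> x - gauss \<tau> y\<bar> \<le> 1 / \<tau> * \<bar>x - y\<bar>"
proof -
  have "norm (gauss \<tau> x - gauss \<tau> y) \<le> 1 / \<tau> * norm (x - y)"
    by (rule field_differentiable_bound[of UNIV "gauss \<tau>" "gauss' \<tau>"])
       (use assms in \<open>auto intro: has_derivative_gauss abs_gauss'_le has_field_derivative_at_within\<close>)
  then show ?thesis by simp
qed

lemma integral_abs_gauss'_le:
  assumes "0 < \<tau>"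
  shows "(\<integral>\<^sup>+y. ennreal \<bar>gauss' \<tau> y\<bar> \<partial>lborel) \<le> ennreal (1 / sqrt \<tau>)"
proof -
  have *: "has_bochner_integral lborel (\<lambda>x. 1 / \<tau> * (gauss \<tau> x * \<bar>x - 0\<bar>^(2*0+1))) (1 / \<tau> * (2^0 * (sqrt \<tau>)^(2*0+1) * fact 0 * sqrt (2 / pi)))"
    using assms by (intro has_bochner_integral_mult_right normal_moment_abs_odd) auto
  have eq: "\<bar>gauss' \<tau> y\<bar> = 1 / \<tau> * (gauss \<tau> y * \<bar>y - 0\<bar>^(2*0+1))" for y
    using assms by (simp add: gauss'_def abs_mult)
  have "(\<integral>\<^sup>+y. ennreal \<bar>gauss' \<tau> y\<bar> \<partial>lborel) = ennreal (1 / \<tau> * (2^0 * (sqrt \<tau>)^(2*0+1) * fact 0 * sqrt (2 / pi)))"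
    unfolding eq using assms
    by (subst nn_integral_eq_integral)
       (use * in \<open>auto simp: has_bochner_integral_iff simp del: power_0 power_Suc intro!: mult_nonneg_nonneg\<close>)
  also have "\<dots> \<le> ennreal (1 / sqrt \<tau>)"
  proof (intro ennreal_leI)
    have "sqrt (2 / pi) \<le> 1" using pi_gt3 by simp
    then have "1 / \<tau> * sqrt \<tau> * sqrt (2/pi) \<le> 1 / \<tau> * sqrt \<tau> * 1"
      using assms by (intro mult_left_mono) auto
    moreover have "1 / \<tau> * sqrt \<tau> = 1 / sqrt \<tau>"
      using real_div_sqrt[of \<tau>] assms by (simp add: field_simps)
    ultimately show "1 / \<tau> * (2^0 * (sqrt \<tau>)^(2*0+1) * fact 0 * sqrt (2 / pi)) \<le> 1 / sqrt \<tau>"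
      by (simp only: power_0 mult_0_right add_0 power_one_right fact_0 mult_1 mult_1_right mult.assoc[symmetric])
  qed
  finally show ?thesis .
qed

section \<open>The kernel of Brownian motion killed at half the endpoint\<close>

text \<open>The transition density from \<open>w\<close> at time \<open>v\<close> to \<open>y\<close> at time \<open>1\<close> of Brownian motion killed at \<open>y / 2\<close>, by the
reflection principle: the mirror image of the end point \<open>y\<close> is \<open>0\<close>. The derivative in \<open>w\<close> is \<open>kern'\<close>.\<close>

definition kern :: "real \<Rightarrow> real \<Rightarrow> real \<Rightarrow> real" where
  "kern y v w = gauss (1 - v) (w - y) - gauss (1 - v) w"

definition kern' :: "real \<Rightarrow> real \<Rightarrow> real \<Rightarrow> real" where
  "kern' y v w = gauss' (1 - v) (w - y) - gauss' (1 - v) w"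

lemma borel_measurable_kern [measurable]:
  assumes [measurable]: "f \<in> borel_measurable M" "g \<in> borel_measurable M" "h \<in> borel_measurable M"
  shows "(\<lambda>x. kern (f x) (g x) (h x)) \<in> borel_measurable M" "(\<lambda>x. kern' (f x) (g x) (h x)) \<in> borel_measurable M"
  unfolding kern_def kern'_def by measurable

lemma kern_pos:
  assumes "v < 1" "0 < y" "y / 2 < w"
  shows "0 < kern y v w"
proof -
  have "(w - y)\<^sup>2 < w\<^sup>2" using assms by (simp add: power2_eq_square algebra_simps)
  then have "(w - y)\<^sup>2 / (2 * (1 - v)) < w\<^sup>2 / (2 * (1 - v))"
    using assms by (intro divide_strict_right_mono) auto
  then show ?thesis using assms by (simp add: kern_def gauss_eq divide_strict_right_mono)
qed

lemma abs_kern_le: "v < 1 \<Longrightarrow> \<bar>kern y v w\<bar> \<le> 1 / sqrt (1 - v)"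
  using gauss_le[of "1 - v" "w - y"] gauss_le[of "1 - v" w]
   normal_density_nonneg[of 0 "sqrt (1 - v)" "w - y"] normal_density_nonneg[of 0 "sqrt (1 - v)" "w"]
  unfolding kern_def by linarith

text \<open>The kernel vanishes at the killing level \<open>w = y / 2\<close>; the Lipschitz bound quantifies this and is what
makes optional stopping at that level leave no boundary term.\<close>

lemma abs_kern_le_dist: "v < 1 \<Longrightarrow> \<bar>kern y v w\<bar> \<le> 2 / (1 - v) * \<bar>w - y / 2\<bar>"
proof -
  assume v: "v < 1"
  have "\<bar>kern y v w\<bar> = \<bar>gauss (1 - v) (y - w) - gauss (1 - v) w\<bar>"
    by (simp add: kern_def gauss_commute)
  also have "\<dots> \<le> 1 / (1 - v) * \<bar>(y - w) - w\<bar>" using v by (intro gauss_diff_le) auto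
  also have "\<bar>(y - w) - w\<bar> = 2 * \<bar>w - y / 2\<bar>" by (auto simp: abs_if)
  finally show ?thesis by simp
qed

lemma abs_kern'_le: "v < 1 \<Longrightarrow> \<bar>kern' y v w\<bar> \<le> 2 / (1 - v)"
  using abs_gauss'_le[of "1 - v" "w - y"] abs_gauss'_le[of "1 - v" w] unfolding kern'_def by linarith

lemma abs_mult_kern_le: "v < 1 \<Longrightarrow> \<bar>(w - y / 2) * kern y v w\<bar> \<le> 2 + \<bar>y\<bar> / sqrt (1 - v)"
proof -
  assume v: "v < 1"
  have 1: "\<bar>w - y\<bar> * gauss (1 - v) (w - y) \<le> 1" "\<bar>w\<bar> * gauss (1 - v) w \<le> 1"
    using v by (auto intro: abs_mult_gauss_le)
  have 2: "\<bar>y/2\<bar> * gauss (1 - v) (w - y) \<le> \<bar>y/2\<bar> * (1 / sqrt (1 - v))" "\<bar>y/2\<bar> * gauss (1 - v) w \<le> \<bar>y/2\<bar> * (1 / sqrt (1 - v))"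
    using v by (intro mult_left_mono gauss_le; simp)+
  have 3: "\<bar>w - y/2\<bar> * gauss (1 - v) (w - y) \<le> \<bar>w - y\<bar> * gauss (1 - v) (w - y) + \<bar>y/2\<bar> * gauss (1 - v) (w - y)"
    "\<bar>w - y/2\<bar> * gauss (1 - v) w \<le> \<bar>w\<bar> * gauss (1 - v) w + \<bar>y/2\<bar> * gauss (1 - v) w"
    unfolding distrib_right[symmetric] by (intro mult_right_mono; simp; argo)+
  have "\<bar>(w - y / 2) * kern y v w\<bar> \<le> \<bar>w - y/2\<bar> * gauss (1 - v) (w - y) + \<bar>w - y/2\<bar> * gauss (1 - v) w"
    unfolding kern_def abs_mult distrib_left[symmetric]
    by (intro mult_left_mono) (auto simp: abs_if normal_density_nonneg add_nonneg_nonneg)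
  also have "\<dots> \<le> (1 + \<bar>y/2\<bar> * (1 / sqrt (1 - v))) + (1 + \<bar>y/2\<bar> * (1 / sqrt (1 - v)))"
    using 1 2 3 by linarith
  finally show ?thesis by simp
qed

text \<open>The kernel and its derivative are space-time harmonic. Multiplication by \<open>w - y / 2\<close> adds the
drift \<open>kern'\<close> (the cross variation of \<open>W\<close> and of the kernel), which is linear in the elapsed time because
\<open>kern'\<close> is harmonic.\<close>

lemma kern_one_step:
  assumes "v < u" "u < 1"
  shows "has_bochner_integral lborel (\<lambda>x. kern y u x * gauss (u - v) (x - w)) (kern y v w)"
    "has_bochner_integral lborel (\<lambda>x. kern' y u x * gauss (u - v) (x - w)) (kern' y v w)"
    "has_bochner_integral lborel (\<lambda>x. (x - y / 2) * kern y u x * gauss (u - v) (x - w))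
       ((w - y / 2) * kern y v w + (u - v) * kern' y v w)"
proof -
  have \<sigma>: "0 < u - v" "0 < 1 - u" "u - v + (1 - u) = 1 - v" using assms by auto
  have shift: "has_bochner_integral lborel (\<lambda>x. f x) c" if "has_bochner_integral lborel (\<lambda>z. f (w + z)) c"
    for f :: "real \<Rightarrow> real" and c
    using lborel_has_bochner_integral_real_affine_iff[of 1 f c w] that by simp
  have c: "has_bochner_integral lborel (\<lambda>z. gauss (u - v) z * gauss (1 - u) (x + z)) (gauss (1 - v) x)"
    "has_bochner_integral lborel (\<lambda>z. gauss (u - v) z * gauss' (1 - u) (x + z)) (gauss' (1 - v) x)"
    "has_bochner_integral lborel (\<lambda>z. z * (gauss (u - v) z * gauss (1 - u) (x + z))) ((u - v) * gauss' (1 - v) x)" for x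
    using gauss_conv[OF \<sigma>(1,2), of x] gauss'_conv[OF \<sigma>(1,2), of x] gauss_conv_moment[OF \<sigma>(1,2), of x]
    unfolding \<sigma>(3) by auto
  have 1: "has_bochner_integral lborel (\<lambda>z. kern y u (w + z) * gauss (u - v) z) (kern y v w)"
    using has_bochner_integral_diff[OF c(1)[of "w - y"] c(1)[of w]]
    by (simp add: kern_def algebra_simps)
  have 2: "has_bochner_integral lborel (\<lambda>z. kern' y u (w + z) * gauss (u - v) z) (kern' y v w)"
    using has_bochner_integral_diff[OF c(2)[of "w - y"] c(2)[of w]]
    by (simp add: kern'_def algebra_simps)
  have 3: "has_bochner_integral lborel (\<lambda>z. z * kern y u (w + z) * gauss (u - v) z) ((u - v) * kern' y v w)"
    using has_bochner_integral_diff[OF c(3)[of "w - y"] c(3)[of w]]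
    by (simp add: kern_def kern'_def algebra_simps)
  have 4: "has_bochner_integral lborel (\<lambda>z. (w + z - y / 2) * kern y u (w + z) * gauss (u - v) z)
      ((w - y / 2) * kern y v w + (u - v) * kern' y v w)"
    using has_bochner_integral_add[OF has_bochner_integral_mult_right[OF 1, of "w - y/2"] 3]
    by (simp add: algebra_simps)
  show "has_bochner_integral lborel (\<lambda>x. kern y u x * gauss (u - v) (x - w)) (kern y v w)"
    by (rule shift) (use 1 in simp)
  show "has_bochner_integral lborel (\<lambda>x. kern' y u x * gauss (u - v) (x - w)) (kern' y v w)"
    by (rule shift) (use 2 in simp)
  show "has_bochner_integral lborel (\<lambda>x. (x - y / 2) * kern y u x * gauss (u - v) (x - w))
       ((w - y / 2) * kern y v w + (u - v) * kern' y v w)"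
    by (rule shift) (use 4 in simp)
qed

text \<open>The mass in \<open>y\<close> is of order \<open>1 / sqrt (1 - v)\<close> uniformly in \<open>w\<close>; being integrable in \<open>v\<close> up to time \<open>1\<close>, this
bound is the source of the finite variation of \<open>\<chi>\<close>. The term \<open>gauss' (1 - v) w\<close> does not depend on \<open>y\<close>, but the range of
\<open>y\<close> has length at most \<open>2 w\<close>.\<close>

lemma nn_integral_kern'_le:
  assumes "v < 1"
  shows "(\<integral>\<^sup>+y. indicator {0<..} y * indicator {y. y / 2 < w} y * ennreal \<bar>kern' y v w\<bar> \<partial>lborel) \<le> ennreal (5 / sqrt (1 - v))"
proof -
  define \<tau> where "\<tau> = 1 - v"
  have \<tau>: "0 < \<tau>" using assms by (simp add: \<tau>_def)
  have "(\<integral>\<^sup>+y. indicator {0<..} y * indicator {y. y / 2 < w} y * ennreal \<bar>kern' y v w\<bar> \<partial>lborel)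
    \<le> (\<integral>\<^sup>+y. ennreal \<bar>gauss' \<tau> (w - y)\<bar> + ennreal \<bar>gauss' \<tau> w\<bar> * indicator {0<..<2 * w} y \<partial>lborel)"
    by (intro nn_integral_mono)
       (auto simp: kern'_def \<tau>_def indicator_def simp flip: ennreal_plus intro!: ennreal_leI)
  also have "\<dots> = (\<integral>\<^sup>+y. ennreal \<bar>gauss' \<tau> (w - y)\<bar> \<partial>lborel) + ennreal \<bar>gauss' \<tau> w\<bar> * emeasure lborel {0<..<2 * w}"
    by (subst nn_integral_add) (auto simp: nn_integral_cmult_indicator)
  also have "(\<integral>\<^sup>+y. ennreal \<bar>gauss' \<tau> (w - y)\<bar> \<partial>lborel) = (\<integral>\<^sup>+y. ennreal \<bar>gauss' \<tau> y\<bar> \<partial>lborel)"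
    using nn_integral_real_affine[of "\<lambda>y. ennreal \<bar>gauss' \<tau> y\<bar>" "-1" w] by simp
  also have "\<dots> + ennreal \<bar>gauss' \<tau> w\<bar> * emeasure lborel {0<..<2 * w} \<le> ennreal (1 / sqrt \<tau>) + ennreal (4 / sqrt \<tau>)"
  proof (intro add_mono integral_abs_gauss'_le \<tau>)
    show "ennreal \<bar>gauss' \<tau> w\<bar> * emeasure lborel {0<..<2 * w} \<le> ennreal (4 / sqrt \<tau>)"
    proof (cases "0 < w")
      case True
      have "\<bar>gauss' \<tau> w\<bar> * (2 * w) = 2 / \<tau> * (w\<^sup>2 * gauss \<tau> w)"
        using True \<tau> by (simp add: gauss'_def abs_mult power2_eq_square)
      also have "\<dots> \<le> 2 / \<tau> * (2 * sqrt \<tau>)"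
        using \<tau> by (intro mult_left_mono sq_mult_gauss_le) auto
      also have "\<dots> = 4 / sqrt \<tau>" using \<tau> by (simp add: field_simps)
      finally show ?thesis using True by (simp add: ennreal_leI flip: ennreal_mult)
    qed simp
  qed
  also have "\<dots> = ennreal (5 / sqrt \<tau>)" using \<tau> by (simp flip: ennreal_plus add_divide_distrib)
  finally show ?thesis unfolding \<tau>_def .
qed

section \<open>Brownian motion relative to a filtration\<close>

lemma floor_grid_LIMSEQ: "(\<lambda>n. real_of_int \<lfloor>real (Suc n) * t\<rfloor> / real (Suc n)) \<longlonglongrightarrow> t"
proof (rule Lim_null_comparison[of _ "\<lambda>n. 1 / real (Suc n)", THEN LIM_zero_cancel])
  show "\<forall>\<^sub>F n in sequentially. norm (real_of_int \<lfloor>real (Suc n) * t\<rfloor> / real (Suc n) - t) \<le> 1 / real (Suc n)"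
  proof (intro always_eventually allI)
    fix n
    have 1: "real_of_int \<lfloor>real (Suc n) * t\<rfloor> \<le> real (Suc n) * t" "real (Suc n) * t - 1 \<le> real_of_int \<lfloor>real (Suc n) * t\<rfloor>"
      by linarith+
    have "real_of_int \<lfloor>real (Suc n) * t\<rfloor> / real (Suc n) - t = (real_of_int \<lfloor>real (Suc n) * t\<rfloor> - real (Suc n) * t) / real (Suc n)"
      by (simp add: field_simps)
    moreover have "\<bar>real_of_int \<lfloor>real (Suc n) * t\<rfloor> - real (Suc n) * t\<bar> / real (Suc n) \<le> 1 / real (Suc n)"
      using 1 by (intro divide_right_mono) linarith+
    ultimately show "norm (real_of_int \<lfloor>real (Suc n) * t\<rfloor> / real (Suc n) - t) \<le> 1 / real (Suc n)"
      by (simp add: abs_divide)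
  qed
qed (use LIMSEQ_inverse_real_of_nat in \<open>simp add: divide_inverse\<close>)

text \<open>The process is the pointwise limit of its step approximations along the grids of mesh \<open>1 / n\<close>.\<close>

lemma borel_measurable_continuous_process:
  fixes X :: "real \<Rightarrow> 'a \<Rightarrow> real"
  assumes m: "\<And>t. X t \<in> borel_measurable M"
    and c: "\<And>\<omega>. \<omega> \<in> space M \<Longrightarrow> continuous_on UNIV (\<lambda>t. X t \<omega>)"
  shows "(\<lambda>(t, \<omega>). X t \<omega>) \<in> borel_measurable (borel \<Otimes>\<^sub>M M)"
proof (rule borel_measurable_LIMSEQ_real)
  fix n
  have "(\<lambda>p. X (real_of_int i / real (Suc n)) (snd p)) \<in> borel_measurable (borel \<Otimes>\<^sub>M M)" for i :: int
    by (rule measurable_compose[OF measurable_snd m])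
  moreover have "(\<lambda>p. \<lfloor>real (Suc n) * fst p\<rfloor>) \<in> measurable ((borel :: real measure) \<Otimes>\<^sub>M M) (count_space UNIV)"
    by measurable
  ultimately show "(\<lambda>p. X (real_of_int \<lfloor>real (Suc n) * fst p\<rfloor> / real (Suc n)) (snd p)) \<in> borel_measurable (borel \<Otimes>\<^sub>M M)"
    by (rule measurable_compose_countable)
next
  fix p :: "real \<times> 'a" assume "p \<in> space (borel \<Otimes>\<^sub>M M)"
  then have "snd p \<in> space M" by (auto simp: space_pair_measure)
  then have "isCont (\<lambda>t. X t (snd p)) (fst p)"
    using c continuous_on_eq_continuous_at by blast
  then show "(\<lambda>n. X (real_of_int \<lfloor>real (Suc n) * fst p\<rfloor> / real (Suc n)) (snd p)) \<longlonglongrightarrow> (case p of (t, \<omega>) \<Rightarrow> X t \<omega>)"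
    using isCont_tendsto_compose[OF _ floor_grid_LIMSEQ[of "fst p"], of "\<lambda>t. X t (snd p)"]
    by (simp add: case_prod_beta)
qed

text \<open>Continuity and the initial value are required of every path, so that hitting levels, running minima and
\<open>\<xi>\<close> need no exceptional sets.\<close>

locale cont_bm = prob_space P for P :: "'a measure" +
  fixes FF :: "real \<Rightarrow> 'a measure" and W :: "real \<Rightarrow> 'a \<Rightarrow> real"
  assumes subalg: "subalgebra P (FF s)"
    and mono: "s \<le> t \<Longrightarrow> sets (FF s) \<subseteq> sets (FF t)"
    and W_adapted: "0 \<le> s \<Longrightarrow> W s \<in> borel_measurable (FF s)"
    and W_cont: "continuous_on {0..} (\<lambda>t. W t \<omega>)"
    and W_0: "W 0 \<omega> = 0"
    and W_normal: "0 \<le> s \<Longrightarrow> s < t \<Longrightarrow> distributed P lborel (\<lambda>\<omega>. W t \<omega> - W s \<omega>) (gauss (t - s))"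
    and W_indep: "0 \<le> s \<Longrightarrow> s < t \<Longrightarrow> F \<in> sets (FF s) \<Longrightarrow> B \<in> sets borel \<Longrightarrow>
       prob (F \<inter> {\<omega>\<in>space P. W t \<omega> - W s \<omega> \<in> B}) = prob F * prob {\<omega>\<in>space P. W t \<omega> - W s \<omega> \<in> B}"
begin

lemma space_FF [simp]: "space (FF s) = space P"
  using subalg[of s] by (simp add: subalgebra_def)

lemma sets_FF: "F \<in> sets (FF s) \<Longrightarrow> F \<in> events"
  using subalg[of s] by (auto simp: subalgebra_def)

lemma measurable_FF: "f \<in> measurable (FF s) N \<Longrightarrow> f \<in> measurable P N"
  using measurable_from_subalg[OF subalg] .

lemma measurable_FF_mono: "f \<in> measurable (FF s) N \<Longrightarrow> s \<le> t \<Longrightarrow> f \<in> measurable (FF t) N"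
  using mono[of s t] by (auto simp: measurable_def)

lemma measurable_FF_pair:
  assumes "f \<in> measurable (FF s \<Otimes>\<^sub>M N) K" shows "f \<in> measurable (P \<Otimes>\<^sub>M N) K"
proof -
  have "(\<lambda>p. (fst p, snd p)) \<in> measurable (P \<Otimes>\<^sub>M N) (FF s \<Otimes>\<^sub>M N)"
    using subalg[of s] by (intro measurable_Pair measurable_snd measurable_compose[OF measurable_fst]) 
      (auto simp: subalgebra_def measurable_def)
  from measurable_compose[OF this assms] show ?thesis by simp
qed

lemma W_measurable_FF: "0 \<le> r \<Longrightarrow> r \<le> s \<Longrightarrow> W r \<in> borel_measurable (FF s)"
  using W_adapted measurable_FF_mono by blast

lemma W_measurable: "0 \<le> r \<Longrightarrow> W r \<in> borel_measurable P"
  using W_adapted measurable_FF by blast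

lemma W_joint: "(\<lambda>p. W (max 0 (fst p)) (snd p)) \<in> borel_measurable (borel \<Otimes>\<^sub>M P)"
proof -
  have "(\<lambda>(t, \<omega>). W (max 0 t) \<omega>) \<in> borel_measurable (borel \<Otimes>\<^sub>M P)"
  proof (rule borel_measurable_continuous_process)
    show "continuous_on UNIV (\<lambda>t. W (max 0 t) \<omega>)" for \<omega>
      by (rule continuous_on_compose2[OF W_cont]) (auto intro!: continuous_intros)
  qed (simp add: W_measurable)
  then show ?thesis by (simp add: case_prod_beta)
qed

lemma W_joint_meas:
  assumes [measurable]: "f \<in> borel_measurable N" "g \<in> measurable N P"
  shows "(\<lambda>x. W (max 0 (f x)) (g x)) \<in> borel_measurable N"
proof -
  have "(\<lambda>x. (f x, g x)) \<in> measurable N (borel \<Otimes>\<^sub>M P)" by measurable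
  from measurable_compose[OF this W_joint] show ?thesis by simp
qed

lemma FF_id: "(\<lambda>\<omega>. \<omega>) \<in> measurable P (FF s)"
  using subalg[of s] by (auto simp: subalgebra_def measurable_def)

lemma incr_distr: assumes "0 \<le> s" "s < t"
  shows "distr P borel (\<lambda>\<omega>. W t \<omega> - W s \<omega>) = density lborel (gauss (t - s))"
  using distributed_distr_eq_density[OF W_normal[OF assms]] by (simp cong: distr_cong)

text \<open>Independence of an increment from the past, as a product formula. The
first component is the identity into the smaller \<open>\<sigma>\<close>-algebra \<open>FF s\<close>, so that functions of the whole past can be
integrated against the law of the increment.\<close>

lemma joint_distr:
  assumes st: "0 \<le> s" "s < t"
  shows "distr P (FF s) (\<lambda>\<omega>. \<omega>) \<Otimes>\<^sub>M density lborel (gauss (t - s)) =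
    distr P (FF s \<Otimes>\<^sub>M borel) (\<lambda>\<omega>. (\<omega>, W t \<omega> - W s \<omega>))"
proof (rule pair_measure_eqI)
  have [measurable]: "W t \<in> borel_measurable P" "W s \<in> borel_measurable P" using st by (auto intro: W_measurable)
  note FF_id[of s, measurable]
  interpret N: prob_space "density lborel (gauss (t - s))" using st by (intro prob_space_normal_density) auto
  interpret A: prob_space "distr P (FF s) (\<lambda>\<omega>. \<omega>)" by (intro prob_space_distr) simp
  show "sigma_finite_measure (distr P (FF s) (\<lambda>\<omega>. \<omega>))" "sigma_finite_measure (density lborel (\<lambda>x. ennreal (gauss (t - s) x)))"
    by unfold_locales
  show "sets (distr P (FF s) (\<lambda>\<omega>. \<omega>) \<Otimes>\<^sub>M density lborel (gauss (t - s))) =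
      sets (distr P (FF s \<Otimes>\<^sub>M borel) (\<lambda>\<omega>. (\<omega>, W t \<omega> - W s \<omega>)))"
    by (simp cong: sets_pair_measure_cong)
  fix A B assume "A \<in> sets (distr P (FF s) (\<lambda>\<omega>. \<omega>))" "B \<in> sets (density lborel (gauss (t - s)))"
  then have A [measurable]: "A \<in> sets (FF s)" and B [measurable]: "B \<in> sets borel" by auto
  have "emeasure (distr P (FF s) (\<lambda>\<omega>. \<omega>)) A = prob A"
    using sets.sets_into_space[OF A] by (subst emeasure_distr) (auto simp: emeasure_eq_measure Int_absorb2 vimage_def)
  moreover have "emeasure (density lborel (gauss (t - s))) B = prob {\<omega>\<in>space P. W t \<omega> - W s \<omega> \<in> B}"
    unfolding incr_distr[OF st, symmetric]
    by (subst emeasure_distr) (auto simp: emeasure_eq_measure intro!: arg_cong[where f=prob])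
  moreover have "(\<lambda>\<omega>. (\<omega>, W t \<omega> - W s \<omega>)) -` (A \<times> B) \<inter> space P = A \<inter> {\<omega>\<in>space P. W t \<omega> - W s \<omega> \<in> B}"
    using sets.sets_into_space[OF A] by auto
  then have "emeasure (distr P (FF s \<Otimes>\<^sub>M borel) (\<lambda>\<omega>. (\<omega>, W t \<omega> - W s \<omega>))) (A \<times> B) = prob (A \<inter> {\<omega>\<in>space P. W t \<omega> - W s \<omega> \<in> B})"
    by (subst emeasure_distr) (auto simp: emeasure_eq_measure)
  ultimately show "emeasure (distr P (FF s) (\<lambda>\<omega>. \<omega>)) A * emeasure (density lborel (gauss (t - s))) B =
      emeasure (distr P (FF s \<Otimes>\<^sub>M borel) (\<lambda>\<omega>. (\<omega>, W t \<omega> - W s \<omega>))) (A \<times> B)"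
    by (simp add: W_indep[OF st A B] ennreal_mult)
qed

lemma prob_space_gauss: "0 < \<tau> \<Longrightarrow> prob_space (density lborel (gauss \<tau>))"
  by (intro prob_space_normal_density) auto

lemma markov_nn_integral:
  assumes st: "0 \<le> s" "s < t" and f [measurable]: "f \<in> borel_measurable (FF s \<Otimes>\<^sub>M borel)"
  shows "(\<integral>\<^sup>+\<omega>. f (\<omega>, W t \<omega>) \<partial>P) =
    (\<integral>\<^sup>+\<omega>. \<integral>\<^sup>+y. f (\<omega>, y) * ennreal (gauss (t - s) (y - W s \<omega>)) \<partial>lborel \<partial>P)"
proof -
  have [measurable]: "W t \<in> borel_measurable P" "W s \<in> borel_measurable P" "W s \<in> borel_measurable (FF s)"
    using st by (auto intro: W_measurable W_adapted)
  note FF_id[of s, measurable]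
  interpret N: prob_space "density lborel (gauss (t - s))" using st by (intro prob_space_gauss) auto
  interpret A: prob_space "distr P (FF s) (\<lambda>\<omega>. \<omega>)" by (intro prob_space_distr) simp
  interpret pair_sigma_finite "distr P (FF s) (\<lambda>\<omega>. \<omega>)" "density lborel (gauss (t - s))" ..
  define g where "g = (\<lambda>p. f (fst p, W s (fst p) + snd p))"
  have g [measurable]: "g \<in> borel_measurable (FF s \<Otimes>\<^sub>M borel)" unfolding g_def by measurable
  have "(\<integral>\<^sup>+\<omega>. f (\<omega>, W t \<omega>) \<partial>P) = (\<integral>\<^sup>+\<omega>. g (\<omega>, W t \<omega> - W s \<omega>) \<partial>P)" by (simp add: g_def)
  also have "\<dots> = (\<integral>\<^sup>+p. g p \<partial>distr P (FF s \<Otimes>\<^sub>M borel) (\<lambda>\<omega>. (\<omega>, W t \<omega> - W s \<omega>)))"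
    by (subst nn_integral_distr) measurable
  also have "\<dots> = (\<integral>\<^sup>+\<omega>. \<integral>\<^sup>+z. g (\<omega>, z) \<partial>density lborel (gauss (t - s)) \<partial>distr P (FF s) (\<lambda>\<omega>. \<omega>))"
    unfolding joint_distr[OF st, symmetric] by (subst N.nn_integral_fst[symmetric]) simp_all
  also have "\<dots> = (\<integral>\<^sup>+\<omega>. \<integral>\<^sup>+z. g (\<omega>, z) \<partial>density lborel (gauss (t - s)) \<partial>P)"
  proof (subst nn_integral_distr)
    have "g \<in> borel_measurable (FF s \<Otimes>\<^sub>M density lborel (gauss (t - s)))"
      using g by (subst measurable_cong_sets[OF sets_pair_measure_cong[OF refl, of _ borel] refl]) simp_all
    then show "(\<lambda>\<omega>. \<integral>\<^sup>+z. g (\<omega>, z) \<partial>density lborel (gauss (t - s))) \<in> borel_measurable (distr P (FF s) (\<lambda>\<omega>. \<omega>))"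
      using N.borel_measurable_nn_integral[of "\<lambda>\<omega> z. g (\<omega>, z)" "FF s"] by simp
  qed simp_all
  also have "\<dots> = (\<integral>\<^sup>+\<omega>. \<integral>\<^sup>+y. f (\<omega>, y) * ennreal (gauss (t - s) (y - W s \<omega>)) \<partial>lborel \<partial>P)"
  proof (rule nn_integral_cong)
    fix \<omega> assume \<omega>: "\<omega> \<in> space P"
    have f': "(\<lambda>y. f (\<omega>, y)) \<in> borel_measurable borel"
      using \<omega> by (intro measurable_compose[OF _ f]) simp
    have "(\<integral>\<^sup>+z. g (\<omega>, z) \<partial>density lborel (gauss (t - s))) = (\<integral>\<^sup>+z. ennreal (gauss (t - s) z) * f (\<omega>, W s \<omega> + z) \<partial>lborel)"
      using f' by (subst nn_integral_density) (auto simp: g_def)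
    also have "\<dots> = (\<integral>\<^sup>+y. f (\<omega>, y) * ennreal (gauss (t - s) (y - W s \<omega>)) \<partial>lborel)"
      using f' by (subst nn_integral_real_affine[where c=1 and t="W s \<omega>"]) (auto simp: mult.commute)
    finally show "(\<integral>\<^sup>+z. g (\<omega>, z) \<partial>density lborel (gauss (t - s))) = \<dots>" .
  qed
  finally show ?thesis .
qed

lemma markov_integral:
  assumes st: "0 \<le> s" "s < t" and F: "F \<in> sets (FF s)" and f [measurable]: "f \<in> borel_measurable borel"
    and bnd: "\<And>x. \<bar>f x\<bar> \<le> C"
    and g: "\<And>x. has_bochner_integral lborel (\<lambda>y. f y * gauss (t - s) (y - x)) (g x)"
  shows "(\<integral>\<omega>. indicator F \<omega> * f (W t \<omega>) \<partial>P) = (\<integral>\<omega>. indicator F \<omega> * g (W s \<omega>) \<partial>P)"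
proof -
  have [measurable]: "W t \<in> borel_measurable P" "W s \<in> borel_measurable P" "W s \<in> borel_measurable (FF s)"
    using st by (auto intro: W_measurable W_adapted)
  note FF_id[of s, measurable] F[measurable]
  interpret N: prob_space "density lborel (gauss (t - s))" using st by (intro prob_space_gauss) auto
  interpret A: prob_space "distr P (FF s) (\<lambda>\<omega>. \<omega>)" by (intro prob_space_distr) simp
  interpret AN: pair_prob_space "distr P (FF s) (\<lambda>\<omega>. \<omega>)" "density lborel (gauss (t - s))" ..
  define h where "h = (\<lambda>p. indicator F (fst p) * f (W s (fst p) + snd p))"
  have h [measurable]: "h \<in> borel_measurable (FF s \<Otimes>\<^sub>M borel)" unfolding h_def by measurable
  have hb: "\<bar>h p\<bar> \<le> C" for p using bnd[of "W s (fst p) + snd p"] bnd[of 0] by (auto simp: h_def indicator_def)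
  have int: "integrable (distr P (FF s) (\<lambda>\<omega>. \<omega>) \<Otimes>\<^sub>M density lborel (gauss (t - s))) h"
    by (rule AN.integrable_const_bound[where B=C]) (auto simp: hb)
  have g_eq: "g x = (\<integral>y. f y * gauss (t - s) (y - x) \<partial>lborel)" for x
    using g[of x] by (simp add: has_bochner_integral_iff)
  have "(\<integral>\<omega>. indicator F \<omega> * f (W t \<omega>) \<partial>P) = (\<integral>\<omega>. h (\<omega>, W t \<omega> - W s \<omega>) \<partial>P)" by (simp add: h_def)
  also have "\<dots> = (\<integral>p. h p \<partial>distr P (FF s \<Otimes>\<^sub>M borel) (\<lambda>\<omega>. (\<omega>, W t \<omega> - W s \<omega>)))"
    by (subst integral_distr) measurable
  also have "\<dots> = (\<integral>\<omega>. \<integral>z. h (\<omega>, z) \<partial>density lborel (gauss (t - s)) \<partial>distr P (FF s) (\<lambda>\<omega>. \<omega>))"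
    unfolding joint_distr[OF st, symmetric] using int by (subst AN.integral_fst'[symmetric]) simp_all
  also have "\<dots> = (\<integral>\<omega>. \<integral>z. h (\<omega>, z) \<partial>density lborel (gauss (t - s)) \<partial>P)"
  proof (subst integral_distr)
    have "h \<in> borel_measurable (FF s \<Otimes>\<^sub>M density lborel (gauss (t - s)))"
      using h by (subst measurable_cong_sets[OF sets_pair_measure_cong[OF refl, of _ borel] refl]) simp_all
    then show "(\<lambda>\<omega>. \<integral>z. h (\<omega>, z) \<partial>density lborel (gauss (t - s))) \<in> borel_measurable (FF s)"
      using N.borel_measurable_lebesgue_integral[of "\<lambda>\<omega> z. h (\<omega>, z)" "FF s"] by simp
  qed simp_all
  also have "\<dots> = (\<integral>\<omega>. indicator F \<omega> * g (W s \<omega>) \<partial>P)"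
  proof (rule Bochner_Integration.integral_cong[OF refl])
    fix \<omega> assume \<omega>: "\<omega> \<in> space P"
    have "(\<integral>z. h (\<omega>, z) \<partial>density lborel (gauss (t - s))) = indicator F \<omega> * (\<integral>z. gauss (t - s) z * f (W s \<omega> + z) \<partial>lborel)"
      by (subst integral_density) (auto simp: h_def ac_simps)
    also have "(\<integral>z. gauss (t - s) z * f (W s \<omega> + z) \<partial>lborel) = g (W s \<omega>)"
      unfolding g_eq by (subst lborel_integral_real_affine[where c=1 and t="W s \<omega>"]) (auto simp: mult.commute)
    finally show "(\<integral>z. h (\<omega>, z) \<partial>density lborel (gauss (t - s))) = indicator F \<omega> * g (W s \<omega>)" .
  qed
  finally show ?thesis .
qed

definition rmin :: "real \<Rightarrow> real \<Rightarrow> 'a \<Rightarrow> real" where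
  "rmin q v \<omega> = (INF r\<in>{q..v}. W r \<omega>)"

lemma rmin_attained:
  assumes "0 \<le> q" "q \<le> v"
  obtains r where "q \<le> r" "r \<le> v" "rmin q v \<omega> = W r \<omega>" "\<And>x. q \<le> x \<Longrightarrow> x \<le> v \<Longrightarrow> W r \<omega> \<le> W x \<omega>"
proof -
  have "\<exists>r\<in>{q..v}. \<forall>x\<in>{q..v}. W r \<omega> \<le> W x \<omega>"
    using assms by (intro continuous_attains_inf continuous_on_subset[OF W_cont]) auto
  then obtain r where r: "r \<in> {q..v}" "\<And>x. x \<in> {q..v} \<Longrightarrow> W r \<omega> \<le> W x \<omega>" by auto
  have "rmin q v \<omega> = W r \<omega>"
    unfolding rmin_def using r by (intro cInf_eq_minimum) auto
  with r that show ?thesis by auto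
qed

lemma less_rmin_iff:
  assumes "0 \<le> q" "q \<le> v"
  shows "c < rmin q v \<omega> \<longleftrightarrow> (\<forall>r. q \<le> r \<and> r \<le> v \<longrightarrow> c < W r \<omega>)"
  using rmin_attained[OF assms, of \<omega>] by (metis order.strict_trans2)

lemma rmin_same [simp]: "rmin q q \<omega> = W q \<omega>" by (simp add: rmin_def)

lemma less_rmin_split:
  assumes "0 \<le> q" "q \<le> v" "v \<le> u"
  shows "c < rmin q u \<omega> \<longleftrightarrow> c < rmin q v \<omega> \<and> c < rmin v u \<omega>"
  using assms by (auto simp: less_rmin_iff) (metis le_cases order_trans)

text \<open>By continuity the minimum is an infimum over the rational times, together with the left end point, which
a degenerate interval would otherwise lose.\<close>

lemma rmin_measurable_FF:
  assumes "0 \<le> q" "q \<le> v"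
  shows "rmin q v \<in> borel_measurable (FF v)"
proof (rule borel_measurable_iff_ge[THEN iffD2], intro allI)
  fix a
  define D where "D = {q} \<union> ({q..v} \<inter> \<rat>)"
  have "countable D" unfolding D_def by (auto intro: countable_subset[OF _ countable_rat])
  have D: "D \<subseteq> {q..v}" using assms by (auto simp: D_def)
  have "a \<le> rmin q v \<omega> \<longleftrightarrow> (\<forall>r\<in>D. a \<le> W r \<omega>)" for \<omega>
  proof
    assume "a \<le> rmin q v \<omega>" then show "\<forall>r\<in>D. a \<le> W r \<omega>"
      using D rmin_attained[OF assms, of \<omega>] by (metis atLeastAtMost_iff order_trans subsetD)
  next
    assume *: "\<forall>r\<in>D. a \<le> W r \<omega>"
    obtain r where r: "q \<le> r" "r \<le> v" "rmin q v \<omega> = W r \<omega>" using rmin_attained[OF assms, of \<omega>] by metis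
    show "a \<le> rmin q v \<omega>"
    proof (rule ccontr)
      assume "\<not> a \<le> rmin q v \<omega>"
      then have lt: "W r \<omega> < a" using r by simp
      have "r \<noteq> q" using lt * by (auto simp: D_def)
      then have qr: "q < r" using r by simp
      have "0 < a - W r \<omega>" "r \<in> {0..}" using lt qr assms by auto
      then obtain d where d: "0 < d" "\<And>x. x \<in> {0..} \<Longrightarrow> dist x r < d \<Longrightarrow> dist (W x \<omega>) (W r \<omega>) < a - W r \<omega>"
        using W_cont[of \<omega>] unfolding continuous_on_iff by meson
      define b where "b = r - d"
      have b: "b < r" using d by (simp add: b_def)
      have b': "W x \<omega> < a" if "max b q < x" "x < r" for x
      proof -
        have "dist (W x \<omega>) (W r \<omega>) < a - W r \<omega>"
          using that assms by (intro d) (auto simp: b_def dist_real_def)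
        then show ?thesis unfolding dist_real_def by linarith
      qed
      obtain x where "x \<in> \<rat>" "max b q < x" "x < r" using Rats_dense_in_real[of "max b q" r] b qr by auto
      then have "x \<in> D" "W x \<omega> < a" using r b' by (auto simp: D_def)
      with * show False by auto
    qed
  qed
  then have "{\<omega> \<in> space (FF v). a \<le> rmin q v \<omega>} = {\<omega> \<in> space (FF v). \<forall>r\<in>D. a \<le> W r \<omega>}" by auto
  also have "\<dots> \<in> sets (FF v)"
  proof (rule sets.sets_Collect_countable_All')
    fix r assume "r \<in> D" then have "W r \<in> borel_measurable (FF v)"
      using D assms by (intro W_measurable_FF) auto
    then show "{\<omega> \<in> space (FF v). a \<le> W r \<omega>} \<in> sets (FF v)" by measurable
  qed fact
  finally show "{\<omega> \<in> space (FF v). a \<le> rmin q v \<omega>} \<in> sets (FF v)" .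
qed

end

section \<open>Optional stopping at the passage below a level\<close>

lemma integrable_const_Ioc:
  fixes a b C :: real
  shows "integrable lborel (\<lambda>v. C * indicator {a<..b} v :: real)"
proof (intro integrable_mult_right integrable_real_indicator)
  show "emeasure lborel {a<..b} < \<infinity>" by (cases "a \<le> b") (simp_all add: ennreal_less_top)
qed simp

context cont_bm begin

context
  fixes G H :: "real \<Rightarrow> real \<Rightarrow> real" and c s t C L :: real and F :: "'a set"
  assumes s: "0 \<le> s" and st: "s < t"
    and G_meas [measurable]: "\<And>v. G v \<in> borel_measurable borel"
    and H_meas [measurable]: "(\<lambda>p. H (fst p) (snd p)) \<in> borel_measurable (borel \<Otimes>\<^sub>M borel)"
    and G_bound: "\<And>v w. s \<le> v \<Longrightarrow> v \<le> t \<Longrightarrow> \<bar>G v w\<bar> \<le> C"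
    and H_bound: "\<And>v w. s \<le> v \<Longrightarrow> v \<le> t \<Longrightarrow> \<bar>H v w\<bar> \<le> C"
    and G_lip: "\<And>v w. s \<le> v \<Longrightarrow> v \<le> t \<Longrightarrow> \<bar>G v w\<bar> \<le> L * \<bar>w - c\<bar>" and L: "0 \<le> L"
    and step: "\<And>r u F. s \<le> r \<Longrightarrow> r < u \<Longrightarrow> u \<le> t \<Longrightarrow> F \<in> sets (FF r) \<Longrightarrow>
       (\<integral>\<omega>. indicator F \<omega> * G u (W u \<omega>) \<partial>P) = (\<integral>\<omega>. indicator F \<omega> * G r (W r \<omega>) \<partial>P) +
         (LINT v:{r<..u}|lborel. (\<integral>\<omega>. indicator F \<omega> * H v (W v \<omega>) \<partial>P))"
    and F: "F \<in> sets (FF s)"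
begin

lemma killed_C_nonneg: "0 \<le> C"
  using G_bound[of s 0] st by linarith

lemma killed_F_events [measurable]: "F \<in> events" using F by (rule sets_FF)

definition grid :: "nat \<Rightarrow> nat \<Rightarrow> real" where "grid n k = s + real k * ((t - s) / 2 ^ n)"

text \<open>The raised level \<open>c + \<epsilon>\<close> absorbs the times between grid points: staying above \<open>c + \<epsilon>\<close> on all grids implies staying
above \<open>c\<close>, and \<open>\<epsilon>\<close> is sent to \<open>0\<close> last. Grid times are compared strictly with \<open>v\<close>, so the
event is known just before \<open>v\<close> and is constant for \<open>v\<close> between two grid points.\<close>

definition above_on_grid :: "real \<Rightarrow> nat \<Rightarrow> real \<Rightarrow> 'a set" where
  "above_on_grid \<epsilon> n v = {\<omega>\<in>space P. \<forall>k\<in>{..2 ^ n}. grid n k < v \<longrightarrow> c + \<epsilon> < W (grid n k) \<omega>}"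

lemma grid_less_iff: "grid n j < grid n k \<longleftrightarrow> j < k"
proof -
  have "0 < (t - s) / 2 ^ n" using st by simp
  then show ?thesis unfolding grid_def add_less_cancel_left by (simp only: mult_less_cancel_right_pos of_nat_less_iff)
qed

lemma grid_ge: "s \<le> grid n k" using st by (simp add: grid_def)

lemma grid_0: "grid n 0 = s" by (simp add: grid_def)

lemma grid_last: "grid n (2 ^ n) = t" by (simp add: grid_def)

lemma grid_le: "k \<le> 2 ^ n \<Longrightarrow> grid n k \<le> t"
  using grid_less_iff[of n "2^n" k] grid_last[of n] by (metis leD le_less_linear)

lemma W_grid [measurable]: "W (grid n k) \<in> borel_measurable P"
  using grid_ge[of n k] s by (intro W_measurable) simp

lemma above_on_grid_FF: "(\<And>k. k \<le> 2 ^ n \<Longrightarrow> grid n k < v \<Longrightarrow> grid n k \<le> u) \<Longrightarrow> above_on_grid \<epsilon> n v \<in> sets (FF u)"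
proof -
  assume *: "\<And>k. k \<le> 2 ^ n \<Longrightarrow> grid n k < v \<Longrightarrow> grid n k \<le> u"
  have "{\<omega>\<in>space (FF u). \<forall>k\<in>{..2 ^ n}. grid n k < v \<longrightarrow> c + \<epsilon> < W (grid n k) \<omega>} \<in> sets (FF u)"
  proof (rule sets.sets_Collect_finite_All)
    fix k :: nat assume k: "k \<in> {..2 ^ n}"
    show "{\<omega> \<in> space (FF u). grid n k < v \<longrightarrow> c + \<epsilon> < W (grid n k) \<omega>} \<in> sets (FF u)"
    proof (cases "grid n k < v")
      case True
      have [measurable]: "W (grid n k) \<in> borel_measurable (FF u)"
        using True k * grid_ge[of n k] s by (intro W_measurable_FF) auto
      show ?thesis by measurable
    next
      case False
      then have eq: "{\<omega> \<in> space (FF u). grid n k < v \<longrightarrow> c + \<epsilon> < W (grid n k) \<omega>} = space (FF u)" by auto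
      show ?thesis unfolding eq by (rule sets.top)
    qed
  qed simp
  then show ?thesis unfolding above_on_grid_def by (simp only: space_FF)
qed

lemma above_on_grid_events [measurable]: "above_on_grid \<epsilon> n v \<in> events"
  using sets_FF[OF above_on_grid_FF[of n v v]] by auto

lemma above_on_grid_joint: "(\<lambda>p. indicator (above_on_grid \<epsilon> n (fst p)) (snd p) :: real) \<in> borel_measurable (borel \<Otimes>\<^sub>M P)"
proof -
  have "(\<lambda>p. indicator {p\<in>space (borel \<Otimes>\<^sub>M P). \<forall>k\<in>{..2 ^ n}. grid n k < fst p \<longrightarrow> c + \<epsilon> < W (grid n k) (snd p)} p :: real) \<in> borel_measurable (borel \<Otimes>\<^sub>M P)"
    by measurable
  then show ?thesis
    by (rule measurable_cong[THEN iffD1, rotated]) (auto simp: above_on_grid_def indicator_def space_pair_measure)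
qed

lemma killed_H_integrable:
  assumes B: "(\<lambda>p. indicator (B (fst p)) (snd p) :: real) \<in> borel_measurable (borel \<Otimes>\<^sub>M P)" and ab: "s \<le> a" "b \<le> t"
  shows "set_integrable lborel {a<..b} (\<lambda>v. \<integral>\<omega>. indicator (B v) \<omega> * H v (W v \<omega>) \<partial>P)"
    and "\<And>v. v \<in> {a<..b} \<Longrightarrow> \<bar>\<integral>\<omega>. indicator (B v) \<omega> * H v (W v \<omega>) \<partial>P\<bar> \<le> C"
    and "\<And>v. v \<in> {a<..b} \<Longrightarrow> (\<lambda>\<omega>. indicator (B v) \<omega> * H v (W v \<omega>)) \<in> borel_measurable P"
proof -
  note W_joint[measurable] B[measurable]
  have m: "(\<lambda>p. indicator (B (fst p)) (snd p) * H (fst p) (W (max 0 (fst p)) (snd p))) \<in> borel_measurable (borel \<Otimes>\<^sub>M P)"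
  proof -
    have "(\<lambda>p. (fst p, W (max 0 (fst p)) (snd p))) \<in> measurable (borel \<Otimes>\<^sub>M P) (borel \<Otimes>\<^sub>M borel)" by measurable
    from measurable_compose[OF this H_meas] have [measurable]:
      "(\<lambda>p. H (fst p) (W (max 0 (fst p)) (snd p))) \<in> borel_measurable (borel \<Otimes>\<^sub>M P)" by simp
    show ?thesis by measurable
  qed
  then have m': "(\<lambda>v. \<integral>\<omega>. indicator (B v) \<omega> * H v (W (max 0 v) \<omega>) \<partial>P) \<in> borel_measurable borel"
    using borel_measurable_lebesgue_integral[of "\<lambda>v \<omega>. indicator (B v) \<omega> * H v (W (max 0 v) \<omega>)" borel] by (simp add: case_prod_beta)
  have ms: "(\<lambda>\<omega>. indicator (B v) \<omega> * H v (W (max 0 v) \<omega>)) \<in> borel_measurable P" for v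
    using measurable_compose[OF measurable_Pair1'[of v borel P] m] by simp
  show bnd: "\<bar>\<integral>\<omega>. indicator (B v) \<omega> * H v (W v \<omega>) \<partial>P\<bar> \<le> C" if v: "v \<in> {a<..b}" for v
  proof -
    have "\<bar>\<integral>\<omega>. indicator (B v) \<omega> * H v (W v \<omega>) \<partial>P\<bar> \<le> (\<integral>\<omega>. C \<partial>P)"
      using H_bound[of v] v ab killed_C_nonneg
      by (intro order_trans[OF integral_abs_bound] integral_mono') (auto simp: indicator_def)
    then show ?thesis by (simp add: prob_space)
  qed
  show "(\<lambda>\<omega>. indicator (B v) \<omega> * H v (W v \<omega>)) \<in> borel_measurable P" if "v \<in> {a<..b}" for v
    using ms[of v] that ab s by (simp add: max_def)
  have "set_integrable lborel {a<..b} (\<lambda>v. \<integral>\<omega>. indicator (B v) \<omega> * H v (W (max 0 v) \<omega>) \<partial>P)"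
    unfolding set_integrable_def
  proof (rule Bochner_Integration.integrable_bound)
    show "integrable lborel (\<lambda>v. C * indicator {a<..b} v)" by (rule integrable_const_Ioc)
    show "(\<lambda>v. indicat_real {a<..b} v *\<^sub>R (\<integral>\<omega>. indicator (B v) \<omega> * H v (W (max 0 v) \<omega>) \<partial>P)) \<in> borel_measurable lborel"
      using m' by measurable
    show "AE v in lborel. norm (indicat_real {a<..b} v *\<^sub>R (\<integral>\<omega>. indicator (B v) \<omega> * H v (W (max 0 v) \<omega>) \<partial>P)) \<le> norm (C * indicator {a<..b} v)"
      using bnd ab s killed_C_nonneg by (intro AE_I2) (auto simp: indicator_def max_def)
  qed
  then show "set_integrable lborel {a<..b} (\<lambda>v. \<integral>\<omega>. indicator (B v) \<omega> * H v (W v \<omega>) \<partial>P)"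
    by (rule set_integrable_cong[THEN iffD1, rotated -1]) (use ab s in \<open>auto simp: max_def\<close>)
qed

definition osc :: "nat \<Rightarrow> 'a \<Rightarrow> real" where
  "osc n \<omega> = Max ((\<lambda>j. \<bar>W (grid n (Suc j)) \<omega> - W (grid n j) \<omega>\<bar>) ` {..<2 ^ n})"

lemma osc_measurable [measurable]: "osc n \<in> borel_measurable P"
  unfolding osc_def by measurable

lemma osc_ge: "j < 2 ^ n \<Longrightarrow> \<bar>W (grid n (Suc j)) \<omega> - W (grid n j) \<omega>\<bar> \<le> osc n \<omega>"
  unfolding osc_def by (intro Max_ge) auto

lemma osc_nonneg: "0 \<le> osc n \<omega>"
  using osc_ge[of 0 n \<omega>] abs_ge_zero order_trans by fastforce

lemma mesh_LIMSEQ: "(\<lambda>n. (t - s) / 2 ^ n) \<longlonglongrightarrow> 0"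
  using LIMSEQ_divide_realpow_zero[of 2 "t - s"] by simp

lemma osc_LIMSEQ: "(\<lambda>n. osc n \<omega>) \<longlonglongrightarrow> 0"
proof (rule LIMSEQ_I)
  fix e :: real assume e: "0 < e"
  have "uniformly_continuous_on {s..t} (\<lambda>x. W x \<omega>)"
    by (intro compact_uniformly_continuous continuous_on_subset[OF W_cont]) (use s in auto)
  then obtain d where d: "0 < d" "\<And>x y. x \<in> {s..t} \<Longrightarrow> y \<in> {s..t} \<Longrightarrow> dist y x < d \<Longrightarrow> dist (W y \<omega>) (W x \<omega>) < e"
    using e unfolding uniformly_continuous_on_def by meson
  obtain N where N: "\<And>n. N \<le> n \<Longrightarrow> norm ((t - s) / 2 ^ n - 0) < d"
    using LIMSEQ_D[OF mesh_LIMSEQ d(1)] by auto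
  show "\<exists>N. \<forall>n\<ge>N. norm (osc n \<omega> - 0) < e"
  proof (intro exI allI impI)
    fix n assume "N \<le> n"
    then have dn: "(t - s) / 2 ^ n < d" using N[of n] st by simp
    have "osc n \<omega> < e" unfolding osc_def
    proof (subst Max_less_iff)
      show "\<forall>a\<in>(\<lambda>j. \<bar>W (grid n (Suc j)) \<omega> - W (grid n j) \<omega>\<bar>) ` {..<2 ^ n}. a < e"
      proof safe
        fix j :: nat assume j: "j < 2 ^ n"
        have "dist (W (grid n (Suc j)) \<omega>) (W (grid n j) \<omega>) < e"
        proof (rule d)
          show "grid n j \<in> {s..t}" "grid n (Suc j) \<in> {s..t}" using j grid_ge grid_le by auto
          show "dist (grid n (Suc j)) (grid n j) < d" 
          proof -
            have "grid n (Suc j) - grid n j = (t - s) / 2 ^ n" by (simp add: grid_def distrib_right add_divide_distrib)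
            then show ?thesis using dn st by (simp add: dist_real_def)
          qed
        qed
        then show "\<bar>W (grid n (Suc j)) \<omega> - W (grid n j) \<omega>\<bar> < e" by (simp add: dist_real_def)
      qed
    qed (auto simp: lessThan_empty_iff)
    then show "norm (osc n \<omega> - 0) < e" using osc_nonneg[of n \<omega>] by simp
  qed
qed

lemma G_grid_integrable:
  assumes k: "k \<le> 2 ^ n" and [measurable]: "B \<in> events"
  shows "integrable P (\<lambda>\<omega>. indicator B \<omega> * G (grid n k) (W (grid n k) \<omega>))"
  using G_bound[OF grid_ge grid_le[OF k]] killed_C_nonneg
  by (intro integrable_const_bound[where B=C]) (auto simp: indicator_def)

text \<open>Optional stopping along a finite grid: one step of the assumed identity is applied on the event that
the path has not yet been seen below the level, and the part where it is first seen below is split off. The sum collects these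
stopped contributions.\<close>

lemma killed_identity_grid:
  assumes "k \<le> 2 ^ n"
  shows "(\<integral>\<omega>. indicator (F \<inter> above_on_grid \<epsilon> n (grid n (Suc k))) \<omega> * G (grid n k) (W (grid n k) \<omega>) \<partial>P) +
     (\<Sum>j<k. \<integral>\<omega>. indicator (F \<inter> (above_on_grid \<epsilon> n (grid n (Suc j)) - above_on_grid \<epsilon> n (grid n (Suc (Suc j))))) \<omega> * G (grid n (Suc j)) (W (grid n (Suc j)) \<omega>) \<partial>P)
    = (\<integral>\<omega>. indicator (F \<inter> above_on_grid \<epsilon> n (grid n 1)) \<omega> * G s (W s \<omega>) \<partial>P) +
      (LINT v:{s<..grid n k}|lborel. \<integral>\<omega>. indicator (F \<inter> above_on_grid \<epsilon> n v) \<omega> * H v (W v \<omega>) \<partial>P)"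
  using assms
proof (induction k)
  case 0
  then show ?case by (simp add: grid_0 set_lebesgue_integral_def)
next
  case (Suc k)
  define E where "E j = above_on_grid \<epsilon> n (grid n (Suc j))" for j
  have k: "k \<le> 2 ^ n" "Suc k \<le> 2 ^ n" using Suc by auto
  have EFF: "F \<inter> E k \<in> sets (FF (grid n k))"
    using mono[OF grid_ge[of n k]] F unfolding E_def
    by (intro sets.Int above_on_grid_FF) (auto simp: grid_less_iff not_less dest!: less_Suc_eq_le[THEN iffD1] intro: leI order.strict_implies_order)
  have sub: "E (Suc k) \<subseteq> E k"
    unfolding E_def above_on_grid_def using grid_less_iff[of n "Suc k" "Suc (Suc k)"] by auto
  have ind: "indicator (F \<inter> E k) \<omega> = (indicator (F \<inter> E (Suc k)) \<omega> + indicator (F \<inter> (E k - E (Suc k))) \<omega> :: real)" for \<omega>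
    using sub by (auto simp: indicator_def)
  have [measurable]: "E j \<in> events" for j unfolding E_def by measurable
  note I = G_grid_integrable[OF k(2)]
  have 1: "(\<integral>\<omega>. indicator (F \<inter> E k) \<omega> * G (grid n (Suc k)) (W (grid n (Suc k)) \<omega>) \<partial>P) =
     (\<integral>\<omega>. indicator (F \<inter> E (Suc k)) \<omega> * G (grid n (Suc k)) (W (grid n (Suc k)) \<omega>) \<partial>P) +
     (\<integral>\<omega>. indicator (F \<inter> (E k - E (Suc k))) \<omega> * G (grid n (Suc k)) (W (grid n (Suc k)) \<omega>) \<partial>P)"
    unfolding ind distrib_right by (intro Bochner_Integration.integral_add I) measurable
  have 2: "(\<integral>\<omega>. indicator (F \<inter> E k) \<omega> * G (grid n (Suc k)) (W (grid n (Suc k)) \<omega>) \<partial>P) =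
     (\<integral>\<omega>. indicator (F \<inter> E k) \<omega> * G (grid n k) (W (grid n k) \<omega>) \<partial>P) +
     (LINT v:{grid n k<..grid n (Suc k)}|lborel. (\<integral>\<omega>. indicator (F \<inter> E k) \<omega> * H v (W v \<omega>) \<partial>P))"
    using EFF grid_ge grid_le[OF k(2)] by (intro step) (auto simp: grid_less_iff)
  have 3: "(LINT v:{grid n k<..grid n (Suc k)}|lborel. (\<integral>\<omega>. indicator (F \<inter> E k) \<omega> * H v (W v \<omega>) \<partial>P)) =
     (LINT v:{grid n k<..grid n (Suc k)}|lborel. (\<integral>\<omega>. indicator (F \<inter> above_on_grid \<epsilon> n v) \<omega> * H v (W v \<omega>) \<partial>P))"
  proof (intro set_lebesgue_integral_cong allI impI)
    fix v assume v: "v \<in> {grid n k<..grid n (Suc k)}"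
    have "grid n j < v \<longleftrightarrow> grid n j < grid n (Suc k)" for j
      using v grid_less_iff[of n j "Suc k"] grid_less_iff[of n k j] by (auto simp: less_Suc_eq_le not_less) 
    then have "E k = above_on_grid \<epsilon> n v" by (simp add: E_def above_on_grid_def)
    then show "(\<integral>\<omega>. indicator (F \<inter> E k) \<omega> * H v (W v \<omega>) \<partial>P) = (\<integral>\<omega>. indicator (F \<inter> above_on_grid \<epsilon> n v) \<omega> * H v (W v \<omega>) \<partial>P)" by simp
  qed simp
  have 4: "(LINT v:{s<..grid n (Suc k)}|lborel. \<integral>\<omega>. indicator (F \<inter> above_on_grid \<epsilon> n v) \<omega> * H v (W v \<omega>) \<partial>P) =
    (LINT v:{s<..grid n k}|lborel. \<integral>\<omega>. indicator (F \<inter> above_on_grid \<epsilon> n v) \<omega> * H v (W v \<omega>) \<partial>P) +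
    (LINT v:{grid n k<..grid n (Suc k)}|lborel. \<integral>\<omega>. indicator (F \<inter> above_on_grid \<epsilon> n v) \<omega> * H v (W v \<omega>) \<partial>P)"
  proof -
    have un: "{s<..grid n (Suc k)} = {s<..grid n k} \<union> {grid n k<..grid n (Suc k)}"
      using grid_ge[of n k] grid_less_iff[of n k "Suc k"] by auto
    have [measurable]: "(\<lambda>p. indicator (F \<inter> above_on_grid \<epsilon> n (fst p)) (snd p) :: real) \<in> borel_measurable (borel \<Otimes>\<^sub>M P)"
      using above_on_grid_joint[measurable] unfolding indicator_inter_arith by measurable
    show ?thesis unfolding un
      by (intro set_integral_Un killed_H_integrable) (use grid_ge grid_le k in auto)
  qed
  show ?case using Suc.IH[OF k(1)] 1 2 3 4 unfolding E_def sum.lessThan_Suc by linarith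
qed

text \<open>When the path is first seen below \<open>c + \<epsilon>\<close> it was above it one grid point earlier, so it lies within
\<open>\<epsilon>\<close> plus its oscillation of \<open>c\<close>, where \<open>G\<close> is small. The events in the sum are disjoint, so the bounds do not accumulate.\<close>

lemma killed_crossing_error:
  "\<bar>\<Sum>j<2 ^ n. \<integral>\<omega>. indicator (F \<inter> (above_on_grid \<epsilon> n (grid n (Suc j)) - above_on_grid \<epsilon> n (grid n (Suc (Suc j))))) \<omega> * G (grid n (Suc j)) (W (grid n (Suc j)) \<omega>) \<partial>P\<bar>
   \<le> (\<integral>\<omega>. min C (L * (\<bar>\<epsilon>\<bar> + osc n \<omega>)) \<partial>P)" (is "\<bar>\<Sum>j<_. ?I j\<bar> \<le> (\<integral>\<omega>. ?B \<omega> \<partial>P)")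
proof -
  define E where "E j = above_on_grid \<epsilon> n (grid n (Suc j))" for j
  have [measurable]: "E j \<in> events" for j unfolding E_def by measurable
  have B: "0 \<le> ?B \<omega>" "?B \<omega> \<le> C" for \<omega> using killed_C_nonneg L osc_nonneg[of n \<omega>] by auto
  have Bi: "integrable P (\<lambda>\<omega>. indicator A \<omega> * ?B \<omega>)" if [measurable]: "A \<in> events" for A
    using B killed_C_nonneg by (intro integrable_const_bound[where B=C]) (auto simp: indicator_def)
  have sub: "E (Suc j) \<subseteq> E j" for j
    unfolding E_def above_on_grid_def using grid_less_iff[of n "Suc j" "Suc (Suc j)"] by auto
  have pt: "\<bar>G (grid n (Suc j)) (W (grid n (Suc j)) \<omega>)\<bar> \<le> ?B \<omega>" if j: "j < 2 ^ n" and \<omega>: "\<omega> \<in> E j - E (Suc j)" for j \<omega>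
  proof -
    have jj: "s \<le> grid n (Suc j)" "grid n (Suc j) \<le> t" using grid_ge grid_le j by auto
    have "\<exists>k\<le>2 ^ n. grid n k < grid n (Suc (Suc j)) \<and> \<not> grid n k < grid n (Suc j) \<and> W (grid n k) \<omega> \<le> c + \<epsilon>"
      using \<omega> unfolding E_def above_on_grid_def by (auto simp: not_less) (meson not_less atMost_iff)
    then have 1: "W (grid n (Suc j)) \<omega> \<le> c + \<epsilon>"
      unfolding grid_less_iff by (metis less_antisym)
    have 2: "c + \<epsilon> < W (grid n j) \<omega>"
      using \<omega> j unfolding E_def above_on_grid_def by (auto simp: grid_less_iff)
    have "\<bar>W (grid n (Suc j)) \<omega> - c\<bar> \<le> \<bar>\<epsilon>\<bar> + osc n \<omega>" using 1 2 osc_ge[OF j, of \<omega>] by linarith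
    then have "\<bar>G (grid n (Suc j)) (W (grid n (Suc j)) \<omega>)\<bar> \<le> L * (\<bar>\<epsilon>\<bar> + osc n \<omega>)"
      using L by (intro order_trans[OF G_lip[OF jj]] mult_left_mono)
    with G_bound[OF jj] show ?thesis by simp
  qed
  have "\<bar>\<Sum>j<2 ^ n. ?I j\<bar> \<le> (\<Sum>j<2 ^ n. \<bar>?I j\<bar>)" by (rule sum_abs)
  also have "\<dots> \<le> (\<Sum>j<2 ^ n. \<integral>\<omega>. indicator (E j - E (Suc j)) \<omega> * ?B \<omega> \<partial>P)"
  proof (intro sum_mono)
    fix j :: nat assume j: "j \<in> {..<2 ^ n}"
    show "\<bar>?I j\<bar> \<le> (\<integral>\<omega>. indicator (E j - E (Suc j)) \<omega> * ?B \<omega> \<partial>P)"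
      unfolding E_def[symmetric] using pt[of j] j
      by (intro order_trans[OF integral_abs_bound] integral_mono' Bi) (auto simp: indicator_def killed_C_nonneg L osc_nonneg)
  qed
  also have "\<dots> = (\<integral>\<omega>. (\<Sum>j<2 ^ n. indicator (E j - E (Suc j)) \<omega> * ?B \<omega>) \<partial>P)"
    by (subst Bochner_Integration.integral_sum) (auto intro: Bi)
  also have "\<dots> \<le> (\<integral>\<omega>. ?B \<omega> \<partial>P)"
  proof (rule integral_mono')
    show "integrable P ?B" using B killed_C_nonneg by (intro integrable_const_bound[where B=C]) auto
    fix \<omega>
    have "(\<Sum>j<2 ^ n. indicator (E j - E (Suc j)) \<omega> * ?B \<omega>) = (\<Sum>j<2 ^ n. indicator (E j - E (Suc j)) \<omega>) * ?B \<omega>"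
      by (rule sum_distrib_right[symmetric])
    also have "(\<Sum>j<2 ^ n. indicator (E j - E (Suc j)) \<omega> :: real) = (\<Sum>j<2 ^ n. indicator (E j) \<omega> - indicator (E (Suc j)) \<omega>)"
      using sub by (intro sum.cong refl) (auto simp: indicator_def)
    also have "\<dots> = indicator (E 0) \<omega> - indicator (E (2 ^ n)) \<omega>" by (rule sum_lessThan_telescope')
    also have "\<dots> * ?B \<omega> \<le> 1 * ?B \<omega>" by (intro mult_right_mono B) (auto simp: indicator_def)
    finally show "(\<Sum>j<2 ^ n. indicator (E j - E (Suc j)) \<omega> * ?B \<omega>) \<le> ?B \<omega>" by simp
  qed (use B in auto)
  finally show ?thesis .
qed

lemma above_on_grid_decseq: "decseq (\<lambda>n. above_on_grid \<epsilon> n v)"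
proof (rule decseq_SucI)
  fix n
  have "grid n k = grid (Suc n) (2 * k)" for k by (simp add: grid_def)
  moreover have "2 * k \<le> 2 ^ Suc n" if "k \<le> 2 ^ n" for k :: nat using that by simp
  ultimately show "above_on_grid \<epsilon> (Suc n) v \<subseteq> above_on_grid \<epsilon> n v" unfolding above_on_grid_def by (auto simp del: power_Suc)
qed

definition above_on_grids :: "real \<Rightarrow> real \<Rightarrow> 'a set" where "above_on_grids \<epsilon> v = (\<Inter>n. above_on_grid \<epsilon> n v)"

lemma above_on_grids_events [measurable]: "above_on_grids \<epsilon> v \<in> events" unfolding above_on_grids_def by measurable

lemma indicator_above_on_grid_LIMSEQ: "(\<lambda>n. indicator (F \<inter> above_on_grid \<epsilon> n v) \<omega> :: real) \<longlonglongrightarrow> indicator (F \<inter> above_on_grids \<epsilon> v) \<omega>"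
proof -
  have "decseq (\<lambda>n. F \<inter> above_on_grid \<epsilon> n v)" using above_on_grid_decseq[of \<epsilon> v] by (auto simp: decseq_def)
  from LIMSEQ_indicator_decseq[OF this] show ?thesis by (simp add: above_on_grids_def)
qed

lemma above_on_grids_joint: "(\<lambda>p. indicator (F \<inter> above_on_grids \<epsilon> (fst p)) (snd p) :: real) \<in> borel_measurable (borel \<Otimes>\<^sub>M P)"
proof (rule borel_measurable_LIMSEQ_real)
  show "(\<lambda>p. indicator (F \<inter> above_on_grid \<epsilon> n (fst p)) (snd p) :: real) \<in> borel_measurable (borel \<Otimes>\<^sub>M P)" for n
    using above_on_grid_joint[measurable] unfolding indicator_inter_arith by measurable
qed (rule indicator_above_on_grid_LIMSEQ)

lemma killed_H_limit:
  fixes B :: "nat \<Rightarrow> real \<Rightarrow> 'a set"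
  assumes lim: "\<And>v \<omega>. v \<in> {s<..t} \<Longrightarrow> \<omega> \<in> space P \<Longrightarrow> (\<lambda>n. indicator (B n v) \<omega> :: real) \<longlonglongrightarrow> indicator (B' v) \<omega>"
    and m: "\<And>n. (\<lambda>p. indicator (B n (fst p)) (snd p) :: real) \<in> borel_measurable (borel \<Otimes>\<^sub>M P)"
    and m': "(\<lambda>p. indicator (B' (fst p)) (snd p) :: real) \<in> borel_measurable (borel \<Otimes>\<^sub>M P)"
  shows "(\<lambda>n. LINT v:{s<..t}|lborel. \<integral>\<omega>. indicator (B n v) \<omega> * H v (W v \<omega>) \<partial>P)
     \<longlonglongrightarrow> (LINT v:{s<..t}|lborel. \<integral>\<omega>. indicator (B' v) \<omega> * H v (W v \<omega>) \<partial>P)"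
  unfolding set_lebesgue_integral_def
proof (rule integral_dominated_convergence[where w="\<lambda>v. C * indicator {s<..t} v"])
  note I = killed_H_integrable[OF m, of s t] and I' = killed_H_integrable[OF m', of s t]
  show "(\<lambda>v. indicat_real {s<..t} v *\<^sub>R (\<integral>\<omega>. indicator (B' v) \<omega> * H v (W v \<omega>) \<partial>P)) \<in> borel_measurable lborel"
    using I'(1) st unfolding set_integrable_def by auto
  show "(\<lambda>v. indicat_real {s<..t} v *\<^sub>R (\<integral>\<omega>. indicator (B n v) \<omega> * H v (W v \<omega>) \<partial>P)) \<in> borel_measurable lborel" for n
    using I(1) st unfolding set_integrable_def by auto
  show "integrable lborel (\<lambda>v. C * indicator {s<..t} v)" by (rule integrable_const_Ioc)
  show "AE v in lborel. norm (indicat_real {s<..t} v *\<^sub>R (\<integral>\<omega>. indicator (B n v) \<omega> * H v (W v \<omega>) \<partial>P)) \<le> C * indicator {s<..t} v" for n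
    using I(2) st by (intro AE_I2) (auto simp: indicator_def)
  show "AE v in lborel. (\<lambda>n. indicat_real {s<..t} v *\<^sub>R (\<integral>\<omega>. indicator (B n v) \<omega> * H v (W v \<omega>) \<partial>P))
     \<longlonglongrightarrow> indicat_real {s<..t} v *\<^sub>R (\<integral>\<omega>. indicator (B' v) \<omega> * H v (W v \<omega>) \<partial>P)"
  proof (intro AE_I2)
    fix v
    show "(\<lambda>n. indicat_real {s<..t} v *\<^sub>R (\<integral>\<omega>. indicator (B n v) \<omega> * H v (W v \<omega>) \<partial>P))
     \<longlonglongrightarrow> indicat_real {s<..t} v *\<^sub>R (\<integral>\<omega>. indicator (B' v) \<omega> * H v (W v \<omega>) \<partial>P)"
    proof (cases "v \<in> {s<..t}")
      case True
      have "(\<lambda>n. \<integral>\<omega>. indicator (B n v) \<omega> * H v (W v \<omega>) \<partial>P) \<longlonglongrightarrow> (\<integral>\<omega>. indicator (B' v) \<omega> * H v (W v \<omega>) \<partial>P)"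
      proof (rule integral_dominated_convergence[where w="\<lambda>_. C"])
        show "AE \<omega> in P. norm (indicator (B n v) \<omega> * H v (W v \<omega>)) \<le> C" for n
          using H_bound[of v] True killed_C_nonneg by (intro AE_I2) (auto simp: indicator_def)
        show "AE \<omega> in P. (\<lambda>n. indicator (B n v) \<omega> * H v (W v \<omega>)) \<longlonglongrightarrow> indicator (B' v) \<omega> * H v (W v \<omega>)"
          using lim[OF True] by (intro AE_I2 tendsto_mult) auto
      qed (use I(3) I'(3) True in auto)
      then show ?thesis by (intro tendsto_scaleR tendsto_const)
    qed simp
  qed
qed

lemma killed_G_limit:
  fixes B :: "nat \<Rightarrow> 'a set"
  assumes lim: "\<And>\<omega>. \<omega> \<in> space P \<Longrightarrow> (\<lambda>n. indicator (B n) \<omega> :: real) \<longlonglongrightarrow> indicator B' \<omega>"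
    and [measurable]: "\<And>n. B n \<in> events" "B' \<in> events" and v: "s \<le> v" "v \<le> t"
  shows "(\<lambda>n. \<integral>\<omega>. indicator (B n) \<omega> * G v (W v \<omega>) \<partial>P) \<longlonglongrightarrow> (\<integral>\<omega>. indicator B' \<omega> * G v (W v \<omega>) \<partial>P)"
proof (rule integral_dominated_convergence[where w="\<lambda>_. C"])
  have [measurable]: "W v \<in> borel_measurable P" using v s by (intro W_measurable) auto
  show "(\<lambda>\<omega>. indicator B' \<omega> * G v (W v \<omega>)) \<in> borel_measurable P" "(\<lambda>\<omega>. indicator (B n) \<omega> * G v (W v \<omega>)) \<in> borel_measurable P" for n
    by measurable
  show "AE \<omega> in P. norm (indicator (B n) \<omega> * G v (W v \<omega>)) \<le> C" for n
    using G_bound[OF v] killed_C_nonneg by (intro AE_I2) (auto simp: indicator_def)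
  show "AE \<omega> in P. (\<lambda>n. indicator (B n) \<omega> * G v (W v \<omega>)) \<longlonglongrightarrow> indicator B' \<omega> * G v (W v \<omega>)"
    using lim by (intro AE_I2 tendsto_mult) auto
qed simp

lemma killed_identity_approx:
  assumes \<epsilon>: "0 < \<epsilon>"
  shows "\<bar>(\<integral>\<omega>. indicator (F \<inter> above_on_grids \<epsilon> (t + 1)) \<omega> * G t (W t \<omega>) \<partial>P) -
    (\<integral>\<omega>. indicator (F \<inter> {\<omega>\<in>space P. c + \<epsilon> < W s \<omega>}) \<omega> * G s (W s \<omega>) \<partial>P) -
    (LINT v:{s<..t}|lborel. \<integral>\<omega>. indicator (F \<inter> above_on_grids \<epsilon> v) \<omega> * H v (W v \<omega>) \<partial>P)\<bar> \<le> L * \<epsilon>"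
    (is "\<bar>?a - ?b - ?h\<bar> \<le> _")
proof -
  define a where "a n = (\<integral>\<omega>. indicator (F \<inter> above_on_grid \<epsilon> n (t + 1)) \<omega> * G t (W t \<omega>) \<partial>P)" for n
  define h where "h n = (LINT v:{s<..t}|lborel. \<integral>\<omega>. indicator (F \<inter> above_on_grid \<epsilon> n v) \<omega> * H v (W v \<omega>) \<partial>P)" for n
  have last: "above_on_grid \<epsilon> n (grid n (Suc (2 ^ n))) = above_on_grid \<epsilon> n (t + 1)" for n
    unfolding above_on_grid_def grid_less_iff using grid_le[of _ n] by force
  have first: "above_on_grid \<epsilon> n (grid n 1) = {\<omega>\<in>space P. c + \<epsilon> < W s \<omega>}" for n
    unfolding above_on_grid_def grid_less_iff by (auto simp: grid_0)
  have bnd: "\<bar>a n - ?b - h n\<bar> \<le> (\<integral>\<omega>. min C (L * (\<bar>\<epsilon>\<bar> + osc n \<omega>)) \<partial>P)" for n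
    using killed_identity_grid[of "2 ^ n" n \<epsilon>] killed_crossing_error[of \<epsilon> n] unfolding last first grid_last a_def h_def by linarith
  have a: "a \<longlonglongrightarrow> ?a" unfolding a_def
    using st by (intro killed_G_limit indicator_above_on_grid_LIMSEQ sets.Int) (auto intro: above_on_grid_events above_on_grids_events killed_F_events)
  have h: "h \<longlonglongrightarrow> ?h" unfolding h_def
    using above_on_grid_joint[measurable] by (intro killed_H_limit indicator_above_on_grid_LIMSEQ above_on_grids_joint) (simp_all add: indicator_inter_arith)
  have "(\<lambda>n. \<integral>\<omega>. min C (L * (\<bar>\<epsilon>\<bar> + osc n \<omega>)) \<partial>P) \<longlonglongrightarrow> (\<integral>\<omega>. min C (L * (\<bar>\<epsilon>\<bar> + 0)) \<partial>P)"
  proof (rule integral_dominated_convergence[where w="\<lambda>_. C"])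
    show "AE \<omega> in P. norm (min C (L * (\<bar>\<epsilon>\<bar> + osc n \<omega>))) \<le> C" for n
      using killed_C_nonneg L osc_nonneg by (intro AE_I2) auto
    show "AE \<omega> in P. (\<lambda>n. min C (L * (\<bar>\<epsilon>\<bar> + osc n \<omega>))) \<longlonglongrightarrow> min C (L * (\<bar>\<epsilon>\<bar> + 0))"
      by (intro AE_I2 tendsto_intros osc_LIMSEQ)
  qed measurable
  then have B: "(\<lambda>n. \<integral>\<omega>. min C (L * (\<bar>\<epsilon>\<bar> + osc n \<omega>)) \<partial>P) \<longlonglongrightarrow> min C (L * \<epsilon>)" using \<epsilon> by (simp add: prob_space)
  have "(\<lambda>n. \<bar>a n - ?b - h n\<bar>) \<longlonglongrightarrow> \<bar>?a - ?b - ?h\<bar>" by (intro tendsto_intros a h)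
  then have "\<bar>?a - ?b - ?h\<bar> \<le> min C (L * \<epsilon>)" using B bnd by (intro LIMSEQ_le) auto
  then show ?thesis by simp
qed

text \<open>If the minimum exceeds \<open>c\<close> it exceeds \<open>c + \<epsilon>\<close> for small \<open>\<epsilon>\<close>; otherwise the path is at most \<open>c\<close> somewhere, hence
below \<open>c + \<epsilon>\<close> at some nearby dyadic time before \<open>v\<close>. The truncation at \<open>t\<close> is there because no grid extends beyond \<open>t\<close>.\<close>

lemma above_on_grids_LIMSEQ:
  assumes v: "s < v" and \<omega>: "\<omega> \<in> space P"
  shows "(\<lambda>m. indicator (F \<inter> above_on_grids (1 / real (Suc m)) v) \<omega> :: real) \<longlonglongrightarrow> indicator (F \<inter> {\<omega>\<in>space P. c < rmin s (min v t) \<omega>}) \<omega>"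
proof (cases "c < rmin s (min v t) \<omega>")
  case True
  obtain r where r: "s \<le> r" "r \<le> min v t" "rmin s (min v t) \<omega> = W r \<omega>"
    "\<And>x. s \<le> x \<Longrightarrow> x \<le> min v t \<Longrightarrow> W r \<omega> \<le> W x \<omega>"
    using rmin_attained[of s "min v t" \<omega>] s v st by auto
  have "0 < W r \<omega> - c" using True r by simp
  then obtain N where N: "1 / real (Suc N) < W r \<omega> - c" using nat_approx_posE by blast
  have "\<omega> \<in> above_on_grids (1 / real (Suc m)) v" if m: "N \<le> m" for m
  proof -
    have "1 / real (Suc m) \<le> 1 / real (Suc N)" using m by (intro divide_left_mono) auto
    then have "c + 1 / real (Suc m) < W r \<omega>" using N by linarith
    then have "c + 1 / real (Suc m) < W (grid n k) \<omega>" if "k \<le> 2 ^ n" "grid n k < v" for n k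
      using r(4)[of "grid n k"] grid_ge grid_le that by force
    then show ?thesis using \<omega> by (auto simp: above_on_grids_def above_on_grid_def)
  qed
  then have "\<forall>\<^sub>F m in sequentially. indicator (F \<inter> above_on_grids (1 / real (Suc m)) v) \<omega> = (indicator (F \<inter> {\<omega>\<in>space P. c < rmin s (min v t) \<omega>}) \<omega> :: real)"
    using True \<omega> by (intro eventually_sequentiallyI[of N]) (auto simp: indicator_def)
  then show ?thesis by (rule tendsto_eventually)
next
  case False
  obtain r where r: "s \<le> r" "r \<le> v" "r \<le> t" "W r \<omega> \<le> c"
    using rmin_attained[of s "min v t" \<omega>] s v st False by (metis less_imp_le min.bounded_iff not_less)
  have "\<omega> \<notin> above_on_grids \<epsilon> v" if \<epsilon>: "0 < \<epsilon>" for \<epsilon>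
  proof -
    have "\<exists>n k. k \<le> 2 ^ n \<and> grid n k < v \<and> W (grid n k) \<omega> \<le> c + \<epsilon>"
    proof (cases "r = s")
      case True
      then show ?thesis using v r \<epsilon> by (intro exI[of _ 0]) (auto simp: grid_0)
    next
      case False
      then have rs: "s < r" using r by simp
      have "r \<in> {0..}" using r s by auto
      then obtain d where d: "0 < d" "\<And>x. x \<in> {0..} \<Longrightarrow> dist x r < d \<Longrightarrow> dist (W x \<omega>) (W r \<omega>) < \<epsilon>"
        using W_cont[of \<omega>] \<epsilon> unfolding continuous_on_iff by meson
      obtain n where n: "(t - s) / 2 ^ n < d"
        using LIMSEQ_D[OF mesh_LIMSEQ d(1)] using st by auto
      define \<delta> where "\<delta> = (t - s) / 2 ^ n"
      have \<delta>: "0 < \<delta>" using st by (simp add: \<delta>_def)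
      define k where "k = nat (\<lceil>(r - s) / \<delta>\<rceil> - 1)"
      have c1: "0 < (r - s) / \<delta>" using rs \<delta> by simp
      have kk: "real k < (r - s) / \<delta>" "(r - s) / \<delta> - 1 \<le> real k"
        using c1 unfolding k_def by linarith+
      have g1: "grid n k < r" using kk(1) \<delta> by (simp add: grid_def \<delta>_def[symmetric] field_simps)
      have g2: "r - \<delta> \<le> grid n k" using kk(2) \<delta> by (simp add: grid_def \<delta>_def[symmetric] field_simps)
      have "grid n k < grid n (2 ^ n)" using g1 r grid_last by simp
      then have k2: "k \<le> 2 ^ n" unfolding grid_less_iff by simp
      have "dist (W (grid n k) \<omega>) (W r \<omega>) < \<epsilon>"
        using g1 g2 n grid_ge[of n k] s by (intro d) (auto simp: dist_real_def \<delta>_def)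
      then have "W (grid n k) \<omega> \<le> c + \<epsilon>" using r unfolding dist_real_def by linarith
      with k2 g1 r show ?thesis by (intro exI[of _ n] exI[of _ k]) auto
    qed
    then show ?thesis unfolding above_on_grids_def above_on_grid_def by force
  qed
  then have "\<omega> \<notin> above_on_grids (1 / real (Suc m)) v" for m by simp
  then show ?thesis using False by (simp add: indicator_def)
qed

lemma rmin_indicator_joint: "(\<lambda>p. indicator (F \<inter> {\<omega>\<in>space P. s < fst p \<and> c < rmin s (min (fst p) t) \<omega>}) (snd p) :: real) \<in> borel_measurable (borel \<Otimes>\<^sub>M P)"
proof (rule borel_measurable_LIMSEQ_real)
  show "(\<lambda>p. indicator {s<..} (fst p) * indicator (F \<inter> above_on_grids (1 / real (Suc m)) (fst p)) (snd p) :: real) \<in> borel_measurable (borel \<Otimes>\<^sub>M P)" for m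
    using above_on_grids_joint[measurable] by measurable
  fix p :: "real \<times> 'a" assume "p \<in> space (borel \<Otimes>\<^sub>M P)"
  then have p: "snd p \<in> space P" by (auto simp: space_pair_measure)
  show "(\<lambda>m. indicator {s<..} (fst p) * indicator (F \<inter> above_on_grids (1 / real (Suc m)) (fst p)) (snd p) :: real) \<longlonglongrightarrow>
    indicator (F \<inter> {\<omega>\<in>space P. s < fst p \<and> c < rmin s (min (fst p) t) \<omega>}) (snd p)"
  proof (cases "s < fst p")
    case True
    then show ?thesis using above_on_grids_LIMSEQ[OF True p] by simp
  qed simp
qed

text \<open>Dynkin's formula survives killing at \<open>c\<close> because \<open>G\<close> vanishes there.\<close>

lemma killed_identity:
  "(\<integral>\<omega>. indicator (F \<inter> {\<omega>\<in>space P. c < rmin s t \<omega>}) \<omega> * G t (W t \<omega>) \<partial>P) =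
    (\<integral>\<omega>. indicator (F \<inter> {\<omega>\<in>space P. c < W s \<omega>}) \<omega> * G s (W s \<omega>) \<partial>P) +
    (LINT v:{s<..t}|lborel. \<integral>\<omega>. indicator (F \<inter> {\<omega>\<in>space P. c < rmin s v \<omega>}) \<omega> * H v (W v \<omega>) \<partial>P)"
proof -
  define e where "e m = 1 / real (Suc m)" for m
  have e: "0 < e m" for m by (simp add: e_def)
  have elim: "e \<longlonglongrightarrow> 0" using LIMSEQ_inverse_real_of_nat by (simp add: e_def[abs_def] divide_inverse)
  define a where "a m = (\<integral>\<omega>. indicator (F \<inter> above_on_grids (e m) (t + 1)) \<omega> * G t (W t \<omega>) \<partial>P)" for m
  define b where "b m = (\<integral>\<omega>. indicator (F \<inter> {\<omega>\<in>space P. c + e m < W s \<omega>}) \<omega> * G s (W s \<omega>) \<partial>P)" for m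
  define h where "h m = (LINT v:{s<..t}|lborel. \<integral>\<omega>. indicator (F \<inter> above_on_grids (e m) v) \<omega> * H v (W v \<omega>) \<partial>P)" for m
  have rm [measurable]: "rmin s v \<in> borel_measurable P" if "s \<le> v" for v
    using rmin_measurable_FF[of s v] s that by (intro measurable_FF) auto
  have [measurable]: "rmin s t \<in> borel_measurable P" "W s \<in> borel_measurable P" using st s by (auto intro: rm W_measurable)
  have a: "a \<longlonglongrightarrow> (\<integral>\<omega>. indicator (F \<inter> {\<omega>\<in>space P. c < rmin s t \<omega>}) \<omega> * G t (W t \<omega>) \<partial>P)"
    unfolding a_def using above_on_grids_LIMSEQ[of "t + 1"] st
    by (intro killed_G_limit) (simp_all add: e_def)
  have b: "b \<longlonglongrightarrow> (\<integral>\<omega>. indicator (F \<inter> {\<omega>\<in>space P. c < W s \<omega>}) \<omega> * G s (W s \<omega>) \<partial>P)"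
    unfolding b_def
  proof (intro killed_G_limit)
    fix \<omega> assume \<omega>: "\<omega> \<in> space P"
    show "(\<lambda>n. indicator (F \<inter> {\<omega> \<in> space P. c + e n < W s \<omega>}) \<omega> :: real) \<longlonglongrightarrow> indicator (F \<inter> {\<omega> \<in> space P. c < W s \<omega>}) \<omega>"
    proof (cases "c < W s \<omega>")
      case True
      then have "\<forall>\<^sub>F m in sequentially. e m < W s \<omega> - c" using elim by (intro order_tendstoD) auto
      then have "\<forall>\<^sub>F m in sequentially. indicator (F \<inter> {\<omega> \<in> space P. c + e m < W s \<omega>}) \<omega> =
          (indicator (F \<inter> {\<omega> \<in> space P. c < W s \<omega>}) \<omega> :: real)"
        by eventually_elim (use True in \<open>auto simp: indicator_def\<close>)
      then show ?thesis by (rule tendsto_eventually)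
    next
      case False
      have nl: "\<not> c + e m < W s \<omega>" for m using e[of m] False by linarith
      have "\<omega> \<notin> F \<inter> {\<omega> \<in> space P. c + e m < W s \<omega>}" for m using nl by blast
      moreover have "\<omega> \<notin> F \<inter> {\<omega> \<in> space P. c < W s \<omega>}" using False by blast
      ultimately show ?thesis by simp
    qed
  qed (use st in auto)
  have h: "h \<longlonglongrightarrow> (LINT v:{s<..t}|lborel. \<integral>\<omega>. indicator (F \<inter> {\<omega>\<in>space P. s < v \<and> c < rmin s (min v t) \<omega>}) \<omega> * H v (W v \<omega>) \<partial>P)"
    unfolding h_def
  proof (intro killed_H_limit above_on_grids_joint rmin_indicator_joint)
    fix v \<omega> assume "v \<in> {s<..t}" "\<omega> \<in> space P"
    then show "(\<lambda>n. indicator (F \<inter> above_on_grids (e n) v) \<omega> :: real) \<longlonglongrightarrow> indicator (F \<inter> {\<omega> \<in> space P. s < v \<and> c < rmin s (min v t) \<omega>}) \<omega>"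
      using above_on_grids_LIMSEQ[of v \<omega>] by (simp add: e_def)
  qed
  have heq: "(LINT v:{s<..t}|lborel. \<integral>\<omega>. indicator (F \<inter> {\<omega>\<in>space P. s < v \<and> c < rmin s (min v t) \<omega>}) \<omega> * H v (W v \<omega>) \<partial>P) =
    (LINT v:{s<..t}|lborel. \<integral>\<omega>. indicator (F \<inter> {\<omega>\<in>space P. c < rmin s v \<omega>}) \<omega> * H v (W v \<omega>) \<partial>P)"
    by (intro set_lebesgue_integral_cong) (auto simp: min_def)
  have "(\<lambda>m. \<bar>a m - b m - h m\<bar>) \<longlonglongrightarrow> 0"
  proof (rule tendsto_sandwich[of "\<lambda>_. 0" _ _ "\<lambda>m. L * e m"])
    show "\<forall>\<^sub>F m in sequentially. \<bar>a m - b m - h m\<bar> \<le> L * e m"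
      using killed_identity_approx[OF e] unfolding a_def b_def h_def by simp
    show "(\<lambda>m. L * e m) \<longlonglongrightarrow> 0" using tendsto_mult_left[OF elim, of L] by simp
  qed auto
  then have l0: "(\<lambda>m. a m - b m - h m) \<longlonglongrightarrow> 0" by (rule tendsto_rabs_zero_cancel)
  from LIMSEQ_unique[OF tendsto_diff[OF tendsto_diff[OF a b] h] l0]
  show ?thesis unfolding heq by (simp only: diff_diff_eq right_minus_eq)
qed

end

end

section \<open>The joint law of the past and of the endpoint\<close>

context cont_bm begin

lemma W_1_nonzero: "AE \<omega> in P. W 1 \<omega> \<noteq> 0"
proof -
  have [measurable]: "W 1 \<in> borel_measurable P" by (intro W_measurable) simp
  have "AE x in distr P borel (\<lambda>\<omega>. W 1 \<omega> - W 0 \<omega>). x \<noteq> 0"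
    unfolding incr_distr[of 0 1, simplified]
    by (subst AE_density) (auto intro: AE_mp[OF AE_lborel_singleton[of 0]])
  then show ?thesis by (subst (asm) AE_distr_iff) (auto simp: W_0)
qed

text \<open>The total mass of the killed process is conserved after the transform by \<open>kern\<close>.\<close>

lemma kern_killed:
  assumes st: "0 \<le> s" "s < t" "t < 1" and F: "F \<in> sets (FF s)"
  shows "(\<integral>\<omega>. indicator (F \<inter> {\<omega>\<in>space P. y / 2 < rmin s t \<omega>}) \<omega> * kern y t (W t \<omega>) \<partial>P) =
    (\<integral>\<omega>. indicator (F \<inter> {\<omega>\<in>space P. y / 2 < W s \<omega>}) \<omega> * kern y s (W s \<omega>) \<partial>P)"
proof -
  have mon: "1 / sqrt (1 - v) \<le> 1 / sqrt (1 - t)" "2 / (1 - v) \<le> 2 / (1 - t)" if "v \<le> t" for v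
    using that st by (auto intro!: divide_left_mono mult_pos_pos)
  have "(\<integral>\<omega>. indicator (F \<inter> {\<omega>\<in>space P. y / 2 < rmin s t \<omega>}) \<omega> * kern y t (W t \<omega>) \<partial>P) =
    (\<integral>\<omega>. indicator (F \<inter> {\<omega>\<in>space P. y / 2 < W s \<omega>}) \<omega> * kern y s (W s \<omega>) \<partial>P) +
    (LINT v:{s<..t}|lborel. \<integral>\<omega>. indicator (F \<inter> {\<omega>\<in>space P. y / 2 < rmin s v \<omega>}) \<omega> * 0 \<partial>P)"
  proof (rule killed_identity[where C="1 / sqrt (1 - t)" and L="2 / (1 - t)" and H="\<lambda>_ _. 0"])
    fix v w :: real assume v: "s \<le> v" "v \<le> t"
    then have v1: "v < 1" using st by simp
    show "\<bar>kern y v w\<bar> \<le> 1 / sqrt (1 - t)"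
      using abs_kern_le[OF v1, of y w] mon(1)[OF v(2)] by linarith
    have "2 / (1 - v) * \<bar>w - y / 2\<bar> \<le> 2 / (1 - t) * \<bar>w - y / 2\<bar>" by (rule mult_right_mono[OF mon(2)[OF v(2)]]) simp
    then show "\<bar>kern y v w\<bar> \<le> 2 / (1 - t) * \<bar>w - y / 2\<bar>"
      using abs_kern_le_dist[OF v1, of y w] by linarith
  next
    fix r u F assume r: "s \<le> r" "r < u" "u \<le> t" "F \<in> sets (FF r)"
    have "(\<integral>\<omega>. indicator F \<omega> * kern y u (W u \<omega>) \<partial>P) = (\<integral>\<omega>. indicator F \<omega> * kern y r (W r \<omega>) \<partial>P)"
      using r st by (intro markov_integral[where C="1 / sqrt (1 - u)"] kern_one_step abs_kern_le) auto
    then show "(\<integral>\<omega>. indicator F \<omega> * kern y u (W u \<omega>) \<partial>P) = (\<integral>\<omega>. indicator F \<omega> * kern y r (W r \<omega>) \<partial>P) +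
      (LINT v:{r<..u}|lborel. (\<integral>\<omega>. indicator F \<omega> * 0 \<partial>P))"
      by (simp add: set_lebesgue_integral_def)
  qed (use st F in auto)
  then show ?thesis by (simp add: set_lebesgue_integral_def)
qed

lemma mult_kern_killed:
  assumes st: "0 \<le> s" "s < t" "t < 1" and F: "F \<in> sets (FF s)"
  shows "(\<integral>\<omega>. indicator (F \<inter> {\<omega>\<in>space P. y / 2 < rmin s t \<omega>}) \<omega> * ((W t \<omega> - y / 2) * kern y t (W t \<omega>)) \<partial>P) =
    (\<integral>\<omega>. indicator (F \<inter> {\<omega>\<in>space P. y / 2 < W s \<omega>}) \<omega> * ((W s \<omega> - y / 2) * kern y s (W s \<omega>)) \<partial>P) +
    (LINT v:{s<..t}|lborel. \<integral>\<omega>. indicator (F \<inter> {\<omega>\<in>space P. y / 2 < rmin s v \<omega>}) \<omega> * kern' y v (W v \<omega>) \<partial>P)"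
proof (rule killed_identity[where C="max (2 + \<bar>y\<bar> / sqrt (1 - t)) (2 / (1 - t))" and L="1 / sqrt (1 - t)"])
  have mon: "1 / sqrt (1 - v) \<le> 1 / sqrt (1 - t)" "2 / (1 - v) \<le> 2 / (1 - t)" "\<bar>y\<bar> / sqrt (1 - v) \<le> \<bar>y\<bar> / sqrt (1 - t)" if "v \<le> t" for v
    using that st by (auto intro!: divide_left_mono mult_pos_pos)
  fix v w :: real assume v: "s \<le> v" "v \<le> t"
  then have v1: "v < 1" using st by simp
  show "\<bar>(w - y / 2) * kern y v w\<bar> \<le> max (2 + \<bar>y\<bar> / sqrt (1 - t)) (2 / (1 - t))"
    using abs_mult_kern_le[OF v1, of w y] mon(3)[OF v(2)] by linarith
  show "\<bar>kern' y v w\<bar> \<le> max (2 + \<bar>y\<bar> / sqrt (1 - t)) (2 / (1 - t))"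
    using abs_kern'_le[OF v1, of y w] mon(2)[OF v(2)] by linarith
  have "\<bar>w - y / 2\<bar> * \<bar>kern y v w\<bar> \<le> \<bar>w - y / 2\<bar> * (1 / sqrt (1 - t))"
    using abs_kern_le[OF v1, of y w] mon(1)[OF v(2)] by (intro mult_left_mono) auto
  then show "\<bar>(w - y / 2) * kern y v w\<bar> \<le> 1 / sqrt (1 - t) * \<bar>w - y / 2\<bar>"
    by (simp add: abs_mult mult.commute)
next
  fix r u F assume r: "s \<le> r" "r < u" "u \<le> t" and F: "F \<in> sets (FF r)"
  have [measurable]: "W r \<in> borel_measurable P" using r st by (intro W_measurable) auto
  have [measurable]: "F \<in> events" using F by (rule sets_FF)
  have r1: "r < 1" using r st by simp
  have i: "integrable P (\<lambda>\<omega>. indicator F \<omega> * f (W r \<omega>))" if [measurable]: "f \<in> borel_measurable borel" and "\<And>x. \<bar>f x\<bar> \<le> C" for f :: "real \<Rightarrow> real" and C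
  proof (rule integrable_const_bound[where B=C])
    have "0 \<le> C" using that(2)[of 0] by linarith
    then show "AE \<omega> in P. norm (indicator F \<omega> * f (W r \<omega>)) \<le> C" using that(2) by (intro AE_I2) (auto simp: indicator_def)
  qed measurable
  have "(\<integral>\<omega>. indicator F \<omega> * ((W u \<omega> - y / 2) * kern y u (W u \<omega>)) \<partial>P) =
      (\<integral>\<omega>. indicator F \<omega> * ((W r \<omega> - y / 2) * kern y r (W r \<omega>) + (u - r) * kern' y r (W r \<omega>)) \<partial>P)"
    using r st F by (intro markov_integral[where C="2 + \<bar>y\<bar> / sqrt (1 - u)"] kern_one_step abs_mult_kern_le) auto
  also have "\<dots> = (\<integral>\<omega>. indicator F \<omega> * ((W r \<omega> - y / 2) * kern y r (W r \<omega>)) + (u - r) * (indicator F \<omega> * kern' y r (W r \<omega>)) \<partial>P)"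
    by (intro Bochner_Integration.integral_cong) (auto simp: algebra_simps)
  also have "\<dots> = (\<integral>\<omega>. indicator F \<omega> * ((W r \<omega> - y / 2) * kern y r (W r \<omega>)) \<partial>P) + (u - r) * (\<integral>\<omega>. indicator F \<omega> * kern' y r (W r \<omega>) \<partial>P)"
  proof (subst Bochner_Integration.integral_add)
    show "integrable P (\<lambda>\<omega>. indicator F \<omega> * ((W r \<omega> - y / 2) * kern y r (W r \<omega>)))"
      by (rule i[OF _ abs_mult_kern_le[OF r1]]) measurable
    show "integrable P (\<lambda>\<omega>. (u - r) * (indicator F \<omega> * kern' y r (W r \<omega>)))"
      by (intro integrable_mult_right i[OF _ abs_kern'_le[OF r1]]) measurable
  qed simp
  also have "(u - r) * (\<integral>\<omega>. indicator F \<omega> * kern' y r (W r \<omega>) \<partial>P) = (LINT v:{r<..u}|lborel. (\<integral>\<omega>. indicator F \<omega> * kern' y r (W r \<omega>) \<partial>P))"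
    using r by (simp add: set_lebesgue_integral_def measure_def)
  also have "\<dots> = (LINT v:{r<..u}|lborel. (\<integral>\<omega>. indicator F \<omega> * kern' y v (W v \<omega>) \<partial>P))"
  proof (intro set_lebesgue_integral_cong allI impI)
    fix v assume v: "v \<in> {r<..u}"
    show "(\<integral>\<omega>. indicator F \<omega> * kern' y r (W r \<omega>) \<partial>P) = (\<integral>\<omega>. indicator F \<omega> * kern' y v (W v \<omega>) \<partial>P)"
      using r st F v by (intro markov_integral[where C="2 / (1 - v)", symmetric] kern_one_step abs_kern'_le) auto
  qed simp
  finally show "(\<integral>\<omega>. indicator F \<omega> * ((W u \<omega> - y / 2) * kern y u (W u \<omega>)) \<partial>P) =
      (\<integral>\<omega>. indicator F \<omega> * ((W r \<omega> - y / 2) * kern y r (W r \<omega>)) \<partial>P) +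
      (LINT v:{r<..u}|lborel. (\<integral>\<omega>. indicator F \<omega> * kern' y v (W v \<omega>) \<partial>P))" .
qed (use st F in auto)

text \<open>For a positive endpoint this is the event \<open>\<xi> < q\<close> (see \<open>pos_last_eq\<close>); the running minimum makes it accessible to
\<open>killed_identity\<close>.\<close>

definition pos_last :: "real \<Rightarrow> 'a set" where
  "pos_last q = {\<omega>\<in>space P. 0 < W 1 \<omega> \<and> W 1 \<omega> / 2 < rmin q 1 \<omega>}"

lemma rmin_measurable: "0 \<le> q \<Longrightarrow> q \<le> v \<Longrightarrow> rmin q v \<in> borel_measurable P"
  using rmin_measurable_FF measurable_FF by blast

lemma pos_last_FF: "0 \<le> q \<Longrightarrow> q \<le> 1 \<Longrightarrow> pos_last q \<in> sets (FF 1)"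
proof -
  assume q: "0 \<le> q" "q \<le> 1"
  have [measurable]: "W 1 \<in> borel_measurable (FF 1)" "rmin q 1 \<in> borel_measurable (FF 1)"
    using q by (auto intro: W_adapted rmin_measurable_FF)
  have "{\<omega>\<in>space (FF 1). 0 < W 1 \<omega> \<and> W 1 \<omega> / 2 < rmin q 1 \<omega>} \<in> sets (FF 1)" by measurable
  then show ?thesis unfolding pos_last_def space_FF .
qed

lemma pos_last_events: "0 \<le> q \<Longrightarrow> q \<le> 1 \<Longrightarrow> pos_last q \<in> events"
  using pos_last_FF sets_FF by blast

lemma rmin_set_FF: "0 \<le> q \<Longrightarrow> q \<le> v \<Longrightarrow> {\<omega>\<in>space P. c < rmin q v \<omega>} \<in> sets (FF v)"
proof -
  assume "0 \<le> q" "q \<le> v"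
  then have [measurable]: "rmin q v \<in> borel_measurable (FF v)" by (rule rmin_measurable_FF)
  have "{\<omega>\<in>space (FF v). c < rmin q v \<omega>} \<in> sets (FF v)" by measurable
  then show ?thesis unfolding space_FF .
qed

lemma less_rmin_imp: "0 \<le> q \<Longrightarrow> q \<le> r \<Longrightarrow> r \<le> v \<Longrightarrow> c < rmin q v \<omega> \<Longrightarrow> c < W r \<omega>"
  using less_rmin_iff[of q v c \<omega>] by auto

lemma kern_nn_integral:
  assumes [measurable]: "A \<in> events" "W x \<in> borel_measurable P" and A: "\<And>\<omega>. \<omega> \<in> A \<Longrightarrow> y / 2 < W x \<omega>" and x: "x < 1" and y: "0 < y"
  shows "(\<integral>\<^sup>+\<omega>. indicator A \<omega> * ennreal (kern y x (W x \<omega>)) \<partial>P) = ennreal (\<integral>\<omega>. indicator A \<omega> * kern y x (W x \<omega>) \<partial>P)"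
proof -
  have "(\<integral>\<^sup>+\<omega>. indicator A \<omega> * ennreal (kern y x (W x \<omega>)) \<partial>P) = (\<integral>\<^sup>+\<omega>. ennreal (indicator A \<omega> * kern y x (W x \<omega>)) \<partial>P)"
    by (intro nn_integral_cong) (auto simp: indicator_def)
  also have "\<dots> = ennreal (\<integral>\<omega>. indicator A \<omega> * kern y x (W x \<omega>) \<partial>P)"
  proof (rule nn_integral_eq_integral)
    show "integrable P (\<lambda>\<omega>. indicator A \<omega> * kern y x (W x \<omega>))"
      using abs_kern_le[OF x] x by (intro integrable_const_bound[where B="1 / sqrt (1 - x)"]) (auto simp: indicator_def)
    show "AE \<omega> in P. 0 \<le> indicator A \<omega> * kern y x (W x \<omega>)"
      using kern_pos[OF x y] A by (intro AE_I2) (auto simp: indicator_def intro: less_imp_le)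
  qed
  finally show ?thesis .
qed

lemma kern_killed_nn:
  assumes qv: "0 \<le> q" "q \<le> v" "v < u" "u < 1" and F: "F \<in> sets (FF v)" and y: "0 < y"
  shows "(\<integral>\<^sup>+\<omega>. indicator (F \<inter> {\<omega>\<in>space P. y / 2 < rmin q u \<omega>}) \<omega> * ennreal (kern y u (W u \<omega>)) \<partial>P) =
    (\<integral>\<^sup>+\<omega>. indicator (F \<inter> {\<omega>\<in>space P. y / 2 < rmin q v \<omega>}) \<omega> * ennreal (kern y v (W v \<omega>)) \<partial>P)"
proof -
  define F' where "F' = F \<inter> {\<omega>\<in>space P. y / 2 < rmin q v \<omega>}"
  have F': "F' \<in> sets (FF v)"
    unfolding F'_def using F qv by (intro sets.Int rmin_set_FF)
  have F'e: "F' \<in> events" using F' by (rule sets_FF)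
  have e1: "F \<inter> {\<omega>\<in>space P. y / 2 < rmin q u \<omega>} = F' \<inter> {\<omega>\<in>space P. y / 2 < rmin v u \<omega>}"
    unfolding F'_def using less_rmin_split[of q v u] qv by auto
  have e2: "F \<inter> {\<omega>\<in>space P. y / 2 < rmin q v \<omega>} = F' \<inter> {\<omega>\<in>space P. y / 2 < W v \<omega>}"
    unfolding F'_def using less_rmin_imp[of q v v "y / 2"] qv by auto
  have "(\<integral>\<^sup>+\<omega>. indicator (F' \<inter> {\<omega>\<in>space P. y / 2 < rmin v u \<omega>}) \<omega> * ennreal (kern y u (W u \<omega>)) \<partial>P) =
     ennreal (\<integral>\<omega>. indicator (F' \<inter> {\<omega>\<in>space P. y / 2 < rmin v u \<omega>}) \<omega> * kern y u (W u \<omega>) \<partial>P)"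
    using qv y F'e less_rmin_imp[of v u u "y/2"] by (intro kern_nn_integral sets.Int F'e sets_FF[OF rmin_set_FF] W_measurable) auto
  moreover have "(\<integral>\<^sup>+\<omega>. indicator F' \<omega> * ennreal (kern y v (W v \<omega>)) \<partial>P) =
     ennreal (\<integral>\<omega>. indicator F' \<omega> * kern y v (W v \<omega>) \<partial>P)"
    using qv y F'e less_rmin_imp[of q v v "y/2"] by (intro kern_nn_integral W_measurable) (auto simp: F'_def)
  moreover have "(\<integral>\<omega>. indicator (F' \<inter> {\<omega>\<in>space P. y / 2 < rmin v u \<omega>}) \<omega> * kern y u (W u \<omega>) \<partial>P) =
    (\<integral>\<omega>. indicator (F' \<inter> {\<omega>\<in>space P. y / 2 < W v \<omega>}) \<omega> * kern y v (W v \<omega>) \<partial>P)"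
    using qv F' by (intro kern_killed) auto
  ultimately show ?thesis unfolding e1 e2[symmetric] F'_def[symmetric] using e2 by (simp add: F'_def[symmetric])
qed

text \<open>The reflected part of the transition density disappears as time tends to \<open>1\<close>, since it
concentrates at the origin and \<open>W\<^sub>1 \<noteq> 0\<close> almost surely.\<close>

lemma gauss_remainder:
  assumes u: "\<And>n. 0 \<le> u n" "\<And>n. u n < 1" "u \<longlonglongrightarrow> 1"
  shows "(\<lambda>n. \<integral>\<^sup>+\<omega>. ennreal (2 * (\<bar>W (u n) \<omega>\<bar> * gauss (1 - u n) (W (u n) \<omega>))) \<partial>P) \<longlonglongrightarrow> 0"
proof -
  have [measurable]: "W (u n) \<in> borel_measurable P" for n using u by (intro W_measurable)
  have bound: "\<bar>x\<bar> * gauss \<tau> x \<le> 2 * sqrt \<tau> / \<bar>x\<bar>" if "0 < \<tau>" for x \<tau> :: real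
  proof (cases "x = 0")
    case False
    have "\<bar>x\<bar> * gauss \<tau> x * \<bar>x\<bar> = x\<^sup>2 * gauss \<tau> x" by (simp add: power2_eq_square)
    also have "\<dots> \<le> 2 * sqrt \<tau>" by (rule sq_mult_gauss_le[OF that])
    finally show ?thesis using False by (simp add: pos_le_divide_eq)
  qed simp
  have "(\<lambda>n. \<integral>\<omega>. 2 * (\<bar>W (u n) \<omega>\<bar> * gauss (1 - u n) (W (u n) \<omega>)) \<partial>P) \<longlonglongrightarrow> (\<integral>\<omega>. 0 \<partial>P)"
  proof (rule integral_dominated_convergence[where w="\<lambda>_. 2"])
    show "AE \<omega> in P. norm (2 * (\<bar>W (u n) \<omega>\<bar> * gauss (1 - u n) (W (u n) \<omega>))) \<le> 2" for n
      using u abs_mult_gauss_le[of "1 - u n"] by (intro AE_I2) (auto simp: abs_mult)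
    show "AE \<omega> in P. (\<lambda>n. 2 * (\<bar>W (u n) \<omega>\<bar> * gauss (1 - u n) (W (u n) \<omega>))) \<longlonglongrightarrow> 0"
      using W_1_nonzero
    proof eventually_elim
      case (elim \<omega>)
      have lim: "(\<lambda>n. W (u n) \<omega>) \<longlonglongrightarrow> W 1 \<omega>"
        using u by (intro continuous_on_tendsto_compose[OF W_cont u(3)]) auto
      have "(\<lambda>n. 2 * (2 * sqrt (1 - u n) / \<bar>W (u n) \<omega>\<bar>)) \<longlonglongrightarrow> 2 * (2 * sqrt (1 - 1) / \<bar>W 1 \<omega>\<bar>)"
        using elim by (intro tendsto_intros lim u) auto
      then have up: "(\<lambda>n. 2 * (2 * sqrt (1 - u n) / \<bar>W (u n) \<omega>\<bar>)) \<longlonglongrightarrow> 0" by simp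
      show "(\<lambda>n. 2 * (\<bar>W (u n) \<omega>\<bar> * gauss (1 - u n) (W (u n) \<omega>))) \<longlonglongrightarrow> 0"
      proof (rule tendsto_sandwich[OF _ _ tendsto_const up])
        show "\<forall>\<^sub>F n in sequentially. 2 * (\<bar>W (u n) \<omega>\<bar> * gauss (1 - u n) (W (u n) \<omega>)) \<le> 2 * (2 * sqrt (1 - u n) / \<bar>W (u n) \<omega>\<bar>)"
          using u by (intro always_eventually allI mult_left_mono bound) auto
      qed auto
    qed
  qed auto
  then have "(\<lambda>n. ennreal (\<integral>\<omega>. 2 * (\<bar>W (u n) \<omega>\<bar> * gauss (1 - u n) (W (u n) \<omega>)) \<partial>P)) \<longlonglongrightarrow> ennreal 0"
    by (intro tendsto_ennrealI) simp
  moreover have "(\<integral>\<^sup>+\<omega>. ennreal (2 * (\<bar>W (u n) \<omega>\<bar> * gauss (1 - u n) (W (u n) \<omega>))) \<partial>P) = ennreal (\<integral>\<omega>. 2 * (\<bar>W (u n) \<omega>\<bar> * gauss (1 - u n) (W (u n) \<omega>)) \<partial>P)" for n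
    using u abs_mult_gauss_le[of "1 - u n"]
    by (intro nn_integral_eq_integral integrable_const_bound[where B=2]) (auto simp: abs_mult)
  ultimately show ?thesis by simp
qed

lemma sets_FF_pair_mono:
  assumes "C \<in> sets (FF v \<Otimes>\<^sub>M (borel :: real measure))" "v \<le> u"
  shows "C \<in> sets (FF u \<Otimes>\<^sub>M borel)" "C \<in> sets (P \<Otimes>\<^sub>M borel)"
proof -
  have *: "C \<in> sets (N \<Otimes>\<^sub>M borel)" if "sets (FF v) \<subseteq> sets N" "space N = space P" for N :: "'a measure"
  proof -
    have "(\<lambda>p. (fst p, snd p)) \<in> measurable (N \<Otimes>\<^sub>M borel) (FF v \<Otimes>\<^sub>M (borel :: real measure))"
      using that by (intro measurable_Pair measurable_snd measurable_compose[OF measurable_fst]) (auto simp: measurable_def)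
    from measurable_sets[OF this assms(1)] have "C \<inter> space (N \<Otimes>\<^sub>M borel) \<in> sets (N \<Otimes>\<^sub>M borel)"
      by (simp add: vimage_def)
    moreover have "C \<subseteq> space (N \<Otimes>\<^sub>M borel)"
      using sets.sets_into_space[OF assms(1)] that by (simp add: space_pair_measure)
    ultimately show ?thesis by (simp add: Int_absorb2)
  qed
  show "C \<in> sets (FF u \<Otimes>\<^sub>M borel)" using mono[OF assms(2)] by (intro *) auto
  show "C \<in> sets (P \<Otimes>\<^sub>M borel)" using sets_FF by (intro *) auto
qed

text \<open>The Markov property at a time \<open>u\<close> close to \<open>1\<close>, with the Gaussian transition density written as \<open>kern\<close> plus its
reflected part.\<close>

lemma markov_kern_split:
  assumes qu: "0 \<le> q" "q \<le> u" "u < 1" and C: "C \<in> sets (FF u \<Otimes>\<^sub>M borel)"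
  defines "f \<equiv> (\<lambda>\<omega> y. indicator {0<..} y * indicator {\<omega>\<in>space P. y / 2 < rmin q u \<omega>} \<omega> * indicator C (\<omega>, y) :: ennreal)"
  shows "emeasure P {\<omega>\<in>space P. 0 < W 1 \<omega> \<and> W 1 \<omega> / 2 < rmin q u \<omega> \<and> (\<omega>, W 1 \<omega>) \<in> C} =
    (\<integral>\<^sup>+y. \<integral>\<^sup>+\<omega>. f \<omega> y * ennreal (kern y u (W u \<omega>)) \<partial>P \<partial>lborel) +
    (\<integral>\<^sup>+\<omega>. \<integral>\<^sup>+y. f \<omega> y * ennreal (gauss (1 - u) (W u \<omega>)) \<partial>lborel \<partial>P)"
proof -
  have mFF [measurable]: "rmin q u \<in> borel_measurable (FF u)" "W u \<in> borel_measurable (FF u)"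
    using qu by (auto intro: rmin_measurable_FF W_adapted)
  have mP [measurable]: "rmin q u \<in> borel_measurable P" "W u \<in> borel_measurable P" "W 1 \<in> borel_measurable P"
    using qu by (auto intro: rmin_measurable W_measurable)
  note C [measurable] sets_FF_pair_mono(2)[OF C order_refl, measurable]
  define g where "g = (\<lambda>p. f (fst p) (snd p))"
  have g_eq: "g = (\<lambda>p. indicator {0<..} (snd p) * (if snd p / 2 < rmin q u (fst p) \<and> fst p \<in> space (FF u) then 1 else 0) * indicator C p)"
    by (auto simp: g_def f_def indicator_def fun_eq_iff)
  have g [measurable]: "g \<in> borel_measurable (FF u \<Otimes>\<^sub>M borel)" unfolding g_eq by measurable
  have gP [measurable]: "g \<in> borel_measurable (P \<Otimes>\<^sub>M borel)" using g by (rule measurable_FF_pair)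
  have gy [measurable]: "(\<lambda>y. g (\<omega>, y)) \<in> borel_measurable borel" if "\<omega> \<in> space P" for \<omega>
    using that by (intro measurable_compose[OF _ gP]) auto
  define A where "A = {\<omega>\<in>space P. 0 < W 1 \<omega> \<and> W 1 \<omega> / 2 < rmin q u \<omega> \<and> (\<omega>, W 1 \<omega>) \<in> C}"
  have [measurable]: "A \<in> events" unfolding A_def by measurable
  have "emeasure P A = (\<integral>\<^sup>+\<omega>. g (\<omega>, W 1 \<omega>) \<partial>P)"
    unfolding nn_integral_indicator[OF \<open>A \<in> events\<close>, symmetric]
    by (intro nn_integral_cong) (auto simp: g_def f_def A_def indicator_def)
  also have "\<dots> = (\<integral>\<^sup>+\<omega>. \<integral>\<^sup>+y. g (\<omega>, y) * ennreal (gauss (1 - u) (y - W u \<omega>)) \<partial>lborel \<partial>P)"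
    using qu by (intro markov_nn_integral g) auto
  also have "\<dots> = (\<integral>\<^sup>+\<omega>. \<integral>\<^sup>+y. g (\<omega>, y) * ennreal (kern y u (W u \<omega>)) + g (\<omega>, y) * ennreal (gauss (1 - u) (W u \<omega>)) \<partial>lborel \<partial>P)"
  proof (intro nn_integral_cong)
    fix \<omega> y
    show "g (\<omega>, y) * ennreal (gauss (1 - u) (y - W u \<omega>)) = g (\<omega>, y) * ennreal (kern y u (W u \<omega>)) + g (\<omega>, y) * ennreal (gauss (1 - u) (W u \<omega>))"
    proof (cases "0 < y \<and> y / 2 < rmin q u \<omega>")
      case True
      then have "0 < kern y u (W u \<omega>)" using less_rmin_imp[of q u u "y/2" \<omega>] qu by (intro kern_pos) auto
      then have "ennreal (gauss (1 - u) (y - W u \<omega>)) = ennreal (kern y u (W u \<omega>)) + ennreal (gauss (1 - u) (W u \<omega>))"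
        by (subst ennreal_plus[symmetric]) (auto simp: kern_def gauss_commute)
      then show ?thesis by (simp add: distrib_left)
    qed (auto simp: g_def f_def)
  qed
  also have "\<dots> = (\<integral>\<^sup>+\<omega>. (\<integral>\<^sup>+y. g (\<omega>, y) * ennreal (kern y u (W u \<omega>)) \<partial>lborel) + (\<integral>\<^sup>+y. g (\<omega>, y) * ennreal (gauss (1 - u) (W u \<omega>)) \<partial>lborel) \<partial>P)"
    by (intro nn_integral_cong nn_integral_add) auto
  also have "\<dots> = (\<integral>\<^sup>+\<omega>. \<integral>\<^sup>+y. g (\<omega>, y) * ennreal (kern y u (W u \<omega>)) \<partial>lborel \<partial>P) + (\<integral>\<^sup>+\<omega>. \<integral>\<^sup>+y. g (\<omega>, y) * ennreal (gauss (1 - u) (W u \<omega>)) \<partial>lborel \<partial>P)"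
    by (intro nn_integral_add) measurable
  also have "(\<integral>\<^sup>+\<omega>. \<integral>\<^sup>+y. g (\<omega>, y) * ennreal (kern y u (W u \<omega>)) \<partial>lborel \<partial>P) =
      (\<integral>\<^sup>+y. \<integral>\<^sup>+\<omega>. g (\<omega>, y) * ennreal (kern y u (W u \<omega>)) \<partial>P \<partial>lborel)"
  proof -
    interpret pair_sigma_finite P lborel ..
    show ?thesis by (rule Fubini'[symmetric]) measurable
  qed
  finally show ?thesis by (simp add: A_def g_def)
qed

text \<open>Apply \<open>markov_kern_split\<close> at times increasing to \<open>1\<close>. The first term does not depend on the time, by
\<open>kern_killed\<close>, and the second one tends to \<open>0\<close>, by \<open>gauss_remainder\<close>.\<close>

lemma emeasure_pos_last:
  assumes qv: "0 \<le> q" "q \<le> v" "v < 1" and C: "C \<in> sets (FF v \<Otimes>\<^sub>M borel)"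
  shows "emeasure P {\<omega>\<in>pos_last q. (\<omega>, W 1 \<omega>) \<in> C} =
    (\<integral>\<^sup>+y. indicator {0<..} y * (\<integral>\<^sup>+\<omega>. indicator {\<omega>\<in>space P. y / 2 < rmin q v \<omega>} \<omega> *
       (indicator C (\<omega>, y) * ennreal (kern y v (W v \<omega>))) \<partial>P) \<partial>lborel)"
    (is "_ = ?K")
proof -
  define u where "u n = 1 - (1 - v) / real (Suc n + 1)" for n
  have u1: "u n < 1" for n using qv by (simp add: u_def)
  have uv: "v < u n" for n
  proof -
    have "(1 - v) / real (Suc n + 1) < (1 - v) / 1" using qv by (intro divide_strict_left_mono) auto
    then show ?thesis by (simp add: u_def)
  qed
  have umono: "u m \<le> u n" if "m \<le> n" for m n
    unfolding u_def using that qv by (intro diff_left_mono divide_left_mono) auto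
  have ulim: "u \<longlonglongrightarrow> 1" unfolding u_def by real_asymp
  have u0: "0 \<le> u n" "q \<le> u n" for n using uv[of n] qv by auto
  have [measurable]: "W 1 \<in> borel_measurable P" "W (u n) \<in> borel_measurable P" "rmin q (u n) \<in> borel_measurable P" for n
    using qv u0 by (auto intro: W_measurable rmin_measurable)
  have Cu: "C \<in> sets (FF (u n) \<Otimes>\<^sub>M borel)" for n
    using sets_FF_pair_mono(1)[OF C] uv by (simp add: less_imp_le)
  note sets_FF_pair_mono(2)[OF C order_refl, measurable]
  define A where "A n = {\<omega>\<in>space P. 0 < W 1 \<omega> \<and> W 1 \<omega> / 2 < rmin q (u n) \<omega> \<and> (\<omega>, W 1 \<omega>) \<in> C}" for n
  have Ae [measurable]: "A n \<in> events" for n unfolding A_def by measurable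
  define f where "f n \<omega> y = (indicator {0<..} y * indicator {\<omega>\<in>space P. y / 2 < rmin q (u n) \<omega>} \<omega> * indicator C (\<omega>, y) :: ennreal)" for n \<omega> y
  define R where "R n = (\<integral>\<^sup>+\<omega>. \<integral>\<^sup>+y. f n \<omega> y * ennreal (gauss (1 - u n) (W (u n) \<omega>)) \<partial>lborel \<partial>P)" for n
  have K: "(\<integral>\<^sup>+y. \<integral>\<^sup>+\<omega>. f n \<omega> y * ennreal (kern y (u n) (W (u n) \<omega>)) \<partial>P \<partial>lborel) = ?K" for n
  proof (intro nn_integral_cong)
    fix y :: real
    show "(\<integral>\<^sup>+\<omega>. f n \<omega> y * ennreal (kern y (u n) (W (u n) \<omega>)) \<partial>P) =
       indicator {0<..} y * (\<integral>\<^sup>+\<omega>. indicator {\<omega>\<in>space P. y / 2 < rmin q v \<omega>} \<omega> * (indicator C (\<omega>, y) * ennreal (kern y v (W v \<omega>))) \<partial>P)"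
    proof (cases "0 < y")
      case True
      define F where "F = {\<omega>\<in>space P. (\<omega>, y) \<in> C}"
      have "(\<lambda>\<omega>. (\<omega>, y)) \<in> measurable (FF v) (FF v \<Otimes>\<^sub>M borel)" by measurable
      from measurable_sets[OF this C] have F: "F \<in> sets (FF v)" by (simp add: F_def vimage_def Int_def conj_commute)
      have "(\<integral>\<^sup>+\<omega>. f n \<omega> y * ennreal (kern y (u n) (W (u n) \<omega>)) \<partial>P) =
        (\<integral>\<^sup>+\<omega>. indicator (F \<inter> {\<omega>\<in>space P. y / 2 < rmin q (u n) \<omega>}) \<omega> * ennreal (kern y (u n) (W (u n) \<omega>)) \<partial>P)"
        using True by (intro nn_integral_cong) (auto simp: f_def F_def indicator_def)
      also have "\<dots> = (\<integral>\<^sup>+\<omega>. indicator (F \<inter> {\<omega>\<in>space P. y / 2 < rmin q v \<omega>}) \<omega> * ennreal (kern y v (W v \<omega>)) \<partial>P)"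
        using qv uv u1 F True by (intro kern_killed_nn)
      also have "\<dots> = (\<integral>\<^sup>+\<omega>. indicator {\<omega>\<in>space P. y / 2 < rmin q v \<omega>} \<omega> * (indicator C (\<omega>, y) * ennreal (kern y v (W v \<omega>))) \<partial>P)"
        by (intro nn_integral_cong) (auto simp: F_def indicator_def)
      finally show ?thesis using True by simp
    qed (simp add: f_def)
  qed
  have AR: "emeasure P (A n) = ?K + R n" for n
    using markov_kern_split[OF qv(1) u0(2) u1 Cu, of n] unfolding A_def R_def f_def[symmetric] K .
  have "R \<longlonglongrightarrow> 0"
  proof (rule tendsto_sandwich[OF _ _ tendsto_const gauss_remainder[OF u0(1) u1 ulim]])
    show "\<forall>\<^sub>F n in sequentially. R n \<le> (\<integral>\<^sup>+\<omega>. ennreal (2 * (\<bar>W (u n) \<omega>\<bar> * gauss (1 - u n) (W (u n) \<omega>))) \<partial>P)"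
    proof (intro always_eventually allI)
      fix n
      show "R n \<le> (\<integral>\<^sup>+\<omega>. ennreal (2 * (\<bar>W (u n) \<omega>\<bar> * gauss (1 - u n) (W (u n) \<omega>))) \<partial>P)"
        unfolding R_def
      proof (intro nn_integral_mono)
        fix \<omega>
        have le: "f n \<omega> y \<le> indicator {0..2 * \<bar>W (u n) \<omega>\<bar>} y" for y
        proof (cases "0 < y \<and> y / 2 < rmin q (u n) \<omega>")
          case True
          then have "y / 2 < W (u n) \<omega>" using less_rmin_imp[of q "u n" "u n" "y/2" \<omega>] u0[of n] qv by auto
          then have "y \<in> {0..2 * \<bar>W (u n) \<omega>\<bar>}" using True by auto
          then show ?thesis by (auto simp: f_def indicator_def)
        qed (auto simp: f_def)
        have "(\<integral>\<^sup>+y. f n \<omega> y * ennreal (gauss (1 - u n) (W (u n) \<omega>)) \<partial>lborel)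
          \<le> (\<integral>\<^sup>+y. ennreal (gauss (1 - u n) (W (u n) \<omega>)) * indicator {0..2 * \<bar>W (u n) \<omega>\<bar>} y \<partial>lborel)"
          by (intro nn_integral_mono) (subst mult.commute, rule mult_left_mono[OF le], simp)
        also have "\<dots> = ennreal (2 * (\<bar>W (u n) \<omega>\<bar> * gauss (1 - u n) (W (u n) \<omega>)))"
          by (subst nn_integral_cmult_indicator) (auto simp: ennreal_mult'[symmetric] ac_simps)
        finally show "(\<integral>\<^sup>+y. f n \<omega> y * ennreal (gauss (1 - u n) (W (u n) \<omega>)) \<partial>lborel)
          \<le> ennreal (2 * (\<bar>W (u n) \<omega>\<bar> * gauss (1 - u n) (W (u n) \<omega>)))" .
      qed
    qed
  qed auto
  then have "(\<lambda>n. ?K + R n) \<longlonglongrightarrow> ?K + 0" by (intro tendsto_add tendsto_const)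
  then have l1: "(\<lambda>n. emeasure P (A n)) \<longlonglongrightarrow> ?K" unfolding AR by simp
  have "(\<lambda>n. emeasure P (A n)) \<longlonglongrightarrow> emeasure P (\<Inter>n. A n)"
  proof (rule Lim_emeasure_decseq)
    show "decseq A"
    proof (rule decseq_SucI)
      fix n show "A (Suc n) \<subseteq> A n"
        unfolding A_def using less_rmin_split[OF qv(1) u0(2) umono, of n "Suc n"] by auto
    qed
  qed auto
  also have "(\<Inter>n. A n) = {\<omega>\<in>pos_last q. (\<omega>, W 1 \<omega>) \<in> C}"
  proof (intro set_eqI iffI)
    fix \<omega> assume \<omega>: "\<omega> \<in> (\<Inter>n. A n)"
    have "W 1 \<omega> / 2 < rmin q 1 \<omega>"
    proof (subst less_rmin_iff)
      show "\<forall>r. q \<le> r \<and> r \<le> 1 \<longrightarrow> W 1 \<omega> / 2 < W r \<omega>"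
      proof (intro allI impI)
        fix r assume r: "q \<le> r \<and> r \<le> 1"
        show "W 1 \<omega> / 2 < W r \<omega>"
        proof (cases "r = 1")
          case True then show ?thesis using \<omega> by (auto simp: A_def)
        next
          case False
          then have "\<forall>\<^sub>F n in sequentially. r < u n" using r ulim by (intro order_tendstoD) auto
          then obtain n where "r < u n" using eventually_happens'[OF sequentially_bot] by blast
          then show ?thesis using \<omega> r less_rmin_imp[of q r "u n" "W 1 \<omega> / 2" \<omega>] qv by (auto simp: A_def)
        qed
      qed
    qed (use qv in auto)
    then show "\<omega> \<in> {\<omega>\<in>pos_last q. (\<omega>, W 1 \<omega>) \<in> C}" using \<omega> by (auto simp: A_def pos_last_def)
  next
    fix \<omega> assume "\<omega> \<in> {\<omega>\<in>pos_last q. (\<omega>, W 1 \<omega>) \<in> C}"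
    then show "\<omega> \<in> (\<Inter>n. A n)"
      using less_rmin_split[OF qv(1) u0(2) less_imp_le[OF u1], where c="W 1 \<omega> / 2" and \<omega>=\<omega>] by (auto simp: A_def pos_last_def)
  qed
  finally show ?thesis using l1 LIMSEQ_unique by blast
qed

end

section \<open>The random time and the density of the drift\<close>

text \<open>The normalising constants of the Gaussian densities cancel.\<close>

lemma chi_ratio:
  assumes "u < 1"
  shows "(w / (1 - u) * exp (- (w\<^sup>2 / (2 * (1 - u)))) - (w - y) / (1 - u) * exp (- ((w - y)\<^sup>2 / (2 * (1 - u)))))
      / (- exp (- (w\<^sup>2 / (2 * (1 - u)))) + exp (- ((w - y)\<^sup>2 / (2 * (1 - u))))) = kern' y u w / kern y u w"
proof -
  define k where "k = 1 / sqrt (2 * pi * (1 - u))"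
  have k: "k \<noteq> 0" using assms by (simp add: k_def)
  have g: "gauss (1 - u) x = k * exp (- (x\<^sup>2 / (2 * (1 - u))))" for x
    using assms by (simp add: gauss_eq k_def)
  have "kern' y u w = k * (w / (1 - u) * exp (- (w\<^sup>2 / (2 * (1 - u)))) - (w - y) / (1 - u) * exp (- ((w - y)\<^sup>2 / (2 * (1 - u)))))"
    unfolding kern'_def gauss'_def g by (simp add: algebra_simps)
  moreover have "kern y u w = k * (- exp (- (w\<^sup>2 / (2 * (1 - u)))) + exp (- ((w - y)\<^sup>2 / (2 * (1 - u)))))"
    unfolding kern_def g by (simp add: algebra_simps)
  ultimately show ?thesis using k by simp
qed

lemma chi_density_eq:
  "chi_density W u \<omega> = indicator {xi W \<omega><..<1} u * (kern' (W 1 \<omega>) u (W u \<omega>) / kern (W 1 \<omega>) u (W u \<omega>))"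
proof (cases "u < 1")
  case True
  show ?thesis unfolding chi_density_def chi_ratio[OF True] ..
qed (simp add: chi_density_def)

context cont_bm begin

definition zeros :: "'a \<Rightarrow> real set" where
  "zeros \<omega> = {t. 0 \<le> t \<and> t \<le> 1 \<and> W 1 \<omega> - 2 * W t \<omega> = 0}"

lemma xi_zeros: "xi W \<omega> \<in> zeros \<omega>" and zeros_le_xi: "t \<in> zeros \<omega> \<Longrightarrow> t \<le> xi W \<omega>"
proof -
  have c: "continuous_on {0..1} (\<lambda>t. W 1 \<omega> - 2 * W t \<omega>)"
    by (intro continuous_intros continuous_on_subset[OF W_cont]) auto
  have z: "zeros \<omega> = {0..1} \<inter> (\<lambda>t. W 1 \<omega> - 2 * W t \<omega>) -` {0}" by (auto simp: zeros_def)
  have "closed (zeros \<omega>)" unfolding z by (intro continuous_closed_preimage c) auto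
  moreover have "zeros \<omega> \<noteq> {}"
  proof (cases "0 \<le> W 1 \<omega>")
    case True
    have "\<exists>x\<ge>0. x \<le> 1 \<and> W 1 \<omega> - 2 * W x \<omega> = 0"
      by (rule IVT2') (use c True in \<open>auto simp: W_0\<close>)
    then show ?thesis by (auto simp: zeros_def)
  next
    case False
    have "\<exists>x\<ge>0. x \<le> 1 \<and> W 1 \<omega> - 2 * W x \<omega> = 0"
      by (rule IVT') (use c False in \<open>auto simp: W_0\<close>)
    then show ?thesis by (auto simp: zeros_def)
  qed
  moreover have b: "bdd_above (zeros \<omega>)" by (auto simp: zeros_def intro!: bdd_aboveI[of _ 1])
  ultimately have "Sup (zeros \<omega>) \<in> zeros \<omega>" by (intro closed_contains_Sup) auto
  then show "xi W \<omega> \<in> zeros \<omega>" by (simp add: xi_def zeros_def)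
  show "t \<in> zeros \<omega> \<Longrightarrow> t \<le> xi W \<omega>"
    using cSup_upper[OF _ b] by (simp add: xi_def zeros_def)
qed

lemma xi_range: "0 \<le> xi W \<omega>" "xi W \<omega> \<le> 1" and W_xi: "W (xi W \<omega>) \<omega> = W 1 \<omega> / 2"
  using xi_zeros[of \<omega>] by (auto simp: zeros_def)

text \<open>If the path were at or below half of its positive endpoint at some time after \<open>q\<close>, the
intermediate value theorem would give a later zero of \<open>W\<^sub>1 - 2 W\<close>.\<close>

lemma xi_less_iff_pos:
  assumes q: "0 \<le> q" "q \<le> 1" and W1: "0 < W 1 \<omega>"
  shows "xi W \<omega> < q \<longleftrightarrow> W 1 \<omega> / 2 < rmin q 1 \<omega>"
proof
  assume *: "xi W \<omega> < q"
  show "W 1 \<omega> / 2 < rmin q 1 \<omega>"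
  proof (subst less_rmin_iff[OF q], intro allI impI)
    fix r assume r: "q \<le> r \<and> r \<le> 1"
    show "W 1 \<omega> / 2 < W r \<omega>"
    proof (rule ccontr)
      assume "\<not> W 1 \<omega> / 2 < W r \<omega>"
      moreover have "continuous_on {r..1} (\<lambda>t. W t \<omega>)"
        using r q by (intro continuous_on_subset[OF W_cont]) auto
      ultimately have "\<exists>x\<ge>r. x \<le> 1 \<and> W x \<omega> = W 1 \<omega> / 2" using r W1 by (intro IVT') auto
      then obtain x where "r \<le> x" "x \<in> zeros \<omega>" using r q by (auto simp: zeros_def)
      then show False using zeros_le_xi[of x \<omega>] * r by simp
    qed
  qed
next
  assume *: "W 1 \<omega> / 2 < rmin q 1 \<omega>"
  show "xi W \<omega> < q"
    using less_rmin_imp[OF q(1) _ xi_range(2)[of \<omega>] *] W_xi[of \<omega>] by (cases "q \<le> xi W \<omega>") auto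
qed

lemma pos_last_eq: "0 \<le> q \<Longrightarrow> q \<le> 1 \<Longrightarrow> pos_last q = {\<omega>\<in>space P. 0 < W 1 \<omega> \<and> xi W \<omega> < q}"
  unfolding pos_last_def using xi_less_iff_pos by auto

text \<open>Joint measurability in the time is needed for Fubini's theorem. It is an instance of the approximation by grids,
used with \<open>G = H = 0\<close>.\<close>

lemma rmin_joint_measurable:
  assumes q: "0 \<le> q" "q < t"
  shows "(\<lambda>p. rmin q (max q (min (fst p) t)) (snd p)) \<in> borel_measurable (borel \<Otimes>\<^sub>M P)"
proof (rule borel_measurable_iff_greater[THEN iffD2], intro allI)
  fix c
  have "(\<lambda>p. indicator (space P \<inter> {\<omega>\<in>space P. q < fst p \<and> c < rmin q (min (fst p) t) \<omega>}) (snd p) :: real) \<in> borel_measurable (borel \<Otimes>\<^sub>M P)"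
    using q sets.top[of "FF q"]
    by (intro rmin_indicator_joint[where G="\<lambda>_ _. 0" and H="\<lambda>_ _. 0" and C=0 and L=0]) (auto simp: set_lebesgue_integral_def)
  then obtain J :: "real \<times> 'a \<Rightarrow> real" where J [measurable]: "J \<in> borel_measurable (borel \<Otimes>\<^sub>M P)"
    and J_eq: "\<And>p. J p = indicator (space P \<inter> {\<omega>\<in>space P. q < fst p \<and> c < rmin q (min (fst p) t) \<omega>}) (snd p)"
    by blast
  have [measurable]: "W q \<in> borel_measurable P" using q by (intro W_measurable)
  have "{p \<in> space (borel \<Otimes>\<^sub>M P). c < rmin q (max q (min (fst p) t)) (snd p)} =
     {p \<in> space (borel \<Otimes>\<^sub>M P). (q < fst p \<and> J p = 1) \<or> (\<not> q < fst p \<and> c < W q (snd p))}"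
  proof (intro Collect_cong conj_cong refl)
    fix p :: "real \<times> 'a" assume "p \<in> space (borel \<Otimes>\<^sub>M P)"
    then have p: "snd p \<in> space P" by (auto simp: space_pair_measure)
    show "(c < rmin q (max q (min (fst p) t)) (snd p)) = ((q < fst p \<and> J p = 1) \<or> (\<not> q < fst p \<and> c < W q (snd p)))"
    proof (cases "q < fst p")
      case True
      then have "max q (min (fst p) t) = min (fst p) t" using q by auto
      then show ?thesis using True p by (simp add: J_eq indicator_def)
    next
      case False
      then have "max q (min (fst p) t) = q" using q by auto
      then show ?thesis using False by simp
    qed
  qed
  also have "\<dots> \<in> sets (borel \<Otimes>\<^sub>M P)" by measurable
  finally show "{p \<in> space (borel \<Otimes>\<^sub>M P). c < rmin q (max q (min (fst p) t)) (snd p)} \<in> sets (borel \<Otimes>\<^sub>M P)" .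
qed

text \<open>The law of the past up to time \<open>v\<close> and of the endpoint on \<open>pos_last q\<close>, see \<open>distr_pos_last\<close>.\<close>

definition killed_law :: "real \<Rightarrow> real \<Rightarrow> ('a \<times> real) measure" where
  "killed_law q v = density (restr_to_subalg P (FF v) \<Otimes>\<^sub>M lborel)
     (\<lambda>p. ennreal (indicator {0<..} (snd p) * indicator {c. c / 2 < rmin q v (fst p)} (snd p) * kern (snd p) v (W v (fst p))))"

lemma killed_law_density_nonneg:
  assumes "0 \<le> q" "q \<le> v" "v < 1"
  shows "0 \<le> indicator {0<..} y * indicator {c. c / 2 < rmin q v \<omega>} y * kern y v (W v \<omega>)"
  using kern_pos[OF assms(3), of y "W v \<omega>"] less_rmin_imp[of q v v "y/2" \<omega>] assms by (auto simp: indicator_def)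

lemma killed_law_density_measurable:
  assumes "0 \<le> q" "q \<le> v"
  shows "(\<lambda>p. indicator {0<..} (snd p) * indicator {c. c / 2 < rmin q v (fst p)} (snd p) * kern (snd p) v (W v (fst p))) \<in> borel_measurable (FF v \<Otimes>\<^sub>M borel)"
proof -
  have [measurable]: "rmin q v \<in> borel_measurable (FF v)" "W v \<in> borel_measurable (FF v)"
    using assms by (auto intro: rmin_measurable_FF W_adapted)
  have "(\<lambda>p. indicator {0<..} (snd p) * (if snd p / 2 < rmin q v (fst p) then 1 else 0) * kern (snd p) v (W v (fst p))) \<in> borel_measurable (FF v \<Otimes>\<^sub>M borel)"
    by measurable
  then show ?thesis by (simp add: indicator_def[of "{c. c / 2 < rmin q v (fst p)}" for p])
qed

lemma sets_restr: "sets (restr_to_subalg P (FF v) \<Otimes>\<^sub>M lborel) = sets (FF v \<Otimes>\<^sub>M borel)"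
  using sets_restr_to_subalg[OF subalg] by (intro sets_pair_measure_cong) auto

lemma nn_integral_killed_law:
  assumes qv: "0 \<le> q" "q \<le> v" "v < 1" and f [measurable]: "f \<in> borel_measurable (FF v \<Otimes>\<^sub>M borel)"
  shows "(\<integral>\<^sup>+p. f p \<partial>killed_law q v) =
    (\<integral>\<^sup>+y. indicator {0<..} y * (\<integral>\<^sup>+\<omega>. indicator {\<omega>\<in>space P. y / 2 < rmin q v \<omega>} \<omega> *
       (f (\<omega>, y) * ennreal (kern y v (W v \<omega>))) \<partial>P) \<partial>lborel)"
proof -
  interpret R: prob_space "restr_to_subalg P (FF v)"
    by (rule prob_space_restr_to_subalg[OF subalg]) unfold_locales
  interpret pair_sigma_finite "restr_to_subalg P (FF v)" lborel ..
  define d where "d p = indicator {0<..} (snd p) * indicator {c. c / 2 < rmin q v (fst p)} (snd p) * kern (snd p) v (W v (fst p))" for p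
  have d [measurable]: "d \<in> borel_measurable (FF v \<Otimes>\<^sub>M borel)" unfolding d_def using qv by (intro killed_law_density_measurable)
  have [measurable_cong]: "sets (restr_to_subalg P (FF v)) = sets (FF v)" by (rule sets_restr_to_subalg[OF subalg])
  have m: "(\<lambda>p. ennreal (d p) * f p) \<in> borel_measurable (FF v \<Otimes>\<^sub>M borel)" by measurable
  then have m': "(\<lambda>p. ennreal (d p) * f p) \<in> borel_measurable (restr_to_subalg P (FF v) \<Otimes>\<^sub>M lborel)"
    by (subst measurable_cong_sets[OF sets_restr refl])
  have "(\<integral>\<^sup>+p. f p \<partial>killed_law q v) = (\<integral>\<^sup>+p. ennreal (d p) * f p \<partial>(restr_to_subalg P (FF v) \<Otimes>\<^sub>M lborel))"
    unfolding killed_law_def d_def[symmetric]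
    by (rule nn_integral_density) (simp_all add: measurable_cong_sets[OF sets_restr refl])
  also have "\<dots> = (\<integral>\<^sup>+y. \<integral>\<^sup>+\<omega>. ennreal (d (\<omega>, y)) * f (\<omega>, y) \<partial>restr_to_subalg P (FF v) \<partial>lborel)"
    by (rule nn_integral_snd[OF m', symmetric])
  also have "\<dots> = (\<integral>\<^sup>+y. \<integral>\<^sup>+\<omega>. ennreal (d (\<omega>, y)) * f (\<omega>, y) \<partial>P \<partial>lborel)"
  proof (intro nn_integral_cong nn_integral_subalgebra2[OF subalg])
    fix y :: real
    show "(\<lambda>\<omega>. ennreal (d (\<omega>, y)) * f (\<omega>, y)) \<in> borel_measurable (FF v)"
      by (rule measurable_compose[OF _ m]) measurable
  qed
  also have "\<dots> = (\<integral>\<^sup>+y. indicator {0<..} y * (\<integral>\<^sup>+\<omega>. indicator {\<omega>\<in>space P. y / 2 < rmin q v \<omega>} \<omega> *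
       (f (\<omega>, y) * ennreal (kern y v (W v \<omega>))) \<partial>P) \<partial>lborel)"
  proof (intro nn_integral_cong)
    fix y :: real
    show "(\<integral>\<^sup>+\<omega>. ennreal (d (\<omega>, y)) * f (\<omega>, y) \<partial>P) = indicator {0<..} y * (\<integral>\<^sup>+\<omega>. indicator {\<omega>\<in>space P. y / 2 < rmin q v \<omega>} \<omega> *
       (f (\<omega>, y) * ennreal (kern y v (W v \<omega>))) \<partial>P)"
    proof (cases "0 < y")
      case True
      then show ?thesis by (simp, intro nn_integral_cong) (auto simp: d_def indicator_def mult.commute)
    qed (simp add: d_def)
  qed
  finally show ?thesis .
qed

lemma W1_pair_meas: "v \<le> 1 \<Longrightarrow> (\<lambda>\<omega>. (\<omega>, W 1 \<omega>)) \<in> measurable P (FF v \<Otimes>\<^sub>M borel)"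
  by (intro measurable_Pair FF_id W_measurable) simp

lemma distr_pos_last:
  assumes qv: "0 \<le> q" "q \<le> v" "v < 1"
  shows "distr (density P (indicator (pos_last q))) (FF v \<Otimes>\<^sub>M borel) (\<lambda>\<omega>. (\<omega>, W 1 \<omega>)) = killed_law q v"
proof (rule measure_eqI)
  have pl [measurable]: "pos_last q \<in> events" using qv by (intro pos_last_events) auto
  have [measurable]: "(\<lambda>\<omega>. (\<omega>, W 1 \<omega>)) \<in> measurable P (FF v \<Otimes>\<^sub>M borel)" using qv by (intro W1_pair_meas) auto
  show "sets (distr (density P (indicator (pos_last q))) (FF v \<Otimes>\<^sub>M borel) (\<lambda>\<omega>. (\<omega>, W 1 \<omega>))) = sets (killed_law q v)"
    unfolding killed_law_def sets_density sets_distr sets_restr ..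
  fix C assume "C \<in> sets (distr (density P (indicator (pos_last q))) (FF v \<Otimes>\<^sub>M borel) (\<lambda>\<omega>. (\<omega>, W 1 \<omega>)))"
  then have C [measurable]: "C \<in> sets (FF v \<Otimes>\<^sub>M borel)" by simp
  have "(\<lambda>\<omega>. (\<omega>, W 1 \<omega>)) -` C \<inter> space P = {\<omega>\<in>space P. (\<omega>, W 1 \<omega>) \<in> C}" by auto
  then have m: "{\<omega>\<in>space P. (\<omega>, W 1 \<omega>) \<in> C} \<in> events"
    using measurable_sets[OF \<open>(\<lambda>\<omega>. (\<omega>, W 1 \<omega>)) \<in> measurable P (FF v \<Otimes>\<^sub>M borel)\<close> C] by simp
  have "emeasure (distr (density P (indicator (pos_last q))) (FF v \<Otimes>\<^sub>M borel) (\<lambda>\<omega>. (\<omega>, W 1 \<omega>))) C =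
     (\<integral>\<^sup>+\<omega>. indicator (pos_last q) \<omega> * indicator {\<omega>\<in>space P. (\<omega>, W 1 \<omega>) \<in> C} \<omega> \<partial>P)"
    using m by (subst emeasure_distr) (auto simp: emeasure_density vimage_def Int_def conj_commute)
  also have "\<dots> = emeasure P {\<omega>\<in>pos_last q. (\<omega>, W 1 \<omega>) \<in> C}"
  proof -
    have e: "{\<omega>\<in>pos_last q. (\<omega>, W 1 \<omega>) \<in> C} = pos_last q \<inter> {\<omega>\<in>space P. (\<omega>, W 1 \<omega>) \<in> C}" by (auto simp: pos_last_def)
    show ?thesis unfolding e indicator_inter_arith[symmetric] using m by (subst nn_integral_indicator) auto
  qed
  also have "\<dots> = (\<integral>\<^sup>+p. indicator C p \<partial>killed_law q v)"
    unfolding emeasure_pos_last[OF qv C] by (subst nn_integral_killed_law[OF qv]) auto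
  also have "\<dots> = emeasure (killed_law q v) C"
    by (rule nn_integral_indicator) (simp only: killed_law_def sets_density sets_restr C)
  finally show "emeasure (distr (density P (indicator (pos_last q))) (FF v \<Otimes>\<^sub>M borel) (\<lambda>\<omega>. (\<omega>, W 1 \<omega>))) C = emeasure (killed_law q v) C" .
qed

lemma nn_integral_pos_last:
  assumes qv: "0 \<le> q" "q \<le> v" "v < 1" and f [measurable]: "f \<in> borel_measurable (FF v \<Otimes>\<^sub>M borel)"
  shows "(\<integral>\<^sup>+\<omega>. indicator (pos_last q) \<omega> * f (\<omega>, W 1 \<omega>) \<partial>P) =
    (\<integral>\<^sup>+y. indicator {0<..} y * (\<integral>\<^sup>+\<omega>. indicator {\<omega>\<in>space P. y / 2 < rmin q v \<omega>} \<omega> *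
       (f (\<omega>, y) * ennreal (kern y v (W v \<omega>))) \<partial>P) \<partial>lborel)"
proof -
  have [measurable]: "pos_last q \<in> events" using qv by (intro pos_last_events) auto
  have [measurable]: "(\<lambda>\<omega>. (\<omega>, W 1 \<omega>)) \<in> measurable P (FF v \<Otimes>\<^sub>M borel)" using qv by (intro W1_pair_meas) auto
  have "(\<integral>\<^sup>+\<omega>. indicator (pos_last q) \<omega> * f (\<omega>, W 1 \<omega>) \<partial>P) =
    (\<integral>\<^sup>+p. f p \<partial>distr (density P (indicator (pos_last q))) (FF v \<Otimes>\<^sub>M borel) (\<lambda>\<omega>. (\<omega>, W 1 \<omega>)))"
    by (subst nn_integral_distr) (auto simp: nn_integral_density)
  then show ?thesis unfolding distr_pos_last[OF qv] nn_integral_killed_law[OF qv f] .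
qed

lemma integral_pos_last:
  fixes f :: "'a \<times> real \<Rightarrow> real"
  assumes qv: "0 \<le> q" "q \<le> v" "v < 1" and f [measurable]: "f \<in> borel_measurable (FF v \<Otimes>\<^sub>M borel)"
    and int: "integrable P (\<lambda>\<omega>. indicator (pos_last q) \<omega> * f (\<omega>, W 1 \<omega>))"
  shows "integrable lborel (\<lambda>y. indicator {0<..} y * (\<integral>\<omega>. indicator {\<omega>\<in>space P. y / 2 < rmin q v \<omega>} \<omega> * (f (\<omega>, y) * kern y v (W v \<omega>)) \<partial>P))" (is ?I)
    and "(\<integral>\<omega>. indicator (pos_last q) \<omega> * f (\<omega>, W 1 \<omega>) \<partial>P) =
    (\<integral>y. indicator {0<..} y * (\<integral>\<omega>. indicator {\<omega>\<in>space P. y / 2 < rmin q v \<omega>} \<omega> * (f (\<omega>, y) * kern y v (W v \<omega>)) \<partial>P) \<partial>lborel)" (is ?E)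
proof -
  interpret R: prob_space "restr_to_subalg P (FF v)"
    by (rule prob_space_restr_to_subalg[OF subalg]) unfold_locales
  interpret pair_sigma_finite "restr_to_subalg P (FF v)" lborel ..
  have [measurable]: "pos_last q \<in> events" using qv by (intro pos_last_events) auto
  have T [measurable]: "(\<lambda>\<omega>. (\<omega>, W 1 \<omega>)) \<in> measurable P (FF v \<Otimes>\<^sub>M borel)" using qv by (intro W1_pair_meas) auto
  have fT [measurable]: "(\<lambda>\<omega>. f (\<omega>, W 1 \<omega>)) \<in> borel_measurable P" by measurable
  define d where "d p = indicator {0<..} (snd p) * indicator {c. c / 2 < rmin q v (fst p)} (snd p) * kern (snd p) v (W v (fst p))" for p
  have d [measurable]: "d \<in> borel_measurable (FF v \<Otimes>\<^sub>M borel)" unfolding d_def using qv by (intro killed_law_density_measurable) auto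
  have d0: "0 \<le> d p" for p unfolding d_def by (rule killed_law_density_nonneg[OF qv])
  have m: "(\<lambda>p. d p * f p) \<in> borel_measurable (FF v \<Otimes>\<^sub>M borel)" by measurable
  have ind: "density P (indicator (pos_last q)) = density P (\<lambda>\<omega>. ennreal (indicator (pos_last q) \<omega>))"
    by (intro density_cong) (auto simp: indicator_def)
  have "integrable (distr (density P (indicator (pos_last q))) (FF v \<Otimes>\<^sub>M borel) (\<lambda>\<omega>. (\<omega>, W 1 \<omega>))) f"
    using int by (subst integrable_distr_eq) (auto simp: ind integrable_density)
  then have "integrable (killed_law q v) f" unfolding distr_pos_last[OF qv] .
  then have I: "integrable (restr_to_subalg P (FF v) \<Otimes>\<^sub>M lborel) (\<lambda>p. d p * f p)"
    unfolding killed_law_def d_def[symmetric]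
    by (subst (asm) integrable_density) (auto simp: d0 measurable_cong_sets[OF sets_restr refl])
  have inner: "(\<integral>\<omega>. d (\<omega>, y) * f (\<omega>, y) \<partial>restr_to_subalg P (FF v)) =
      indicator {0<..} y * (\<integral>\<omega>. indicator {\<omega>\<in>space P. y / 2 < rmin q v \<omega>} \<omega> * (f (\<omega>, y) * kern y v (W v \<omega>)) \<partial>P)" for y
  proof -
    have "(\<integral>\<omega>. d (\<omega>, y) * f (\<omega>, y) \<partial>restr_to_subalg P (FF v)) = (\<integral>\<omega>. d (\<omega>, y) * f (\<omega>, y) \<partial>P)"
      by (rule integral_subalgebra2[OF subalg], rule measurable_compose[OF _ m]) measurable
    also have "\<dots> = (\<integral>\<omega>. indicator {0<..} y * (indicator {\<omega>\<in>space P. y / 2 < rmin q v \<omega>} \<omega> * (f (\<omega>, y) * kern y v (W v \<omega>))) \<partial>P)"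
      by (intro Bochner_Integration.integral_cong) (auto simp: d_def indicator_def)
    finally show ?thesis by simp
  qed
  have I': "integrable (restr_to_subalg P (FF v) \<Otimes>\<^sub>M lborel) (\<lambda>(\<omega>, y). d (\<omega>, y) * f (\<omega>, y))"
    using I by (simp add: case_prod_beta')
  show ?I using integrable_snd[OF I'] unfolding inner .
  have "(\<integral>\<omega>. indicator (pos_last q) \<omega> * f (\<omega>, W 1 \<omega>) \<partial>P) =
    (\<integral>p. f p \<partial>distr (density P (indicator (pos_last q))) (FF v \<Otimes>\<^sub>M borel) (\<lambda>\<omega>. (\<omega>, W 1 \<omega>)))"
    by (subst integral_distr) (auto simp: ind integral_density)
  also have "\<dots> = (\<integral>p. d p * f p \<partial>(restr_to_subalg P (FF v) \<Otimes>\<^sub>M lborel))"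
    unfolding distr_pos_last[OF qv] unfolding killed_law_def d_def[symmetric]
    by (subst integral_density) (auto simp: d0 measurable_cong_sets[OF sets_restr refl])
  also have "\<dots> = (\<integral>y. (\<integral>\<omega>. d (\<omega>, y) * f (\<omega>, y) \<partial>restr_to_subalg P (FF v)) \<partial>lborel)"
    using integral_snd[OF I'] by (simp add: case_prod_beta')
  finally show ?E unfolding inner .
qed

end

section \<open>The drift identity for positive endpoints\<close>

context cont_bm begin

lemma W_integrable: assumes "0 \<le> t" shows "integrable P (W t)"
proof (cases "t = 0")
  case True
  have "W 0 = (\<lambda>_. 0)" by (simp add: W_0 fun_eq_iff)
  then show ?thesis using True by simp
next
  case False
  have [measurable]: "W t \<in> borel_measurable P" using assms by (intro W_measurable)
  have "integrable (distr P borel (\<lambda>\<omega>. W t \<omega> - W 0 \<omega>)) (\<lambda>x. x)"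
    unfolding incr_distr[of 0 t, simplified, OF order.not_eq_order_implies_strict[OF False[symmetric] assms]]
    using integrable_normal_moment_nz_1[of "sqrt t" 0] False assms
    by (subst integrable_density) auto
  then show ?thesis by (subst (asm) integrable_distr_eq) (auto simp: W_0)
qed

lemma kern'_mass:
  assumes u: "0 \<le> u" "u < 1"
  shows "(\<integral>\<^sup>+y. indicator {0<..} y * (\<integral>\<^sup>+\<omega>. indicator {\<omega>\<in>space P. y / 2 < W u \<omega>} \<omega> * ennreal \<bar>kern' y u (W u \<omega>)\<bar> \<partial>P) \<partial>lborel) \<le> ennreal (5 / sqrt (1 - u))"
proof -
  interpret pair_sigma_finite P lborel ..
  have [measurable]: "W u \<in> borel_measurable P" using u by (intro W_measurable)
  have "(\<integral>\<^sup>+y. indicator {0<..} y * (\<integral>\<^sup>+\<omega>. indicator {\<omega>\<in>space P. y / 2 < W u \<omega>} \<omega> * ennreal \<bar>kern' y u (W u \<omega>)\<bar> \<partial>P) \<partial>lborel) =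
    (\<integral>\<^sup>+y. \<integral>\<^sup>+\<omega>. indicator {0<..} y * (if y / 2 < W u \<omega> then 1 else 0) * ennreal \<bar>kern' y u (W u \<omega>)\<bar> \<partial>P \<partial>lborel)"
  proof (intro nn_integral_cong)
    fix y :: real
    have "indicator {0<..} y * (\<integral>\<^sup>+\<omega>. indicator {\<omega>\<in>space P. y / 2 < W u \<omega>} \<omega> * ennreal \<bar>kern' y u (W u \<omega>)\<bar> \<partial>P) =
      (\<integral>\<^sup>+\<omega>. indicator {0<..} y * (indicator {\<omega>\<in>space P. y / 2 < W u \<omega>} \<omega> * ennreal \<bar>kern' y u (W u \<omega>)\<bar>) \<partial>P)"
      by (rule nn_integral_cmult[symmetric]) measurable
    also have "\<dots> = (\<integral>\<^sup>+\<omega>. indicator {0<..} y * (if y / 2 < W u \<omega> then 1 else 0) * ennreal \<bar>kern' y u (W u \<omega>)\<bar> \<partial>P)"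
      by (intro nn_integral_cong) (auto simp: indicator_def)
    finally show "indicator {0<..} y * (\<integral>\<^sup>+\<omega>. indicator {\<omega>\<in>space P. y / 2 < W u \<omega>} \<omega> * ennreal \<bar>kern' y u (W u \<omega>)\<bar> \<partial>P) = \<dots>" .
  qed
  also have "\<dots> = (\<integral>\<^sup>+\<omega>. \<integral>\<^sup>+y. indicator {0<..} y * (if y / 2 < W u \<omega> then 1 else 0) * ennreal \<bar>kern' y u (W u \<omega>)\<bar> \<partial>lborel \<partial>P)"
    by (rule Fubini') measurable
  also have "\<dots> \<le> (\<integral>\<^sup>+\<omega>. ennreal (5 / sqrt (1 - u)) \<partial>P)"
  proof (intro nn_integral_mono)
    fix \<omega>
    have "(\<integral>\<^sup>+y. indicator {0<..} y * (if y / 2 < W u \<omega> then 1 else 0) * ennreal \<bar>kern' y u (W u \<omega>)\<bar> \<partial>lborel) =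
      (\<integral>\<^sup>+y. indicator {0<..} y * indicator {y. y / 2 < W u \<omega>} y * ennreal \<bar>kern' y u (W u \<omega>)\<bar> \<partial>lborel)"
      by (intro nn_integral_cong) (auto simp: indicator_def)
    then show "(\<integral>\<^sup>+y. indicator {0<..} y * (if y / 2 < W u \<omega> then 1 else 0) * ennreal \<bar>kern' y u (W u \<omega>)\<bar> \<partial>lborel) \<le> ennreal (5 / sqrt (1 - u))"
      using nn_integral_kern'_le[OF u(2)] by simp
  qed
  also have "\<dots> = ennreal (5 / sqrt (1 - u))" by (simp add: emeasure_space_1)
  finally show ?thesis .
qed

lemma drift_L1_bound:
  assumes u: "0 \<le> u" "u < 1"
  shows "(\<integral>\<^sup>+\<omega>. indicator (pos_last u) \<omega> * ennreal \<bar>kern' (W 1 \<omega>) u (W u \<omega>) / kern (W 1 \<omega>) u (W u \<omega>)\<bar> \<partial>P) \<le> ennreal (5 / sqrt (1 - u))"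
proof -
  have [measurable]: "W u \<in> borel_measurable (FF u)" using u by (intro W_adapted)
  define f where "f = (\<lambda>p. ennreal \<bar>kern' (snd p) u (W u (fst p)) / kern (snd p) u (W u (fst p))\<bar>)"
  have f: "f \<in> borel_measurable (FF u \<Otimes>\<^sub>M borel)" unfolding f_def by measurable
  have "(\<integral>\<^sup>+\<omega>. indicator (pos_last u) \<omega> * ennreal \<bar>kern' (W 1 \<omega>) u (W u \<omega>) / kern (W 1 \<omega>) u (W u \<omega>)\<bar> \<partial>P) =
     (\<integral>\<^sup>+\<omega>. indicator (pos_last u) \<omega> * f (\<omega>, W 1 \<omega>) \<partial>P)"
    by (simp add: f_def)
  also have "\<dots> = (\<integral>\<^sup>+y. indicator {0<..} y * (\<integral>\<^sup>+\<omega>. indicator {\<omega>\<in>space P. y / 2 < rmin u u \<omega>} \<omega> *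
       (f (\<omega>, y) * ennreal (kern y u (W u \<omega>))) \<partial>P) \<partial>lborel)"
    by (rule nn_integral_pos_last[OF u(1) order_refl u(2) f])
  also have "\<dots> = (\<integral>\<^sup>+y. indicator {0<..} y * (\<integral>\<^sup>+\<omega>. indicator {\<omega>\<in>space P. y / 2 < W u \<omega>} \<omega> * ennreal \<bar>kern' y u (W u \<omega>)\<bar> \<partial>P) \<partial>lborel)"
  proof (intro nn_integral_cong)
    fix y :: real
    show "indicator {0<..} y * (\<integral>\<^sup>+\<omega>. indicator {\<omega>\<in>space P. y / 2 < rmin u u \<omega>} \<omega> * (f (\<omega>, y) * ennreal (kern y u (W u \<omega>))) \<partial>P) =
      indicator {0<..} y * (\<integral>\<^sup>+\<omega>. indicator {\<omega>\<in>space P. y / 2 < W u \<omega>} \<omega> * ennreal \<bar>kern' y u (W u \<omega>)\<bar> \<partial>P)"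
    proof (cases "0 < y")
      case True
      have "f (\<omega>, y) * ennreal (kern y u (W u \<omega>)) = ennreal \<bar>kern' y u (W u \<omega>)\<bar>" if "y / 2 < W u \<omega>" for \<omega>
        using kern_pos[OF u(2) True that] by (simp add: f_def abs_divide flip: ennreal_mult)
      then have "(\<integral>\<^sup>+\<omega>. indicator {\<omega>\<in>space P. y / 2 < rmin u u \<omega>} \<omega> * (f (\<omega>, y) * ennreal (kern y u (W u \<omega>))) \<partial>P) =
        (\<integral>\<^sup>+\<omega>. indicator {\<omega>\<in>space P. y / 2 < W u \<omega>} \<omega> * ennreal \<bar>kern' y u (W u \<omega>)\<bar> \<partial>P)"
        by (intro nn_integral_cong) (auto simp: indicator_def)
      then show ?thesis by simp
    qed simp
  qed
  also have "\<dots> \<le> ennreal (5 / sqrt (1 - u))" by (rule kern'_mass[OF u])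
  finally show ?thesis .
qed

lemma pos_last_mono: "0 \<le> q \<Longrightarrow> q \<le> u \<Longrightarrow> u \<le> 1 \<Longrightarrow> pos_last q \<subseteq> pos_last u"
  by (subst (1 2) pos_last_eq) auto

lemma drift_integrable:
  assumes "0 \<le> q" "q \<le> u" "u < 1" and F: "F \<in> events"
  shows "integrable P (\<lambda>\<omega>. indicator (F \<inter> pos_last q) \<omega> * (kern' (W 1 \<omega>) u (W u \<omega>) / kern (W 1 \<omega>) u (W u \<omega>)))"
proof (rule integrableI_bounded)
  have [measurable]: "W u \<in> borel_measurable P" "W 1 \<in> borel_measurable P" using assms by (auto intro: W_measurable)
  have [measurable]: "F \<in> events" "pos_last q \<in> events" using assms by (auto intro: pos_last_events)
  show "(\<lambda>\<omega>. indicator (F \<inter> pos_last q) \<omega> * (kern' (W 1 \<omega>) u (W u \<omega>) / kern (W 1 \<omega>) u (W u \<omega>))) \<in> borel_measurable P"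
    by measurable
  have "(\<integral>\<^sup>+\<omega>. ennreal (norm (indicator (F \<inter> pos_last q) \<omega> * (kern' (W 1 \<omega>) u (W u \<omega>) / kern (W 1 \<omega>) u (W u \<omega>)))) \<partial>P)
     \<le> (\<integral>\<^sup>+\<omega>. indicator (pos_last u) \<omega> * ennreal \<bar>kern' (W 1 \<omega>) u (W u \<omega>) / kern (W 1 \<omega>) u (W u \<omega>)\<bar> \<partial>P)"
    using pos_last_mono[of q u] assms by (intro nn_integral_mono) (auto simp: indicator_def)
  also have "\<dots> \<le> ennreal (5 / sqrt (1 - u))" using assms by (intro drift_L1_bound) auto
  finally show "(\<integral>\<^sup>+\<omega>. ennreal (norm (indicator (F \<inter> pos_last q) \<omega> * (kern' (W 1 \<omega>) u (W u \<omega>) / kern (W 1 \<omega>) u (W u \<omega>)))) \<partial>P) < \<infinity>"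
    using order_le_less_trans by fastforce
qed

text \<open>Disintegrate over the endpoint \<open>y\<close>: for fixed \<open>y\<close> the increment of \<open>W - y / 2\<close>, weighted by \<open>kern\<close>, is the time integral
of \<open>kern'\<close> by \<open>mult_kern_killed\<close>, and \<open>kern'\<close> is the drift \<open>kern' / kern\<close> weighted by \<open>kern\<close>. Fubini's theorem
exchanges \<open>y\<close> and the time.\<close>

lemma drift_identity_pos:
  assumes qst: "0 \<le> q" "q \<le> s" "s < t" "t < 1" and F: "F \<in> sets (FF s)"
  shows "(\<integral>\<omega>. indicator (F \<inter> pos_last q) \<omega> * (W t \<omega> - W s \<omega>) \<partial>P) =
    (LINT u:{s<..t}|lborel. \<integral>\<omega>. indicator (F \<inter> pos_last q) \<omega> * (kern' (W 1 \<omega>) u (W u \<omega>) / kern (W 1 \<omega>) u (W u \<omega>)) \<partial>P)"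
proof -
  have Fe [measurable]: "F \<in> events" using F by (rule sets_FF)
  have ple [measurable]: "pos_last q \<in> events" using qst by (intro pos_last_events) auto
  define D where "D v y = F \<inter> {\<omega>\<in>space P. y / 2 < rmin q v \<omega>}" for v y
  define a where "a v y = (\<integral>\<omega>. indicator (D v y) \<omega> * ((W v \<omega> - y / 2) * kern y v (W v \<omega>)) \<partial>P)" for v y
  define b where "b v y = (\<integral>\<omega>. indicator (D v y) \<omega> * kern' y v (W v \<omega>) \<partial>P)" for v y
  have FFu: "F \<in> sets (FF v)" if "s \<le> v" for v using mono[OF that] F by auto
  have A: "integrable lborel (\<lambda>y. indicator {0<..} y * a v y)"
      "(\<integral>\<omega>. indicator (F \<inter> pos_last q) \<omega> * (W v \<omega> - W 1 \<omega> / 2) \<partial>P) = (\<integral>y. indicator {0<..} y * a v y \<partial>lborel)"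
      "integrable P (\<lambda>\<omega>. indicator (F \<inter> pos_last q) \<omega> * (W v \<omega> - W 1 \<omega> / 2))"
    if v: "s \<le> v" "v < 1" for v
  proof -
    have qv: "0 \<le> q" "q \<le> v" "v < 1" using v qst by auto
    note FFu[OF v(1), measurable]
    have [measurable]: "W v \<in> borel_measurable (FF v)" using qv by (intro W_adapted) auto
    define f where "f = (\<lambda>p. indicator F (fst p) * (W v (fst p) - snd p / 2))"
    have f: "f \<in> borel_measurable (FF v \<Otimes>\<^sub>M borel)" unfolding f_def by measurable
    have I: "integrable P (\<lambda>\<omega>. indicator (pos_last q \<inter> F) \<omega> * (W v \<omega> - W 1 \<omega> / 2))"
    proof -
      have "integrable P (\<lambda>\<omega>. W v \<omega> - W 1 \<omega> / 2)" using W_integrable[of v] W_integrable[of 1] qv by auto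
      from integrable_real_mult_indicator[OF sets.Int[OF ple Fe] this] show ?thesis by (simp add: mult.commute)
    qed
    then show "integrable P (\<lambda>\<omega>. indicator (F \<inter> pos_last q) \<omega> * (W v \<omega> - W 1 \<omega> / 2))" by (simp add: Int_commute)
    have int: "integrable P (\<lambda>\<omega>. indicator (pos_last q) \<omega> * f (\<omega>, W 1 \<omega>))"
      using I by (simp add: f_def indicator_inter_arith mult.assoc)
    have inner: "(\<integral>\<omega>. indicator {\<omega>\<in>space P. y / 2 < rmin q v \<omega>} \<omega> * (f (\<omega>, y) * kern y v (W v \<omega>)) \<partial>P) = a v y" for y
      unfolding a_def D_def by (intro Bochner_Integration.integral_cong) (auto simp: f_def indicator_def)
    show "integrable lborel (\<lambda>y. indicator {0<..} y * a v y)"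
      using integral_pos_last(1)[OF qv f int] unfolding inner .
    have "(\<integral>\<omega>. indicator (pos_last q) \<omega> * f (\<omega>, W 1 \<omega>) \<partial>P) = (\<integral>y. indicator {0<..} y * a v y \<partial>lborel)"
      using integral_pos_last(2)[OF qv f int] unfolding inner .
    moreover have "(\<integral>\<omega>. indicator (F \<inter> pos_last q) \<omega> * (W v \<omega> - W 1 \<omega> / 2) \<partial>P) = (\<integral>\<omega>. indicator (pos_last q) \<omega> * f (\<omega>, W 1 \<omega>) \<partial>P)"
      by (intro Bochner_Integration.integral_cong) (auto simp: f_def indicator_def)
    ultimately show "(\<integral>\<omega>. indicator (F \<inter> pos_last q) \<omega> * (W v \<omega> - W 1 \<omega> / 2) \<partial>P) = (\<integral>y. indicator {0<..} y * a v y \<partial>lborel)" by simp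
  qed
  have B: "(\<integral>\<omega>. indicator (F \<inter> pos_last q) \<omega> * (kern' (W 1 \<omega>) u (W u \<omega>) / kern (W 1 \<omega>) u (W u \<omega>)) \<partial>P) = (\<integral>y. indicator {0<..} y * b u y \<partial>lborel)"
    if v: "s \<le> u" "u < 1" for u
  proof -
    have qv: "0 \<le> q" "q \<le> u" "u < 1" using v qst by auto
    note FFu[OF v(1), measurable]
    have [measurable]: "W u \<in> borel_measurable (FF u)" using qv by (intro W_adapted) auto
    define f where "f = (\<lambda>p. indicator F (fst p) * (kern' (snd p) u (W u (fst p)) / kern (snd p) u (W u (fst p))))"
    have f: "f \<in> borel_measurable (FF u \<Otimes>\<^sub>M borel)" unfolding f_def by measurable
    have eq: "indicator (F \<inter> pos_last q) \<omega> * (kern' (W 1 \<omega>) u (W u \<omega>) / kern (W 1 \<omega>) u (W u \<omega>)) = indicator (pos_last q) \<omega> * f (\<omega>, W 1 \<omega>)" for \<omega>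
      by (auto simp: f_def indicator_def)
    have int: "integrable P (\<lambda>\<omega>. indicator (pos_last q) \<omega> * f (\<omega>, W 1 \<omega>))"
      using drift_integrable[OF qv Fe] unfolding eq .
    have inner: "indicator {0<..} y * (\<integral>\<omega>. indicator {\<omega>\<in>space P. y / 2 < rmin q u \<omega>} \<omega> * (f (\<omega>, y) * kern y u (W u \<omega>)) \<partial>P) = indicator {0<..} y * b u y" for y
    proof (cases "0 < y")
      case True
      have "kern y u (W u \<omega>) \<noteq> 0" if "y / 2 < rmin q u \<omega>" for \<omega>
        using kern_pos[OF qv(3) True, of "W u \<omega>"] less_rmin_imp[OF qv(1,2) order_refl that] by simp
      then have "(\<integral>\<omega>. indicator {\<omega>\<in>space P. y / 2 < rmin q u \<omega>} \<omega> * (f (\<omega>, y) * kern y u (W u \<omega>)) \<partial>P) = b u y"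
        unfolding b_def D_def by (intro Bochner_Integration.integral_cong) (auto simp: f_def indicator_def)
      then show ?thesis by simp
    qed simp
    show ?thesis unfolding eq using integral_pos_last(2)[OF qv f int] unfolding inner .
  qed
  have C: "a t y = a s y + (LINT u:{s<..t}|lborel. b u y)" for y
  proof -
    have Ds: "D s y \<in> sets (FF s)" unfolding D_def using qst F by (intro sets.Int rmin_set_FF) auto
    have D1: "D v y = D s y \<inter> {\<omega>\<in>space P. y / 2 < rmin s v \<omega>}" if "s \<le> v" for v
      unfolding D_def using less_rmin_split[of q s v] that qst by auto
    have D2: "D s y = D s y \<inter> {\<omega>\<in>space P. y / 2 < W s \<omega>}"
      unfolding D_def using less_rmin_imp[of q s s "y / 2"] qst by auto
    have "(LINT u:{s<..t}|lborel. b u y) = (LINT v:{s<..t}|lborel. \<integral>\<omega>. indicator (D s y \<inter> {\<omega>\<in>space P. y / 2 < rmin s v \<omega>}) \<omega> * kern' y v (W v \<omega>) \<partial>P)"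
    proof (intro set_lebesgue_integral_cong allI impI)
      fix v assume "v \<in> {s<..t}"
      then have "s \<le> v" by simp
      show "b v y = (\<integral>\<omega>. indicator (D s y \<inter> {\<omega>\<in>space P. y / 2 < rmin s v \<omega>}) \<omega> * kern' y v (W v \<omega>) \<partial>P)"
        unfolding b_def D1[OF \<open>s \<le> v\<close>] ..
    qed simp
    then show ?thesis
      using mult_kern_killed[OF order_trans[OF qst(1,2)] qst(3,4) Ds, of y] qst
      unfolding a_def D1[of t, OF less_imp_le[OF qst(3)]] D2[symmetric] by simp
  qed
  \<comment> \<open>A version of \<open>b\<close> that is jointly measurable; times are clipped to \<open>[q, t]\<close>, where the running minimum makes sense.\<close>
  define \<psi> where "\<psi> u y = (\<integral>\<omega>. indicator F \<omega> * (if y / 2 < rmin q (max q (min u t)) \<omega> then 1 else 0) * kern' y u (W (max 0 u) \<omega>) \<partial>P)" for u y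
  have \<psi>b: "\<psi> u y = b u y" if "u \<in> {s<..t}" for u y
    unfolding \<psi>_def b_def D_def using that qst
    by (intro Bochner_Integration.integral_cong refl) (auto simp: indicator_def max_def min_def)
  have \<psi>m: "(\<lambda>p. \<psi> (fst p) (snd p)) \<in> borel_measurable (borel \<Otimes>\<^sub>M borel)"
  proof -
    define R where "R x = rmin q (max q (min (fst (fst x)) t)) (snd x)" for x :: "(real \<times> real) \<times> 'a"
    define V where "V x = W (max 0 (fst (fst x))) (snd x)" for x :: "(real \<times> real) \<times> 'a"
    have [measurable]: "R \<in> borel_measurable ((borel \<Otimes>\<^sub>M borel) \<Otimes>\<^sub>M P)"
    proof -
      have "(\<lambda>x. (fst (fst x), snd x)) \<in> measurable (((borel :: real measure) \<Otimes>\<^sub>M (borel :: real measure)) \<Otimes>\<^sub>M P) (borel \<Otimes>\<^sub>M P)" by measurable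
      from measurable_compose[OF this rmin_joint_measurable[of q t]] show ?thesis using qst by (simp add: R_def[abs_def])
    qed
    have [measurable]: "V \<in> borel_measurable ((borel \<Otimes>\<^sub>M borel) \<Otimes>\<^sub>M P)"
      unfolding V_def[abs_def] by (rule W_joint_meas) measurable
    have "(\<lambda>x. indicator F (snd x) * (if snd (fst x) / 2 < R x then 1 else 0) *
        kern' (snd (fst x)) (fst (fst x)) (V x)) \<in> borel_measurable ((borel \<Otimes>\<^sub>M borel) \<Otimes>\<^sub>M P)"
      by measurable
    then have "(\<lambda>x. indicator F (snd x) * (if snd (fst x) / 2 < rmin q (max q (min (fst (fst x)) t)) (snd x) then 1 else 0) *
        kern' (snd (fst x)) (fst (fst x)) (W (max 0 (fst (fst x))) (snd x))) \<in> borel_measurable ((borel \<Otimes>\<^sub>M borel) \<Otimes>\<^sub>M P)"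
      by (simp only: R_def V_def)
    then show ?thesis unfolding \<psi>_def
      by (intro borel_measurable_lebesgue_integral) (simp add: case_prod_beta)
  qed
  have I: "integrable (lborel \<Otimes>\<^sub>M lborel) (\<lambda>(u, y). indicator {s<..t} u * (indicator {0<..} y * \<psi> u y))"
  proof (rule integrableI_bounded)
    have m: "(\<lambda>p. indicator {s<..t} (fst p) * (indicator {0<..} (snd p) * \<psi> (fst p) (snd p))) \<in> borel_measurable (borel \<Otimes>\<^sub>M borel)"
      using \<psi>m[measurable] by measurable
    then show m': "(\<lambda>(u, y). indicator {s<..t} u * (indicator {0<..} y * \<psi> u y)) \<in> borel_measurable (lborel \<Otimes>\<^sub>M lborel)"
      by (simp add: case_prod_beta' borel_prod lborel_prod)
    have "(\<integral>\<^sup>+p. ennreal (norm (case p of (u, y) \<Rightarrow> indicator {s<..t} u * (indicator {0<..} y * \<psi> u y))) \<partial>(lborel \<Otimes>\<^sub>M lborel)) =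
      (\<integral>\<^sup>+u. \<integral>\<^sup>+y. ennreal (norm (indicator {s<..t} u * (indicator {0<..} y * \<psi> u y))) \<partial>lborel \<partial>lborel)"
      using m' by (subst lborel.nn_integral_fst[symmetric]) (auto simp: case_prod_beta)
    also have "\<dots> \<le> (\<integral>\<^sup>+u. ennreal (5 / sqrt (1 - t)) * indicator {s<..t} u \<partial>lborel)"
    proof (intro nn_integral_mono)
      fix u
      show "(\<integral>\<^sup>+y. ennreal (norm (indicator {s<..t} u * (indicator {0<..} y * \<psi> u y))) \<partial>lborel) \<le> ennreal (5 / sqrt (1 - t)) * indicator {s<..t} u"
      proof (cases "u \<in> {s<..t}")
        case True
        then have u: "0 \<le> u" "u < 1" "q \<le> u" "s \<le> u" using qst by auto
        have [measurable]: "W u \<in> borel_measurable P" using u by (intro W_measurable)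
        have "(\<integral>\<^sup>+y. ennreal (norm (indicator {s<..t} u * (indicator {0<..} y * \<psi> u y))) \<partial>lborel) \<le>
          (\<integral>\<^sup>+y. indicator {0<..} y * (\<integral>\<^sup>+\<omega>. indicator {\<omega>\<in>space P. y / 2 < W u \<omega>} \<omega> * ennreal \<bar>kern' y u (W u \<omega>)\<bar> \<partial>P) \<partial>lborel)"
        proof (intro nn_integral_mono)
          fix y :: real
          have i: "integrable P (\<lambda>\<omega>. indicator (D u y) \<omega> * kern' y u (W u \<omega>))"
          proof (rule integrable_const_bound[where B="2 / (1 - u)"])
            have [measurable]: "D u y \<in> events" unfolding D_def using u qst by (intro sets.Int Fe sets_FF[OF rmin_set_FF]) auto
            show "(\<lambda>\<omega>. indicator (D u y) \<omega> * kern' y u (W u \<omega>)) \<in> borel_measurable P" by measurable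
          qed (use abs_kern'_le[OF u(2)] u in \<open>auto simp: indicator_def\<close>)
          have "ennreal \<bar>b u y\<bar> \<le> (\<integral>\<^sup>+\<omega>. ennreal (norm (indicator (D u y) \<omega> * kern' y u (W u \<omega>))) \<partial>P)"
            using integral_norm_bound_ennreal[OF i] by (simp add: b_def)
          also have "\<dots> \<le> (\<integral>\<^sup>+\<omega>. indicator {\<omega>\<in>space P. y / 2 < W u \<omega>} \<omega> * ennreal \<bar>kern' y u (W u \<omega>)\<bar> \<partial>P)"
            using less_rmin_imp[OF qst(1) u(3) order_refl, of "y / 2"] by (intro nn_integral_mono) (auto simp: indicator_def D_def)
          finally show "ennreal (norm (indicator {s<..t} u * (indicator {0<..} y * \<psi> u y))) \<le>
            indicator {0<..} y * (\<integral>\<^sup>+\<omega>. indicator {\<omega>\<in>space P. y / 2 < W u \<omega>} \<omega> * ennreal \<bar>kern' y u (W u \<omega>)\<bar> \<partial>P)"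
            using True \<psi>b[OF True, of y] by (simp add: indicator_def)
        qed
        also have "\<dots> \<le> ennreal (5 / sqrt (1 - u))" by (rule kern'_mass[OF u(1,2)])
        also have "\<dots> \<le> ennreal (5 / sqrt (1 - t))" using True qst by (intro ennreal_leI divide_left_mono) auto
        finally show ?thesis using True by simp
      qed simp
    qed
    also have "\<dots> < \<infinity>" using qst by (subst nn_integral_cmult_indicator) (auto simp: ennreal_mult_less_top)
    finally show "(\<integral>\<^sup>+p. ennreal (norm (case p of (u, y) \<Rightarrow> indicator {s<..t} u * (indicator {0<..} y * \<psi> u y))) \<partial>(lborel \<Otimes>\<^sub>M lborel)) < \<infinity>" .
  qed
  have st1: "s \<le> s" "s < 1" "s \<le> t" using qst by auto
  have "(\<integral>\<omega>. indicator (F \<inter> pos_last q) \<omega> * (W t \<omega> - W s \<omega>) \<partial>P) =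
     (\<integral>\<omega>. indicator (F \<inter> pos_last q) \<omega> * (W t \<omega> - W 1 \<omega> / 2) - indicator (F \<inter> pos_last q) \<omega> * (W s \<omega> - W 1 \<omega> / 2) \<partial>P)"
    by (intro Bochner_Integration.integral_cong) (auto simp: algebra_simps)
  also have "\<dots> = (\<integral>y. indicator {0<..} y * a t y \<partial>lborel) - (\<integral>y. indicator {0<..} y * a s y \<partial>lborel)"
    using A[OF st1(3) qst(4)] A[OF st1(1,2)] by (subst Bochner_Integration.integral_diff) auto
  also have "\<dots> = (\<integral>y. indicator {0<..} y * a t y - indicator {0<..} y * a s y \<partial>lborel)"
    using A(1)[OF st1(3) qst(4)] A(1)[OF st1(1,2)] by (subst Bochner_Integration.integral_diff) auto
  also have "\<dots> = (\<integral>y. (\<integral>u. indicator {s<..t} u * (indicator {0<..} y * \<psi> u y) \<partial>lborel) \<partial>lborel)"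
  proof (intro Bochner_Integration.integral_cong refl)
    fix y :: real
    have "(\<integral>u. indicator {s<..t} u * (indicator {0<..} y * \<psi> u y) \<partial>lborel) = (\<integral>u. indicator {0<..} y * (indicator {s<..t} u *\<^sub>R b u y) \<partial>lborel)"
      using \<psi>b by (intro Bochner_Integration.integral_cong) (auto simp: indicator_def)
    also have "\<dots> = indicator {0<..} y * (LINT u:{s<..t}|lborel. b u y)"
      unfolding set_lebesgue_integral_def by (rule integral_mult_right_zero)
    finally show "indicator {0<..} y * a t y - indicator {0<..} y * a s y = (\<integral>u. indicator {s<..t} u * (indicator {0<..} y * \<psi> u y) \<partial>lborel)"
      unfolding C by (simp add: algebra_simps)
  qed
  also have "\<dots> = (\<integral>u. (\<integral>y. indicator {s<..t} u * (indicator {0<..} y * \<psi> u y) \<partial>lborel) \<partial>lborel)"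
    by (rule lborel_pair.Fubini_integral[OF I])
  also have "\<dots> = (LINT u:{s<..t}|lborel. \<integral>\<omega>. indicator (F \<inter> pos_last q) \<omega> * (kern' (W 1 \<omega>) u (W u \<omega>) / kern (W 1 \<omega>) u (W u \<omega>)) \<partial>P)"
    unfolding set_lebesgue_integral_def
  proof (intro Bochner_Integration.integral_cong refl)
    fix u :: real
    show "(\<integral>y. indicator {s<..t} u * (indicator {0<..} y * \<psi> u y) \<partial>lborel) = indicat_real {s<..t} u *\<^sub>R
      (\<integral>\<omega>. indicator (F \<inter> pos_last q) \<omega> * (kern' (W 1 \<omega>) u (W u \<omega>) / kern (W 1 \<omega>) u (W u \<omega>)) \<partial>P)"
    proof (cases "u \<in> {s<..t}")
      case True
      then show ?thesis using B[of u] \<psi>b[OF True] qst by simp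
    qed simp
  qed
  finally show ?thesis .
qed

end

section \<open>Reflection and integrability of the drift\<close>

lemma xi_uminus: "xi (\<lambda>t \<omega>. - W t \<omega>) = xi W"
  unfolding xi_def by (intro ext arg_cong[where f=Sup]) auto

lemma kern_uminus: "kern (- y) u (- w) = kern y u w" "kern' (- y) u (- w) = - kern' y u w"
proof -
  have "- w - - y = - (w - y)" by simp
  then show "kern (- y) u (- w) = kern y u w" "kern' (- y) u (- w) = - kern' y u w"
    unfolding kern_def kern'_def gauss'_def by (simp_all only: gauss_minus)
qed

lemma chi_density_uminus: "chi_density (\<lambda>t \<omega>. - W t \<omega>) u \<omega> = - chi_density W u \<omega>"
  by (simp add: chi_density_eq xi_uminus kern_uminus)

context cont_bm begin

lemma cont_bm_uminus: "cont_bm P FF (\<lambda>t \<omega>. - W t \<omega>)"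
proof unfold_locales
  fix s t :: real assume st: "0 \<le> s" "s < t"
  have "distributed P lborel (\<lambda>\<omega>. 0 + (- 1) * (W t \<omega> - W s \<omega>)) (normal_density (0 + (- 1) * 0) (\<bar>- 1\<bar> * sqrt (t - s)))"
    using st by (intro normal_density_affine W_normal) auto
  then show "distributed P lborel (\<lambda>\<omega>. - W t \<omega> - - W s \<omega>) (gauss (t - s))" by simp
  fix F and B :: "real set" assume F: "F \<in> sets (FF s)" and B: "B \<in> sets borel"
  have "uminus -` B \<in> sets borel" using measurable_sets[OF borel_measurable_uminus[OF measurable_ident] B] by simp
  from W_indep[OF st F this]
  show "prob (F \<inter> {\<omega> \<in> space P. - W t \<omega> - - W s \<omega> \<in> B}) = prob F * prob {\<omega> \<in> space P. - W t \<omega> - - W s \<omega> \<in> B}"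
    by simp
qed (use subalg mono W_adapted W_cont W_0 in \<open>auto intro!: continuous_intros\<close>)

text \<open>The counterpart of \<open>pos_last\<close> under the reflection \<open>W \<mapsto> - W\<close>.\<close>

definition neg_last :: "real \<Rightarrow> 'a set" where
  "neg_last q = {\<omega>\<in>space P. W 1 \<omega> < 0 \<and> xi W \<omega> < q}"

lemma neg_last_eq: "0 \<le> q \<Longrightarrow> q \<le> 1 \<Longrightarrow> cont_bm.pos_last P (\<lambda>t \<omega>. - W t \<omega>) q = neg_last q"
  using cont_bm.pos_last_eq[OF cont_bm_uminus, of q] by (simp add: neg_last_def xi_uminus)

abbreviation xi_less :: "real \<Rightarrow> 'a set" where "xi_less q \<equiv> {\<omega>\<in>space P. xi W \<omega> < q}"

lemma xi_eq_1: "W 1 \<omega> = 0 \<Longrightarrow> xi W \<omega> = 1"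
  using zeros_le_xi[of 1 \<omega>] xi_range(2)[of \<omega>] by (auto simp: zeros_def)

lemma xi_less_split:
  assumes "0 \<le> q" "q \<le> 1"
  shows "xi_less q = pos_last q \<union> neg_last q" "pos_last q \<inter> neg_last q = {}"
  using xi_eq_1 assms by (auto simp: pos_last_eq neg_last_def) (metis linorder_neqE_linordered_idom not_less)

lemma xi_less_FF: "xi_less q \<in> sets (FF 1)"
proof -
  consider "q < 0" | "0 \<le> q" "q \<le> 1" | "1 < q" by linarith
  then show ?thesis
  proof cases
    case 1
    then have "xi_less q = {}" using xi_range(1) by (auto simp: not_less intro: order_trans[OF less_imp_le])
    then show ?thesis by (simp only: sets.empty_sets)
  next
    case 2
    then show ?thesis
      unfolding xi_less_split[OF 2]
      using pos_last_FF[OF 2] cont_bm.pos_last_FF[OF cont_bm_uminus 2] neg_last_eq[OF 2] by auto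
  next
    case 3
    then have "xi_less q = space (FF 1)" using xi_range(2) by (auto intro: order_le_less_trans)
    then show ?thesis by (simp only: sets.top)
  qed
qed

lemma xi_measurable [measurable]: "xi W \<in> borel_measurable P"
  by (rule measurable_FF[of _ 1], rule borel_measurable_iff_less[THEN iffD2]) (use xi_less_FF in simp)

lemma xi_less_1: "AE \<omega> in P. xi W \<omega> < 1"
  using W_1_nonzero
proof eventually_elim
  case (elim \<omega>)
  then have "xi W \<omega> \<noteq> 1" using W_xi[of \<omega>] by auto
  then show ?case using xi_range(2)[of \<omega>] by simp
qed

lemma chi_density_outside: "u \<le> 0 \<or> 1 \<le> u \<Longrightarrow> chi_density W u \<omega> = 0"
  using xi_range(1)[of \<omega>] by (auto simp: chi_density_eq)

lemma chi_density_before: "u \<le> xi W \<omega> \<Longrightarrow> chi_density W u \<omega> = 0"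
  by (simp add: chi_density_eq)

lemma chi_density_joint [measurable]: "(\<lambda>p. chi_density W (snd p) (fst p)) \<in> borel_measurable (P \<Otimes>\<^sub>M borel)"
proof -
  define V where "V p = W (max 0 (snd p)) (fst p)" for p :: "'a \<times> real"
  have [measurable]: "V \<in> borel_measurable (P \<Otimes>\<^sub>M borel)"
    unfolding V_def[abs_def] by (rule W_joint_meas) measurable
  have [measurable]: "W 1 \<in> borel_measurable P" by (intro W_measurable) simp
  have "(\<lambda>p. (if xi W (fst p) < snd p \<and> snd p < 1 then 1 else 0) * (kern' (W 1 (fst p)) (snd p) (V p) / kern (W 1 (fst p)) (snd p) (V p))) \<in> borel_measurable (P \<Otimes>\<^sub>M borel)"
    by measurable
  moreover have "chi_density W (snd p) (fst p) = (if xi W (fst p) < snd p \<and> snd p < 1 then 1 else 0) * (kern' (W 1 (fst p)) (snd p) (V p) / kern (W 1 (fst p)) (snd p) (V p))" for p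
  proof (cases "xi W (fst p) < snd p")
    case True
    then have "0 \<le> snd p" using xi_range(1)[of "fst p"] by simp
    then show ?thesis by (simp add: chi_density_eq V_def indicator_def)
  qed (simp add: chi_density_eq indicator_def)
  ultimately show ?thesis by simp
qed

lemma chi_density_meas': "chi_density W u \<in> borel_measurable P"
  using measurable_compose[OF _ chi_density_joint, of "\<lambda>\<omega>. (\<omega>, u)" P] by simp

lemma chi_density_pos:
  assumes "0 \<le> u" "u < 1"
  shows "\<omega> \<in> pos_last u \<Longrightarrow> chi_density W u \<omega> = kern' (W 1 \<omega>) u (W u \<omega>) / kern (W 1 \<omega>) u (W u \<omega>)"
  using assms by (simp add: chi_density_eq pos_last_eq)

lemma chi_density_bound:
  assumes u: "0 \<le> u" "u < 1"
  shows "(\<integral>\<^sup>+\<omega>. ennreal \<bar>chi_density W u \<omega>\<bar> \<partial>P) \<le> ennreal (10 / sqrt (1 - u))"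
proof -
  have u1: "0 \<le> u" "u \<le> 1" using u by auto
  note xl = xi_less_split[OF u1]
  have [measurable]: "W u \<in> borel_measurable P" "W 1 \<in> borel_measurable P" using u by (auto intro: W_measurable)
  have e: "pos_last u \<in> events" "neg_last u \<in> events"
    using pos_last_events[OF u1] cont_bm.pos_last_events[OF cont_bm_uminus u1] by (auto simp: neg_last_eq[OF u1])
  note e[measurable] chi_density_meas'[measurable]
  have "(\<integral>\<^sup>+\<omega>. ennreal \<bar>chi_density W u \<omega>\<bar> \<partial>P) =
    (\<integral>\<^sup>+\<omega>. indicator (pos_last u) \<omega> * ennreal \<bar>chi_density W u \<omega>\<bar> + indicator (neg_last u) \<omega> * ennreal \<bar>chi_density W u \<omega>\<bar> \<partial>P)"
  proof (intro nn_integral_cong)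
    fix \<omega> assume \<omega>: "\<omega> \<in> space P"
    show "ennreal \<bar>chi_density W u \<omega>\<bar> = indicator (pos_last u) \<omega> * ennreal \<bar>chi_density W u \<omega>\<bar> + indicator (neg_last u) \<omega> * ennreal \<bar>chi_density W u \<omega>\<bar>"
    proof (cases "\<omega> \<in> xi_less u")
      case True
      then show ?thesis using xl by (auto simp: indicator_def)
    next
      case False
      then have "chi_density W u \<omega> = 0" using \<omega> by (intro chi_density_before) auto
      then show ?thesis by simp
    qed
  qed
  also have "\<dots> = (\<integral>\<^sup>+\<omega>. indicator (pos_last u) \<omega> * ennreal \<bar>chi_density W u \<omega>\<bar> \<partial>P) + (\<integral>\<^sup>+\<omega>. indicator (neg_last u) \<omega> * ennreal \<bar>chi_density W u \<omega>\<bar> \<partial>P)"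
    by (intro nn_integral_add) measurable
  also have "(\<integral>\<^sup>+\<omega>. indicator (pos_last u) \<omega> * ennreal \<bar>chi_density W u \<omega>\<bar> \<partial>P) \<le> ennreal (5 / sqrt (1 - u))"
    using drift_L1_bound[OF u] chi_density_pos[OF u]
    by (intro order_trans[OF nn_integral_mono drift_L1_bound[OF u]]) (auto simp: indicator_def)
  also have "(\<integral>\<^sup>+\<omega>. indicator (neg_last u) \<omega> * ennreal \<bar>chi_density W u \<omega>\<bar> \<partial>P) \<le> ennreal (5 / sqrt (1 - u))"
  proof -
    define r where "r \<omega> = kern' (- W 1 \<omega>) u (- W u \<omega>) / kern (- W 1 \<omega>) u (- W u \<omega>)" for \<omega>
    have r: "\<bar>chi_density W u \<omega>\<bar> = \<bar>r \<omega>\<bar>" if "\<omega> \<in> neg_last u" for \<omega>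
    proof -
      have "- chi_density W u \<omega> = r \<omega>"
        using cont_bm.chi_density_pos[OF cont_bm_uminus u, of \<omega>] that
        unfolding neg_last_eq[OF u1] chi_density_uminus r_def by simp
      then show ?thesis by (metis abs_minus_cancel)
    qed
    have "(\<integral>\<^sup>+\<omega>. indicator (neg_last u) \<omega> * ennreal \<bar>chi_density W u \<omega>\<bar> \<partial>P) = (\<integral>\<^sup>+\<omega>. indicator (neg_last u) \<omega> * ennreal \<bar>r \<omega>\<bar> \<partial>P)"
      by (intro nn_integral_cong) (simp add: r indicator_def)
    also have "\<dots> \<le> ennreal (5 / sqrt (1 - u))"
      using cont_bm.drift_L1_bound[OF cont_bm_uminus u] unfolding neg_last_eq[OF u1] r_def .
    finally show ?thesis .
  qed
  also have "ennreal (5 / sqrt (1 - u)) + ennreal (5 / sqrt (1 - u)) = ennreal (10 / sqrt (1 - u))"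
    using u by (simp flip: ennreal_plus add_divide_distrib)
  finally show ?thesis by (simp add: add_mono)
qed

lemma inv_sqrt_mass: "(\<integral>\<^sup>+u. ennreal (10 / sqrt (1 - u)) * indicator {0..<1} u \<partial>lborel) \<le> 20"
proof -
  define b where "b n = 1 - 1 / real (Suc n)" for n
  have b: "0 \<le> b n" "b n < 1" for n by (auto simp: b_def)
  have le: "(\<integral>\<^sup>+u. ennreal (10 / sqrt (1 - u)) * indicator {0..b n} u \<partial>lborel) \<le> 20" for n
  proof -
    have "(\<integral>\<^sup>+u. ennreal (10 / sqrt (1 - u)) * indicator {0..b n} u \<partial>lborel) = ennreal (- 20 * sqrt (1 - b n) - (- 20 * sqrt (1 - 0)))"
    proof (rule nn_integral_FTC_Icc[where F="\<lambda>x. - 20 * sqrt (1 - x)"])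
      fix x assume x: "x \<in> {0..b n}"
      then have "x < 1" using b(2)[of n] by simp
      then show "((\<lambda>x. - 20 * sqrt (1 - x)) has_real_derivative 10 / sqrt (1 - x)) (at x)"
        by (auto intro!: derivative_eq_intros simp: field_simps)
      show "0 \<le> 10 / sqrt (1 - x)" using \<open>x < 1\<close> by simp
    qed (use b in auto)
    also have "\<dots> \<le> ennreal 20" using b[of n] by (intro ennreal_leI) auto
    finally show ?thesis by simp
  qed
  have "(\<lambda>n. \<integral>\<^sup>+u. ennreal (10 / sqrt (1 - u)) * indicator {0..b n} u \<partial>lborel) \<longlonglongrightarrow> (\<integral>\<^sup>+u. ennreal (10 / sqrt (1 - u)) * indicator {0..<1} u \<partial>lborel)"
  proof (rule nn_integral_LIMSEQ)
    show "incseq (\<lambda>n u. ennreal (10 / sqrt (1 - u)) * indicator {0..b n} u)"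
    proof (intro incseq_SucI le_funI mult_left_mono)
      fix n and u :: real
      have "b n \<le> b (Suc n)" unfolding b_def by (intro diff_left_mono divide_left_mono) auto
      then show "indicator {0..b n} u \<le> (indicator {0..b (Suc n)} u :: ennreal)" by (auto simp: indicator_def)
    qed simp
    fix u :: real
    have "b \<longlonglongrightarrow> 1" unfolding b_def by real_asymp
    show "(\<lambda>n. ennreal (10 / sqrt (1 - u)) * indicator {0..b n} u) \<longlonglongrightarrow> ennreal (10 / sqrt (1 - u)) * indicator {0..<1} u"
    proof (cases "u < 1")
      case True
      have "\<forall>\<^sub>F n in sequentially. u < b n" using order_tendstoD(1)[OF \<open>b \<longlonglongrightarrow> 1\<close> True] .
      then show ?thesis by (rule tendsto_eventually[OF eventually_mono]) (auto simp: indicator_def True)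
    next
      case False
      then have "u \<notin> {0..b n}" for n using b(2)[of n] by auto
      then show ?thesis using False by simp
    qed
  qed measurable
  then show ?thesis using le by (intro LIMSEQ_le_const2) auto
qed

lemma chi_density_integrable_pair: "integrable (P \<Otimes>\<^sub>M lborel) (\<lambda>(\<omega>, u). chi_density W u \<omega>)"
proof (rule integrableI_bounded)
  interpret pair_sigma_finite P lborel ..
  show m: "(\<lambda>(\<omega>, u). chi_density W u \<omega>) \<in> borel_measurable (P \<Otimes>\<^sub>M lborel)"
    using chi_density_joint by (simp add: case_prod_beta' measurable_cong_sets[OF sets_pair_measure_cong[OF refl sets_lborel] refl])
  have "(\<integral>\<^sup>+p. ennreal (norm (case p of (\<omega>, u) \<Rightarrow> chi_density W u \<omega>)) \<partial>(P \<Otimes>\<^sub>M lborel)) =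
    (\<integral>\<^sup>+u. \<integral>\<^sup>+\<omega>. ennreal \<bar>chi_density W u \<omega>\<bar> \<partial>P \<partial>lborel)"
    using m by (subst nn_integral_snd[symmetric]) (auto simp: case_prod_beta')
  also have "\<dots> \<le> (\<integral>\<^sup>+u. ennreal (10 / sqrt (1 - u)) * indicator {0..<1} u \<partial>lborel)"
  proof (intro nn_integral_mono)
    fix u show "(\<integral>\<^sup>+\<omega>. ennreal \<bar>chi_density W u \<omega>\<bar> \<partial>P) \<le> ennreal (10 / sqrt (1 - u)) * indicator {0..<1} u"
    proof (cases "u \<in> {0..<1}")
      case True then show ?thesis using chi_density_bound[of u] by simp
    next
      case False then show ?thesis using chi_density_outside[of u] by auto
    qed
  qed
  also have "\<dots> \<le> 20" by (rule inv_sqrt_mass)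
  also have "\<dots> < \<infinity>" by simp
  finally show "(\<integral>\<^sup>+p. ennreal (norm (case p of (\<omega>, u) \<Rightarrow> chi_density W u \<omega>)) \<partial>(P \<Otimes>\<^sub>M lborel)) < \<infinity>" .
qed

lemma chi_density_AE_integrable: "AE \<omega> in P. integrable lborel (\<lambda>u. chi_density W u \<omega>)"
proof -
  interpret pair_sigma_finite P lborel ..
  show ?thesis using AE_integrable_fst[OF chi_density_integrable_pair] .
qed

lemma chi_eq: "chi W t \<omega> = (\<integral>u. indicator {..t} u * chi_density W u \<omega> \<partial>lborel)"
  unfolding chi_def set_lebesgue_integral_def
  using chi_density_outside by (intro Bochner_Integration.integral_cong) (auto simp: indicator_def)

lemma chi_set_integral:
  assumes B: "B \<in> events" and S: "S \<in> sets borel"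
  shows "integrable P (\<lambda>\<omega>. indicator B \<omega> * (\<integral>u. indicator S u * chi_density W u \<omega> \<partial>lborel))"
    "(\<integral>\<omega>. indicator B \<omega> * (\<integral>u. indicator S u * chi_density W u \<omega> \<partial>lborel) \<partial>P) =
       (\<integral>u. indicator S u * (\<integral>\<omega>. indicator B \<omega> * chi_density W u \<omega> \<partial>P) \<partial>lborel)"
proof -
  interpret pair_sigma_finite P lborel ..
  have "integrable (P \<Otimes>\<^sub>M lborel) (\<lambda>p. (case p of (\<omega>, u) \<Rightarrow> chi_density W u \<omega>) * indicator (B \<times> S) p)"
    using B S by (intro integrable_real_mult_indicator chi_density_integrable_pair) auto
  then have I: "integrable (P \<Otimes>\<^sub>M lborel) (\<lambda>(\<omega>, u). indicator B \<omega> * (indicator S u * chi_density W u \<omega>))"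
    by (simp add: case_prod_beta' indicator_times ac_simps)
  show "integrable P (\<lambda>\<omega>. indicator B \<omega> * (\<integral>u. indicator S u * chi_density W u \<omega> \<partial>lborel))"
    using integrable_fst[OF I] by simp
  have "(\<integral>\<omega>. indicator B \<omega> * (\<integral>u. indicator S u * chi_density W u \<omega> \<partial>lborel) \<partial>P) = (\<integral>\<omega>. (\<integral>u. indicator B \<omega> * (indicator S u * chi_density W u \<omega>) \<partial>lborel) \<partial>P)"
    by simp
  also have "\<dots> = (\<integral>u. (\<integral>\<omega>. indicator B \<omega> * (indicator S u * chi_density W u \<omega>) \<partial>P) \<partial>lborel)"
    by (rule Fubini_integral[OF I, symmetric])
  also have "\<dots> = (\<integral>u. (\<integral>\<omega>. indicator S u * (indicator B \<omega> * chi_density W u \<omega>) \<partial>P) \<partial>lborel)"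
    by (simp add: mult.left_commute)
  finally show "(\<integral>\<omega>. indicator B \<omega> * (\<integral>u. indicator S u * chi_density W u \<omega> \<partial>lborel) \<partial>P) =
       (\<integral>u. indicator S u * (\<integral>\<omega>. indicator B \<omega> * chi_density W u \<omega> \<partial>P) \<partial>lborel)" by simp
qed

lemma chi_integrable: "integrable P (chi W t)"
  using chi_set_integral(1)[of "space P" "{..t}"]
  by (rule Bochner_Integration.integrable_cong[OF refl, THEN iffD1, rotated]) (simp_all add: chi_eq)

lemma chi_diff:
  assumes "integrable lborel (\<lambda>u. chi_density W u \<omega>)" "s \<le> t"
  shows "chi W t \<omega> - chi W s \<omega> = (\<integral>u. indicator {s<..t} u * chi_density W u \<omega> \<partial>lborel)"
proof -
  have I: "integrable lborel (\<lambda>u. indicator S u * chi_density W u \<omega>)" if "S \<in> sets borel" for S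
    using integrable_real_mult_indicator[of S lborel, OF _ assms(1)] that by (simp add: mult.commute)
  have "chi W t \<omega> - chi W s \<omega> = (\<integral>u. indicator {..t} u * chi_density W u \<omega> - indicator {..s} u * chi_density W u \<omega> \<partial>lborel)"
    unfolding chi_eq by (intro Bochner_Integration.integral_diff[symmetric] I) auto
  also have "\<dots> = (\<integral>u. indicator {s<..t} u * chi_density W u \<omega> \<partial>lborel)"
    using assms(2) by (intro Bochner_Integration.integral_cong) (auto simp: indicator_def)
  finally show ?thesis .
qed

definition X :: "real \<Rightarrow> 'a \<Rightarrow> real" where "X t \<omega> = W t \<omega> - W (min t (xi W \<omega>)) \<omega>"

definition N :: "real \<Rightarrow> 'a \<Rightarrow> real" where "N t \<omega> = X t \<omega> - chi W t \<omega>"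

lemma X_eq: "X t \<omega> = (if xi W \<omega> \<le> t then W t \<omega> - W 1 \<omega> / 2 else 0)"
  unfolding X_def using W_xi[of \<omega>] by (simp add: min_def)

lemma chi_before: "t \<le> xi W \<omega> \<Longrightarrow> chi W t \<omega> = 0"
proof -
  assume t: "t \<le> xi W \<omega>"
  have "(\<integral>u. indicator {..t} u * chi_density W u \<omega> \<partial>lborel) = (\<integral>(u::real). 0 \<partial>lborel)"
  proof (intro Bochner_Integration.integral_cong refl)
    fix u :: real show "indicator {..t} u * chi_density W u \<omega> = 0"
      using t chi_density_before[of u \<omega>] by (cases "u \<le> t") auto
  qed
  then show ?thesis by (simp add: chi_eq)
qed

lemma N_before: "t \<le> xi W \<omega> \<Longrightarrow> N t \<omega> = 0"
  unfolding N_def X_def using chi_before by (simp add: min_def)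

lemma X_integrable: "0 \<le> t \<Longrightarrow> integrable P (X t)"
proof -
  assume t: "0 \<le> t"
  have "integrable P (\<lambda>\<omega>. (W t \<omega> - W 1 \<omega> / 2) * indicator {\<omega>\<in>space P. xi W \<omega> \<le> t} \<omega>)"
    using t W_integrable[of 1] W_integrable[of t] by (intro integrable_real_mult_indicator) auto
  then show ?thesis by (rule Bochner_Integration.integrable_cong[OF refl, THEN iffD1, rotated]) (auto simp: X_eq)
qed

lemma N_integrable: "0 \<le> t \<Longrightarrow> integrable P (N t)"
  unfolding N_def by (intro Bochner_Integration.integrable_diff X_integrable chi_integrable)

lemma N_ind_integrable: "0 \<le> t \<Longrightarrow> B \<in> events \<Longrightarrow> integrable P (\<lambda>\<omega>. indicator B \<omega> * N t \<omega>)"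
  using integrable_real_mult_indicator[OF _ N_integrable[of t], of B] by (simp add: mult.commute)

lemma W_increment_mean_zero:
  assumes st: "0 \<le> s" "s \<le> t" and F: "F \<in> sets (FF s)"
  shows "(\<integral>\<omega>. indicator F \<omega> * (W t \<omega> - W s \<omega>) \<partial>P) = 0"
proof (cases "s = t")
  case False
  then have lt: "s < t" using st by simp
  interpret G: prob_space "density lborel (gauss (t - s))" using lt by (intro prob_space_gauss) auto
  note FF_id[of s, measurable] F[measurable]
  interpret A: prob_space "distr P (FF s) (\<lambda>\<omega>. \<omega>)" by (intro prob_space_distr) simp
  interpret pair_prob_space "distr P (FF s) (\<lambda>\<omega>. \<omega>)" "density lborel (gauss (t - s))" ..
  have [measurable]: "W t \<in> borel_measurable P" "W s \<in> borel_measurable P" using st by (auto intro: W_measurable)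
  define h :: "'a \<times> real \<Rightarrow> real" where "h = (\<lambda>p. indicator F (fst p) * snd p)"
  have h [measurable]: "h \<in> borel_measurable (FF s \<Otimes>\<^sub>M borel)" unfolding h_def by measurable
  have eq: "(\<lambda>\<omega>. indicator F \<omega> * (W t \<omega> - W s \<omega>)) = (\<lambda>\<omega>. h (\<omega>, W t \<omega> - W s \<omega>))" by (simp add: h_def)
  have Fe: "F \<in> sets P" using F by (rule sets_FF)
  have "integrable P (\<lambda>\<omega>. indicator F \<omega> * (W t \<omega> - W s \<omega>))"
    using integrable_real_mult_indicator[OF Fe, of "\<lambda>\<omega>. W t \<omega> - W s \<omega>"] W_integrable[of s] W_integrable[of t] st by (simp add: mult.commute)
  then have "integrable (distr P (FF s \<Otimes>\<^sub>M borel) (\<lambda>\<omega>. (\<omega>, W t \<omega> - W s \<omega>))) h"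
    unfolding eq by (subst integrable_distr_eq) measurable
  then have I: "integrable (distr P (FF s) (\<lambda>\<omega>. \<omega>) \<Otimes>\<^sub>M density lborel (gauss (t - s))) h"
    unfolding joint_distr[OF st(1) lt] .
  have "(\<integral>\<omega>. indicator F \<omega> * (W t \<omega> - W s \<omega>) \<partial>P) = (\<integral>p. h p \<partial>distr P (FF s \<Otimes>\<^sub>M borel) (\<lambda>\<omega>. (\<omega>, W t \<omega> - W s \<omega>)))"
    unfolding eq by (subst integral_distr) measurable
  also have "\<dots> = (\<integral>\<omega>. \<integral>z. h (\<omega>, z) \<partial>density lborel (gauss (t - s)) \<partial>distr P (FF s) (\<lambda>\<omega>. \<omega>))"
    unfolding joint_distr[OF st(1) lt, symmetric] using I by (rule integral_fst'[symmetric])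
  also have "\<dots> = (\<integral>\<omega>. 0 \<partial>distr P (FF s) (\<lambda>\<omega>. \<omega>))"
  proof (intro Bochner_Integration.integral_cong refl)
    fix \<omega>
    have "(\<integral>z. h (\<omega>, z) \<partial>density lborel (gauss (t - s))) = (\<integral>z. gauss (t - s) z * (indicator F \<omega> * z) \<partial>lborel)"
      by (subst integral_density) (auto simp: h_def)
    also have "\<dots> = indicator F \<omega> * (\<integral>z. gauss (t - s) z * z \<partial>lborel)"
      by (simp add: mult.left_commute)
    also have "(\<integral>z. gauss (t - s) z * z \<partial>lborel) = 0" using lt by (intro integral_normal_moment_nz_1) simp
    finally show "(\<integral>z. h (\<omega>, z) \<partial>density lborel (gauss (t - s))) = 0" by simp
  qed
  finally show ?thesis by simp
qed simp

lemma W_increment_L1: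
  assumes "0 \<le> s" "s < t"
  shows "(\<integral>\<omega>. \<bar>W t \<omega> - W s \<omega>\<bar> \<partial>P) \<le> sqrt (t - s)"
proof -
  have [measurable]: "W t \<in> borel_measurable P" "W s \<in> borel_measurable P" using assms by (auto intro: W_measurable)
  have "(\<integral>\<omega>. \<bar>W t \<omega> - W s \<omega>\<bar> \<partial>P) = (\<integral>x. \<bar>x\<bar> \<partial>distr P borel (\<lambda>\<omega>. W t \<omega> - W s \<omega>))"
    by (subst integral_distr) auto
  also have "\<dots> = (\<integral>x. gauss (t - s) x * \<bar>x - 0\<bar> ^ (2 * 0 + 1) \<partial>lborel)"
    unfolding incr_distr[OF assms] by (subst integral_density) auto
  also have "\<dots> = 2 ^ 0 * sqrt (t - s) ^ (2 * 0 + 1) * fact 0 * sqrt (2 / pi)"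
    using assms by (intro integral_normal_moment_abs_odd) simp
  also have "\<dots> \<le> sqrt (t - s)"
  proof -
    have "sqrt (2 / pi) \<le> 1" using pi_gt3 by simp
    then have "sqrt (t - s) * sqrt (2 / pi) \<le> sqrt (t - s) * 1" using assms by (intro mult_left_mono) auto
    then show ?thesis by simp
  qed
  finally show ?thesis .
qed

end

section \<open>Compensated increments after the random time\<close>

lemma isCont_indefinite_integral:
  fixes f :: "real \<Rightarrow> real"
  assumes I: "integrable lborel f"
  shows "isCont (\<lambda>t. \<integral>u. indicator {..t} u * f u \<partial>lborel) t"
  unfolding continuous_at_sequentially comp_def
proof (intro allI impI)
  fix r :: "nat \<Rightarrow> real" assume r: "r \<longlonglongrightarrow> t"
  show "(\<lambda>n. \<integral>u. indicator {..r n} u * f u \<partial>lborel) \<longlonglongrightarrow> (\<integral>u. indicator {..t} u * f u \<partial>lborel)"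
  proof (rule integral_dominated_convergence[where w="\<lambda>u. \<bar>f u\<bar>"])
    have [measurable]: "(\<lambda>u. f u) \<in> borel_measurable lborel" using I by auto
    show "(\<lambda>u. indicator {..t} u * f u) \<in> borel_measurable lborel"
      "(\<lambda>u. indicator {..r n} u * f u) \<in> borel_measurable lborel" for n by measurable
    show "integrable lborel (\<lambda>u. \<bar>f u\<bar>)" using I by (rule integrable_abs)
    show "AE u in lborel. (\<lambda>n. indicator {..r n} u * f u) \<longlonglongrightarrow> indicator {..t} u * f u"
      using AE_lborel_singleton[of t]
    proof eventually_elim
      case (elim u)
      have "(\<lambda>n. indicator {..r n} u :: real) \<longlonglongrightarrow> indicator {..t} u"
      proof (cases "u < t")
        case True
        then have "\<forall>\<^sub>F n in sequentially. u < r n" using r by (intro order_tendstoD)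
        then show ?thesis by (rule tendsto_eventually[OF eventually_mono]) (auto simp: indicator_def True less_imp_le)
      next
        case False
        then have ut: "t < u" using elim by simp
        then have "\<forall>\<^sub>F n in sequentially. r n < u" using r by (intro order_tendstoD)
        then show ?thesis by (rule tendsto_eventually[OF eventually_mono]) (use ut in \<open>auto simp: indicator_def\<close>)
      qed
      then show ?case by (intro tendsto_mult tendsto_const)
    qed
    show "AE u in lborel. norm (indicator {..r n} u * f u) \<le> \<bar>f u\<bar>" for n
      by (intro AE_I2) (auto simp: indicator_def)
  qed
qed

context cont_bm begin

lemma chi_isCont:
  assumes "integrable lborel (\<lambda>u. chi_density W u \<omega>)"
  shows "isCont (\<lambda>t. chi W t \<omega>) t"
  unfolding chi_eq by (rule isCont_indefinite_integral[OF assms])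

lemma chi_dominated: "integrable P (\<lambda>\<omega>. \<integral>u. \<bar>chi_density W u \<omega>\<bar> \<partial>lborel)"
  "AE \<omega> in P. \<forall>t. \<bar>chi W t \<omega>\<bar> \<le> (\<integral>u. \<bar>chi_density W u \<omega>\<bar> \<partial>lborel)"
proof -
  interpret pair_sigma_finite P lborel ..
  have "integrable (P \<Otimes>\<^sub>M lborel) (\<lambda>(\<omega>, u). \<bar>chi_density W u \<omega>\<bar>)"
    using integrable_abs[OF chi_density_integrable_pair] by (simp add: case_prod_beta')
  from integrable_fst[OF this] show "integrable P (\<lambda>\<omega>. \<integral>u. \<bar>chi_density W u \<omega>\<bar> \<partial>lborel)" .
  show "AE \<omega> in P. \<forall>t. \<bar>chi W t \<omega>\<bar> \<le> (\<integral>u. \<bar>chi_density W u \<omega>\<bar> \<partial>lborel)"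
    using chi_density_AE_integrable
  proof eventually_elim
    case (elim \<omega>)
    show ?case unfolding chi_eq
      using integrable_abs[OF elim] by (intro allI order_trans[OF integral_abs_bound] integral_mono') (auto simp: indicator_def)
  qed
qed

lemma W_increment_L1_abs: "0 \<le> s \<Longrightarrow> 0 \<le> t \<Longrightarrow> (\<integral>\<omega>. \<bar>W t \<omega> - W s \<omega>\<bar> \<partial>P) \<le> sqrt \<bar>t - s\<bar>"
  using W_increment_L1[of s t] W_increment_L1[of t s]
  by (cases s t rule: linorder_cases) (auto simp: abs_minus_commute)

text \<open>As a function of time, \<open>X\<close> is governed by \<open>W\<close>, which is continuous in \<open>L\<^sup>1\<close>, and by the indicator of
\<open>{\<xi> \<le> t}\<close>, whose convergence is a hypothesis because it fails at times approached from the left that \<open>\<xi>\<close> charges.\<close>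

lemma X_integral_LIMSEQ:
  assumes r: "r \<longlonglongrightarrow> t" "\<And>n. 0 \<le> r n" "0 \<le> t" and B [measurable]: "B \<in> events"
    and ind: "AE \<omega> in P. (\<lambda>n. indicator {..r n} (xi W \<omega>) :: real) \<longlonglongrightarrow> indicator {..t} (xi W \<omega>)"
  shows "(\<lambda>n. \<integral>\<omega>. indicator B \<omega> * X (r n) \<omega> \<partial>P) \<longlonglongrightarrow> (\<integral>\<omega>. indicator B \<omega> * X t \<omega> \<partial>P)"
proof -
  have Wm [measurable]: "W t \<in> borel_measurable P" "W 1 \<in> borel_measurable P" "W (r n) \<in> borel_measurable P" for n
    using r by (auto intro: W_measurable)
  have Xe: "X t \<omega> = indicator {..t} (xi W \<omega>) * (W t \<omega> - W 1 \<omega> / 2)" for t \<omega>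
    by (auto simp: X_eq indicator_def)
  have i1: "integrable P (\<lambda>\<omega>. indicator B \<omega> * (indicator {..r n} (xi W \<omega>) * (W (r n) \<omega> - W t \<omega>)))" for n
  proof (rule Bochner_Integration.integrable_bound[of P "\<lambda>\<omega>. W (r n) \<omega> - W t \<omega>"])
    show "integrable P (\<lambda>\<omega>. W (r n) \<omega> - W t \<omega>)" by (intro Bochner_Integration.integrable_diff W_integrable r)
    show "AE \<omega> in P. norm (indicator B \<omega> * (indicator {..r n} (xi W \<omega>) * (W (r n) \<omega> - W t \<omega>))) \<le> norm (W (r n) \<omega> - W t \<omega>)"
      by (intro AE_I2) (simp add: indicator_def)
  qed measurable
  have i2: "integrable P (\<lambda>\<omega>. indicator B \<omega> * (indicator {..r n} (xi W \<omega>) * (W t \<omega> - W 1 \<omega> / 2)))" for n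
  proof (rule Bochner_Integration.integrable_bound[of P "\<lambda>\<omega>. W t \<omega> - W 1 \<omega> / 2"])
    show "integrable P (\<lambda>\<omega>. W t \<omega> - W 1 \<omega> / 2)"
      using W_integrable[OF r(3)] W_integrable[of 1] by (intro Bochner_Integration.integrable_diff) auto
    show "AE \<omega> in P. norm (indicator B \<omega> * (indicator {..r n} (xi W \<omega>) * (W t \<omega> - W 1 \<omega> / 2))) \<le> norm (W t \<omega> - W 1 \<omega> / 2)"
      by (intro AE_I2) (simp add: indicator_def)
  qed measurable
  have split: "(\<integral>\<omega>. indicator B \<omega> * X (r n) \<omega> \<partial>P) =
      (\<integral>\<omega>. indicator B \<omega> * (indicator {..r n} (xi W \<omega>) * (W (r n) \<omega> - W t \<omega>)) \<partial>P) +
      (\<integral>\<omega>. indicator B \<omega> * (indicator {..r n} (xi W \<omega>) * (W t \<omega> - W 1 \<omega> / 2)) \<partial>P)" for n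
    unfolding Bochner_Integration.integral_add[OF i1 i2, symmetric]
    by (intro Bochner_Integration.integral_cong) (auto simp: Xe algebra_simps)
  have l1: "(\<lambda>n. \<integral>\<omega>. indicator B \<omega> * (indicator {..r n} (xi W \<omega>) * (W (r n) \<omega> - W t \<omega>)) \<partial>P) \<longlonglongrightarrow> 0"
  proof (rule Lim_null_comparison)
    show "\<forall>\<^sub>F n in sequentially. norm (\<integral>\<omega>. indicator B \<omega> * (indicator {..r n} (xi W \<omega>) * (W (r n) \<omega> - W t \<omega>)) \<partial>P) \<le> sqrt \<bar>r n - t\<bar>"
    proof (intro always_eventually allI)
      fix n
      have "norm (\<integral>\<omega>. indicator B \<omega> * (indicator {..r n} (xi W \<omega>) * (W (r n) \<omega> - W t \<omega>)) \<partial>P) \<le> (\<integral>\<omega>. \<bar>W (r n) \<omega> - W t \<omega>\<bar> \<partial>P)"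
        using W_integrable[of t] W_integrable[of "r n"] r
        by (intro order_trans[OF integral_norm_bound] integral_mono') (auto simp: indicator_def)
      also have "\<dots> \<le> sqrt \<bar>r n - t\<bar>" using r by (intro W_increment_L1_abs) auto
      finally show "norm (\<integral>\<omega>. indicator B \<omega> * (indicator {..r n} (xi W \<omega>) * (W (r n) \<omega> - W t \<omega>)) \<partial>P) \<le> sqrt \<bar>r n - t\<bar>" .
    qed
    have "(\<lambda>n. sqrt \<bar>r n - t\<bar>) \<longlonglongrightarrow> sqrt \<bar>t - t\<bar>" by (intro tendsto_intros r)
    then show "(\<lambda>n. sqrt \<bar>r n - t\<bar>) \<longlonglongrightarrow> 0" by simp
  qed
  have l2: "(\<lambda>n. \<integral>\<omega>. indicator B \<omega> * (indicator {..r n} (xi W \<omega>) * (W t \<omega> - W 1 \<omega> / 2)) \<partial>P) \<longlonglongrightarrow>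
      (\<integral>\<omega>. indicator B \<omega> * (indicator {..t} (xi W \<omega>) * (W t \<omega> - W 1 \<omega> / 2)) \<partial>P)"
  proof (rule integral_dominated_convergence[where w="\<lambda>\<omega>. \<bar>W t \<omega> - W 1 \<omega> / 2\<bar>"])
    show "integrable P (\<lambda>\<omega>. \<bar>W t \<omega> - W 1 \<omega> / 2\<bar>)"
      using W_integrable[of t] W_integrable[of 1] r by (intro integrable_abs Bochner_Integration.integrable_diff) auto
    show "AE \<omega> in P. (\<lambda>n. indicator B \<omega> * (indicator {..r n} (xi W \<omega>) * (W t \<omega> - W 1 \<omega> / 2))) \<longlonglongrightarrow>
       indicator B \<omega> * (indicator {..t} (xi W \<omega>) * (W t \<omega> - W 1 \<omega> / 2))"
      using ind by eventually_elim (intro tendsto_mult tendsto_const)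
    show "AE \<omega> in P. norm (indicator B \<omega> * (indicator {..r n} (xi W \<omega>) * (W t \<omega> - W 1 \<omega> / 2))) \<le> \<bar>W t \<omega> - W 1 \<omega> / 2\<bar>" for n
      by (intro AE_I2) (auto simp: indicator_def)
  qed measurable
  show ?thesis using tendsto_add[OF l1 l2] unfolding split[symmetric] by (simp add: Xe)
qed

lemma N_integral_LIMSEQ:
  assumes r: "r \<longlonglongrightarrow> t" "\<And>n. 0 \<le> r n" "0 \<le> t" and B [measurable]: "B \<in> events"
    and ind: "AE \<omega> in P. (\<lambda>n. indicator {..r n} (xi W \<omega>) :: real) \<longlonglongrightarrow> indicator {..t} (xi W \<omega>)"
  shows "(\<lambda>n. \<integral>\<omega>. indicator B \<omega> * N (r n) \<omega> \<partial>P) \<longlonglongrightarrow> (\<integral>\<omega>. indicator B \<omega> * N t \<omega> \<partial>P)"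
proof -
  have iX: "integrable P (\<lambda>\<omega>. indicator B \<omega> * X u \<omega>)" if "0 \<le> u" for u
    using integrable_real_mult_indicator[OF B X_integrable[OF that]] by (simp add: mult.commute)
  have iC: "integrable P (\<lambda>\<omega>. indicator B \<omega> * chi W u \<omega>)" for u
    using integrable_real_mult_indicator[OF B chi_integrable] by (simp add: mult.commute)
  have split: "(\<integral>\<omega>. indicator B \<omega> * N u \<omega> \<partial>P) = (\<integral>\<omega>. indicator B \<omega> * X u \<omega> \<partial>P) - (\<integral>\<omega>. indicator B \<omega> * chi W u \<omega> \<partial>P)" if "0 \<le> u" for u
    unfolding Bochner_Integration.integral_diff[OF iX[OF that] iC, symmetric] N_def by (simp add: right_diff_distrib)
  have [measurable]: "chi W u \<in> borel_measurable P" for u using chi_integrable by auto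
  have "(\<lambda>n. \<integral>\<omega>. indicator B \<omega> * chi W (r n) \<omega> \<partial>P) \<longlonglongrightarrow> (\<integral>\<omega>. indicator B \<omega> * chi W t \<omega> \<partial>P)"
  proof (rule integral_dominated_convergence[OF _ _ chi_dominated(1)])
    show "AE \<omega> in P. (\<lambda>n. indicator B \<omega> * chi W (r n) \<omega>) \<longlonglongrightarrow> indicator B \<omega> * chi W t \<omega>"
      using chi_density_AE_integrable
      by eventually_elim (intro tendsto_mult tendsto_const isCont_tendsto_compose[OF chi_isCont] r)
    show "AE \<omega> in P. norm (indicator B \<omega> * chi W (r n) \<omega>) \<le> (\<integral>u. \<bar>chi_density W u \<omega>\<bar> \<partial>lborel)" for n
      using chi_dominated(2) by eventually_elim (auto simp: indicator_def)
  qed measurable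
  from tendsto_diff[OF X_integral_LIMSEQ[OF r B ind] this] show ?thesis using r by (simp add: split)
qed

lemma N_increment_pos_last:
  assumes qst: "0 \<le> q" "q \<le> s" "s < t" "t < 1" and F: "F \<in> sets (FF s)"
  shows "(\<integral>\<omega>. indicator (F \<inter> pos_last q) \<omega> * (N t \<omega> - N s \<omega>) \<partial>P) = 0"
proof -
  define B where "B = F \<inter> pos_last q"
  have q1: "0 \<le> q" "q \<le> 1" using qst by auto
  have B: "B \<in> events" unfolding B_def using F sets_FF pos_last_events[OF q1] by auto
  have xiB: "xi W \<omega> < q" if "\<omega> \<in> B" for \<omega> using that pos_last_eq[OF q1] by (auto simp: B_def)
  have iW: "integrable P (\<lambda>\<omega>. indicator B \<omega> * (W t \<omega> - W s \<omega>))"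
    using integrable_real_mult_indicator[OF B, of "\<lambda>\<omega>. W t \<omega> - W s \<omega>"] W_integrable[of s] W_integrable[of t] qst by (simp add: mult.commute)
  have iC: "integrable P (\<lambda>\<omega>. indicator B \<omega> * (chi W t \<omega> - chi W s \<omega>))"
    using integrable_real_mult_indicator[OF B, of "\<lambda>\<omega>. chi W t \<omega> - chi W s \<omega>"] chi_integrable by (simp add: mult.commute)
  have "(\<integral>\<omega>. indicator B \<omega> * (W t \<omega> - W s \<omega>) \<partial>P) = (LINT u:{s<..t}|lborel. \<integral>\<omega>. indicator B \<omega> * chi_density W u \<omega> \<partial>P)"
    unfolding B_def drift_identity_pos[OF qst F]
  proof (intro set_lebesgue_integral_cong allI impI Bochner_Integration.integral_cong refl)
    fix u \<omega> assume u: "u \<in> {s<..t}"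
    show "indicator (F \<inter> pos_last q) \<omega> * (kern' (W 1 \<omega>) u (W u \<omega>) / kern (W 1 \<omega>) u (W u \<omega>)) = indicator (F \<inter> pos_last q) \<omega> * chi_density W u \<omega>"
    proof (cases "\<omega> \<in> F \<inter> pos_last q")
      case True
      then have "\<omega> \<in> pos_last u" using pos_last_mono[of q u] u qst by auto
      then show ?thesis using u qst by (simp add: chi_density_pos)
    qed simp
  qed simp
  also have "\<dots> = (\<integral>\<omega>. indicator B \<omega> * (\<integral>u. indicator {s<..t} u * chi_density W u \<omega> \<partial>lborel) \<partial>P)"
    unfolding set_lebesgue_integral_def using chi_set_integral(2)[OF B, of "{s<..t}"] by simp
  also have "\<dots> = (\<integral>\<omega>. indicator B \<omega> * (chi W t \<omega> - chi W s \<omega>) \<partial>P)"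
  proof (rule integral_cong_AE)
    show "AE \<omega> in P. indicator B \<omega> * (\<integral>u. indicator {s<..t} u * chi_density W u \<omega> \<partial>lborel) = indicator B \<omega> * (chi W t \<omega> - chi W s \<omega>)"
      using chi_density_AE_integrable by eventually_elim (use qst in \<open>simp add: chi_diff\<close>)
  qed (use chi_set_integral(1)[OF B, of "{s<..t}"] iC in auto)
  finally have "(\<integral>\<omega>. indicator B \<omega> * (W t \<omega> - W s \<omega>) \<partial>P) = (\<integral>\<omega>. indicator B \<omega> * (chi W t \<omega> - chi W s \<omega>) \<partial>P)" .
  moreover have "(\<integral>\<omega>. indicator B \<omega> * (N t \<omega> - N s \<omega>) \<partial>P) = (\<integral>\<omega>. indicator B \<omega> * (W t \<omega> - W s \<omega>) - indicator B \<omega> * (chi W t \<omega> - chi W s \<omega>) \<partial>P)"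
  proof (intro Bochner_Integration.integral_cong refl)
    fix \<omega>
    show "indicator B \<omega> * (N t \<omega> - N s \<omega>) = indicator B \<omega> * (W t \<omega> - W s \<omega>) - indicator B \<omega> * (chi W t \<omega> - chi W s \<omega>)"
      using xiB[of \<omega>] qst by (cases "\<omega> \<in> B") (auto simp: N_def X_eq)
  qed
  ultimately show ?thesis using iW iC unfolding B_def[symmetric] by simp
qed

lemma N_uminus: "cont_bm.N (\<lambda>t \<omega>. - W t \<omega>) t \<omega> = - N t \<omega>"
  unfolding N_def cont_bm.N_def[OF cont_bm_uminus] X_def cont_bm.X_def[OF cont_bm_uminus] chi_def
    set_lebesgue_integral_def
  by (simp add: xi_uminus chi_density_uminus)

lemma N_increment_before_1:
  assumes qst: "0 \<le> q" "q \<le> s" "s < t" "t < 1" and F: "F \<in> sets (FF s)"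
  shows "(\<integral>\<omega>. indicator (F \<inter> xi_less q) \<omega> * (N t \<omega> - N s \<omega>) \<partial>P) = 0"
proof -
  have q1: "0 \<le> q" "q \<le> 1" using qst by auto
  have e: "F \<inter> pos_last q \<in> events" "F \<inter> neg_last q \<in> events"
    using pos_last_events[OF q1] cont_bm.pos_last_events[OF cont_bm_uminus q1] sets_FF[OF F] by (auto simp: neg_last_eq[OF q1])
  have i: "integrable P (\<lambda>\<omega>. indicator B \<omega> * (N t \<omega> - N s \<omega>))" if "B \<in> events" for B
    using integrable_real_mult_indicator[OF that, of "\<lambda>\<omega>. N t \<omega> - N s \<omega>"] N_integrable[of t] N_integrable[of s] qst by (simp add: mult.commute)
  have "(\<integral>\<omega>. indicator (F \<inter> neg_last q) \<omega> * (- N t \<omega> - - N s \<omega>) \<partial>P) = 0"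
    using cont_bm.N_increment_pos_last[OF cont_bm_uminus qst F] unfolding neg_last_eq[OF q1] N_uminus .
  moreover have "(\<integral>\<omega>. indicator (F \<inter> neg_last q) \<omega> * (- N t \<omega> - - N s \<omega>) \<partial>P) = (\<integral>\<omega>. - (indicator (F \<inter> neg_last q) \<omega> * (N t \<omega> - N s \<omega>)) \<partial>P)"
    by (intro Bochner_Integration.integral_cong) (auto simp: algebra_simps)
  ultimately have n: "(\<integral>\<omega>. indicator (F \<inter> neg_last q) \<omega> * (N t \<omega> - N s \<omega>) \<partial>P) = 0" by simp
  have "(\<integral>\<omega>. indicator (F \<inter> xi_less q) \<omega> * (N t \<omega> - N s \<omega>) \<partial>P) =
    (\<integral>\<omega>. indicator (F \<inter> pos_last q) \<omega> * (N t \<omega> - N s \<omega>) + indicator (F \<inter> neg_last q) \<omega> * (N t \<omega> - N s \<omega>) \<partial>P)"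
    using xi_less_split(2)[OF q1] unfolding xi_less_split(1)[OF q1]
    by (intro Bochner_Integration.integral_cong) (auto simp: indicator_def)
  also have "\<dots> = 0" using N_increment_pos_last[OF qst F] n by (subst Bochner_Integration.integral_add) (auto intro: i e)
  finally show ?thesis .
qed

lemma N_after_1:
  assumes "1 \<le> s" "1 \<le> t" shows "N t \<omega> - N s \<omega> = W t \<omega> - W s \<omega>"
proof -
  have "chi W t \<omega> = chi W s \<omega>"
    unfolding chi_eq
  proof (intro Bochner_Integration.integral_cong refl)
    fix u :: real show "indicator {..t} u * chi_density W u \<omega> = indicator {..s} u * chi_density W u \<omega>"
      using assms chi_density_outside[of u \<omega>] by (cases "1 \<le> u") (auto simp: indicator_def)
  qed
  then show ?thesis using assms xi_range(2)[of \<omega>] by (simp add: N_def X_eq)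
qed

text \<open>Before time \<open>1\<close> this is the drift identity; time \<open>1\<close> is reached by a limit, as the density of \<open>\<chi>\<close> is singular
there; after time \<open>1\<close> the increments of \<open>N\<close> are those of \<open>W\<close>.\<close>

lemma N_increment_xi_less:
  assumes qst: "0 \<le> q" "q \<le> s" "s \<le> t" and F: "F \<in> sets (FF s)"
  shows "(\<integral>\<omega>. indicator (F \<inter> xi_less q) \<omega> * N t \<omega> \<partial>P) = (\<integral>\<omega>. indicator (F \<inter> xi_less q) \<omega> * N s \<omega> \<partial>P)"
proof -
  define B where "B = F \<inter> xi_less q"
  have B [measurable]: "B \<in> events" unfolding B_def using sets_FF[OF F] sets_FF[OF xi_less_FF] by auto
  have s0: "0 \<le> s" "0 \<le> t" using qst by auto
  define J where "J u = (\<integral>\<omega>. indicator B \<omega> * N u \<omega> \<partial>P)" for u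
  have diff: "(\<integral>\<omega>. indicator B \<omega> * (N u \<omega> - N v \<omega>) \<partial>P) = J u - J v" if "0 \<le> u" "0 \<le> v" for u v
    unfolding J_def right_diff_distrib using that by (intro Bochner_Integration.integral_diff N_ind_integrable) auto
  have low: "J u = J s" if u: "s \<le> u" "u < 1" for u
  proof (cases "s = u")
    case False
    then show ?thesis using N_increment_before_1[OF qst(1,2) _ u(2) F] diff[of u s] u s0 unfolding B_def[symmetric] by simp
  qed simp
  have one: "J 1 = J s" if s1: "s < 1"
  proof -
    define r where "r n = 1 - (1 - s) / real (Suc n)" for n
    have r: "r n < 1" "s \<le> r n" for n
    proof -
      show "r n < 1" using s1 by (simp add: r_def)
      have "(1 - s) / real (Suc n) \<le> (1 - s) / 1" using s1 by (intro divide_left_mono) auto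
      then show "s \<le> r n" by (simp add: r_def)
    qed
    have rl: "r \<longlonglongrightarrow> 1" unfolding r_def by real_asymp
    have r0: "0 \<le> r n" for n using r(2)[of n] s0 by linarith
    have "(\<lambda>n. J (r n)) \<longlonglongrightarrow> J 1" unfolding J_def
    proof (rule N_integral_LIMSEQ[OF rl _ _ B])
      show "AE \<omega> in P. (\<lambda>n. indicator {..r n} (xi W \<omega>) :: real) \<longlonglongrightarrow> indicator {..1} (xi W \<omega>)"
        using xi_less_1
      proof eventually_elim
        case (elim \<omega>)
        then have "\<forall>\<^sub>F n in sequentially. xi W \<omega> < r n" using rl by (intro order_tendstoD)
        then show ?case by (rule tendsto_eventually[OF eventually_mono]) (use elim in \<open>auto simp: indicator_def\<close>)
      qed
    qed (use r0 in auto)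
    moreover have "(\<lambda>n. J (r n)) = (\<lambda>_. J s)" using low r by simp
    ultimately have "(\<lambda>_::nat. J s) \<longlonglongrightarrow> J 1" by simp
    from LIMSEQ_unique[OF this tendsto_const] show ?thesis .
  qed
  have high: "J u = J v" if v: "1 \<le> v" "s \<le> v" "v \<le> u" for u v
  proof -
    have "B \<in> sets (FF v)" unfolding B_def using F xi_less_FF mono[OF v(2)] mono[OF v(1)] by blast
    then have "(\<integral>\<omega>. indicator B \<omega> * (W u \<omega> - W v \<omega>) \<partial>P) = 0" using v by (intro W_increment_mean_zero) auto
    then show ?thesis using diff[of u v] v N_after_1[of v u] by simp
  qed
  have "J t = J s"
  proof -
    consider "t < 1" | "1 \<le> t" "s < 1" | "1 \<le> s" by linarith
    then show ?thesis
    proof cases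
      case 1 show ?thesis by (rule low[OF qst(3) 1])
    next
      case 2
      have "J t = J 1" using 2 by (intro high) auto
      then show ?thesis using one[OF 2(2)] by simp
    next
      case 3 show ?thesis by (rule high[OF 3 order_refl qst(3)])
    qed
  qed
  then show ?thesis by (simp add: J_def B_def)
qed

end

section \<open>The martingale property in the enlarged filtration\<close>

lemma tendsto_indicator_atMost_right:
  fixes r :: "nat \<Rightarrow> real"
  assumes "r \<longlonglongrightarrow> t" "\<And>n. t \<le> r n"
  shows "(\<lambda>n. indicator {..r n} x :: real) \<longlonglongrightarrow> indicator {..t} x"
proof (cases "x \<le> t")
  case True
  then have "x \<le> r n" for n using assms(2) order_trans by blast
  then show ?thesis using True by simp
next
  case False
  then have "\<forall>\<^sub>F n in sequentially. r n < x" using assms(1) by (intro order_tendstoD) auto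
  then show ?thesis by (rule tendsto_eventually[OF eventually_mono]) (use False in \<open>auto simp: indicator_def\<close>)
qed

text \<open>The enlarged filtration is described by bounds from both sides. The upper bound compares \<open>H s\<close> with the past at
strictly later times, which covers the passage to right limits; the right continuity of the expectations of \<open>N\<close> makes up for it.\<close>

locale enlarged_bm = cont_bm +
  fixes H :: "real \<Rightarrow> 'a measure"
  assumes H_sub: "subalgebra P (H t)"
    and H_mono: "s \<le> t \<Longrightarrow> sets (H s) \<subseteq> sets (H t)"
    and H_upper: "0 \<le> s \<Longrightarrow> s < t \<Longrightarrow>
      sets (H s) \<subseteq> sigma_sets (space P) (sets (FF t) \<union> {{\<omega>\<in>space P. xi W \<omega> \<le> q} | q. q \<le> t})"
    and H_W: "0 \<le> r \<Longrightarrow> r \<le> t \<Longrightarrow> W r \<in> borel_measurable (H t)"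
    and H_xi: "0 \<le> q \<Longrightarrow> q \<le> t \<Longrightarrow> {\<omega>\<in>space P. xi W \<omega> \<le> q} \<in> sets (H t)"
begin

lemma space_H [simp]: "space (H t) = space P"
  using H_sub[of t] by (simp add: subalgebra_def)

lemma sets_H: "A \<in> sets (H t) \<Longrightarrow> A \<in> events"
  using H_sub[of t] by (auto simp: subalgebra_def)

abbreviation xi_le :: "real \<Rightarrow> 'a set" where "xi_le q \<equiv> {\<omega>\<in>space P. xi W \<omega> \<le> q}"

text \<open>The enlargement by the events \<open>{\<xi> \<le> q}\<close>, before passing to right limits.\<close>

definition raw_past :: "real \<Rightarrow> 'a set set" where
  "raw_past t = sigma_sets (space P) (sets (FF t) \<union> {xi_le q | q. q \<le> t})"

lemma xi_le_events [measurable]: "xi_le q \<in> events" by measurable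

lemma raw_past_events: "A \<in> raw_past t \<Longrightarrow> A \<in> events"
proof -
  have "raw_past t \<subseteq> events" unfolding raw_past_def
    by (rule sets.sigma_sets_subset) (auto intro: sets_FF xi_le_events)
  then show "A \<in> raw_past t \<Longrightarrow> A \<in> events" by auto
qed

lemma sigma_algebra_raw_past: "sigma_algebra (space P) (raw_past t)"
  unfolding raw_past_def
  by (rule sigma_algebra_sigma_sets) (use sets_FF sets.sets_into_space in fastforce)

lemma xi_le_raw_past: "q \<le> t \<Longrightarrow> xi_le q \<in> raw_past t"
  unfolding raw_past_def by (intro sigma_sets.Basic) auto

lemma N_increment_xi_le:
  assumes s: "0 \<le> q" "q \<le> s" "s < s'" "s' \<le> t" and F: "F \<in> sets (FF s)"
  shows "(\<integral>\<omega>. indicator (F \<inter> xi_le q) \<omega> * N t \<omega> \<partial>P) = (\<integral>\<omega>. indicator (F \<inter> xi_le q) \<omega> * N s' \<omega> \<partial>P)"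
proof -
  define r where "r n = q + (s' - s) / real (Suc n)" for n
  have r: "q < r n" "r n \<le> s'" "0 \<le> r n" for n
  proof -
    show "q < r n" using s by (simp add: r_def)
    have "(s' - s) / real (Suc n) \<le> (s' - s) / 1" using s by (intro divide_left_mono) auto
    then show "r n \<le> s'" using s by (simp add: r_def)
    show "0 \<le> r n" using \<open>q < r n\<close> s by simp
  qed
  have rl: "r \<longlonglongrightarrow> q" unfolding r_def by real_asymp
  have F': "F \<in> sets (FF s')" using F mono[of s s'] s by auto
  have Fe [measurable]: "F \<in> events" using F by (rule sets_FF)
  have lim: "(\<lambda>n. \<integral>\<omega>. indicator (F \<inter> xi_less (r n)) \<omega> * N u \<omega> \<partial>P) \<longlonglongrightarrow> (\<integral>\<omega>. indicator (F \<inter> xi_le q) \<omega> * N u \<omega> \<partial>P)"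
    if u: "0 \<le> u" for u
  proof (rule integral_dominated_convergence[where w="\<lambda>\<omega>. \<bar>N u \<omega>\<bar>"])
    have [measurable]: "N u \<in> borel_measurable P" using N_integrable[OF u] by auto
    show "(\<lambda>\<omega>. indicator (F \<inter> xi_le q) \<omega> * N u \<omega>) \<in> borel_measurable P"
      "(\<lambda>\<omega>. indicator (F \<inter> xi_less (r n)) \<omega> * N u \<omega>) \<in> borel_measurable P" for n by measurable
    show "AE \<omega> in P. norm (indicator (F \<inter> xi_less (r n)) \<omega> * N u \<omega>) \<le> \<bar>N u \<omega>\<bar>" for n
      by (intro AE_I2) (auto simp: indicator_def)
    show "AE \<omega> in P. (\<lambda>n. indicator (F \<inter> xi_less (r n)) \<omega> * N u \<omega>) \<longlonglongrightarrow> indicator (F \<inter> xi_le q) \<omega> * N u \<omega>"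
    proof (intro AE_I2 tendsto_mult tendsto_const)
      fix \<omega>
      show "(\<lambda>n. indicator (F \<inter> xi_less (r n)) \<omega> :: real) \<longlonglongrightarrow> indicator (F \<inter> xi_le q) \<omega>"
      proof (cases "xi W \<omega> \<le> q")
        case True
        then have "xi W \<omega> < r n" for n using r(1)[of n] by simp
        then show ?thesis using True by (simp add: indicator_def)
      next
        case False
        then have "\<forall>\<^sub>F n in sequentially. r n < xi W \<omega>" using rl by (intro order_tendstoD) auto
        then show ?thesis by (rule tendsto_eventually[OF eventually_mono]) (use False in \<open>auto simp: indicator_def\<close>)
      qed
    qed
  qed (use N_integrable[OF u] in auto)
  have eq: "(\<integral>\<omega>. indicator (F \<inter> xi_less (r n)) \<omega> * N t \<omega> \<partial>P) = (\<integral>\<omega>. indicator (F \<inter> xi_less (r n)) \<omega> * N s' \<omega> \<partial>P)" for n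
    using r[of n] s F' by (intro N_increment_xi_less) auto
  show ?thesis
    using lim[of t] lim[of s'] s unfolding eq using LIMSEQ_unique by force
qed

text \<open>The events \<open>F \<inter> {\<xi> \<le> q}\<close> form a generator stable under intersection, to which \<open>N_increment_xi_le\<close> applies.\<close>

lemma N_increment_raw_past:
  assumes s: "0 \<le> s" "s < s'" "s' \<le> t" and A: "A \<in> raw_past s"
  shows "(\<integral>\<omega>. indicator (A \<inter> xi_le s) \<omega> * N t \<omega> \<partial>P) = (\<integral>\<omega>. indicator (A \<inter> xi_le s) \<omega> * N s' \<omega> \<partial>P)"
proof -
  define gens where "gens = sets (FF s) \<union> {F \<inter> xi_le q | F q. F \<in> sets (FF s) \<and> q \<le> s}"
  have gensI1: "F \<in> gens" if "F \<in> sets (FF s)" for F using that by (simp add: gens_def)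
  have gensI2: "F \<inter> xi_le q \<in> gens" if "F \<in> sets (FF s)" "q \<le> s" for F q
    unfolding gens_def using that by blast
  have gensE: thesis if "B \<in> gens" "B \<in> sets (FF s) \<Longrightarrow> thesis"
      "\<And>F q. F \<in> sets (FF s) \<Longrightarrow> q \<le> s \<Longrightarrow> B = F \<inter> xi_le q \<Longrightarrow> thesis" for B thesis
    using that unfolding gens_def by blast
  have gens1: "sets (FF s) \<union> {xi_le q | q. q \<le> s} \<subseteq> gens"
  proof
    fix B assume "B \<in> sets (FF s) \<union> {xi_le q | q. q \<le> s}"
    then consider "B \<in> sets (FF s)" | q where "q \<le> s" "B = xi_le q" by blast
    then show "B \<in> gens"
    proof cases
      case 2
      have "space (FF s) \<inter> xi_le q \<in> gens" using 2(1) by (intro gensI2 sets.top)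
      moreover have "space (FF s) \<inter> xi_le q = B" using 2 by auto
      ultimately show ?thesis by simp
    qed (rule gensI1)
  qed
  have gens2: "gens \<subseteq> events"
  proof
    fix B assume "B \<in> gens"
    then show "B \<in> events" by (rule gensE) (auto intro: sets_FF)
  qed
  have stable: "Int_stable gens"
  proof (rule Int_stableI)
    fix A B assume A: "A \<in> gens" and B: "B \<in> gens"
    show "A \<inter> B \<in> gens"
    proof (rule gensE[OF A])
      assume 1: "A \<in> sets (FF s)"
      show ?thesis
      proof (rule gensE[OF B])
        assume "B \<in> sets (FF s)" with 1 show ?thesis by (intro gensI1 sets.Int)
      next
        fix F q assume F: "F \<in> sets (FF s)" "q \<le> s" "B = F \<inter> xi_le q"
        have "(A \<inter> F) \<inter> xi_le q \<in> gens" using 1 F by (intro gensI2 sets.Int)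
        then show ?thesis by (simp only: F(3) Int_assoc)
      qed
    next
      fix F q assume F: "F \<in> sets (FF s)" "q \<le> s" "A = F \<inter> xi_le q"
      show ?thesis
      proof (rule gensE[OF B])
        assume 1: "B \<in> sets (FF s)"
        have "(F \<inter> B) \<inter> xi_le q \<in> gens" using 1 F by (intro gensI2 sets.Int)
        moreover have "(F \<inter> B) \<inter> xi_le q = A \<inter> B" using F(3) by blast
        ultimately show ?thesis by simp
      next
        fix F' q' assume F': "F' \<in> sets (FF s)" "q' \<le> s" "B = F' \<inter> xi_le q'"
        have "(F \<inter> F') \<inter> xi_le (min q q') \<in> gens" using F F' by (intro gensI2 sets.Int) auto
        moreover have "(F \<inter> F') \<inter> xi_le (min q q') = A \<inter> B" using F(3) F'(3) by auto
        ultimately show ?thesis by simp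
      qed
    qed
  qed
  have "A \<in> sigma_sets (space P) gens"
    using A sigma_sets_mono'[OF gens1] unfolding raw_past_def by blast
  define D where "D \<omega> = N t \<omega> - N s' \<omega>" for \<omega>
  have s0: "0 \<le> s'" "0 \<le> t" using s by linarith+
  have D: "integrable P D" unfolding D_def by (intro Bochner_Integration.integrable_diff N_integrable s0)
  have Di: "integrable P (\<lambda>\<omega>. indicator B \<omega> * D \<omega>)" if "B \<in> events" for B
    using integrable_real_mult_indicator[OF that D] by (simp add: mult.commute)
  have diff: "(\<integral>\<omega>. indicator B \<omega> * D \<omega> \<partial>P) = (\<integral>\<omega>. indicator B \<omega> * N t \<omega> \<partial>P) - (\<integral>\<omega>. indicator B \<omega> * N s' \<omega> \<partial>P)" if "B \<in> events" for B
    unfolding D_def right_diff_distrib by (intro Bochner_Integration.integral_diff N_ind_integrable s0 that)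
  have base: "(\<integral>\<omega>. indicator (F \<inter> xi_le q) \<omega> * D \<omega> \<partial>P) = 0" if F: "F \<in> sets (FF s)" and q: "q \<le> s" for F q
  proof (cases "0 \<le> q")
    case True
    then show ?thesis using N_increment_xi_le[OF True q s(2,3) F] sets_FF[OF F] by (subst diff) auto
  next
    case False
    then have "\<not> xi W \<omega> \<le> q" for \<omega> using xi_range(1)[of \<omega>] by linarith
    then have e: "F \<inter> xi_le q = {}" by blast
    show ?thesis unfolding e by simp
  qed
  have gens_Pow: "gens \<subseteq> Pow (space P)" using gens2 sets.space_closed by blast
  have "(\<integral>\<omega>. indicator (A \<inter> xi_le s) \<omega> * D \<omega> \<partial>P) = 0"
    using stable gens_Pow \<open>A \<in> sigma_sets (space P) gens\<close>
  proof (induction rule: sigma_sets_induct_disjoint)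
    case (basic B)
    show ?case
    proof (rule gensE[OF basic])
      assume "B \<in> sets (FF s)" then show ?thesis by (rule base) simp
    next
      fix F q assume F: "F \<in> sets (FF s)" "q \<le> s" "B = F \<inter> xi_le q"
      then have "B \<inter> xi_le s = F \<inter> xi_le q" by auto
      then show ?thesis using base[OF F(1,2)] by simp
    qed
  next
    case empty then show ?case by simp
  next
    case (compl B)
    have Be: "B \<in> events" using compl.hyps sets.sigma_sets_subset[OF gens2] by blast
    have "(\<integral>\<omega>. indicator ((space P - B) \<inter> xi_le s) \<omega> * D \<omega> \<partial>P) = (\<integral>\<omega>. indicator (space P \<inter> xi_le s) \<omega> * D \<omega> - indicator (B \<inter> xi_le s) \<omega> * D \<omega> \<partial>P)"
      using sets.sets_into_space[OF Be] by (intro Bochner_Integration.integral_cong) (auto simp: indicator_def)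
    also have "\<dots> = 0"
      using compl.IH base[of "space P" s] sets.top[of "FF s"] Be
      by (subst Bochner_Integration.integral_diff) (auto intro: Di)
    finally show ?case .
  next
    case (union B)
    have Be: "B i \<in> events" for i using union.hyps sets.sigma_sets_subset[OF gens2] by blast
    have si: "set_integrable P (\<Union>i. B i \<inter> xi_le s) D"
      unfolding set_integrable_def using Be Di[of "\<Union>i. B i \<inter> xi_le s"] by simp
    have "(LINT \<omega>:(\<Union>i. B i \<inter> xi_le s)|P. D \<omega>) = (\<Sum>i. (LINT \<omega>:(B i \<inter> xi_le s)|P. D \<omega>))"
    proof (rule lebesgue_integral_countable_add[OF _ _ si])
      show "(B i \<inter> xi_le s) \<inter> (B j \<inter> xi_le s) = {}" if "i \<noteq> j" for i j
        using union.hyps that unfolding disjoint_family_on_def by blast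
    qed (use Be in auto)
    also have "\<dots> = 0" using union.IH by (simp add: set_lebesgue_integral_def)
    finally show ?case by (simp add: set_lebesgue_integral_def)
  qed
  then show ?thesis using raw_past_events[OF A] by (subst (asm) diff) auto
qed

lemma N_increment_after_xi:
  assumes s: "0 \<le> s" "s \<le> t" and A: "A \<in> sets (H s)"
  shows "(\<integral>\<omega>. indicator (A \<inter> xi_le s) \<omega> * N t \<omega> \<partial>P) = (\<integral>\<omega>. indicator (A \<inter> xi_le s) \<omega> * N s \<omega> \<partial>P)"
proof (cases "s = t")
  case False
  then have st: "s < t" using s by simp
  define r where "r n = s + (t - s) / real (Suc n)" for n
  have r: "s < r n" "r n \<le> t" "0 \<le> r n" for n
  proof -
    show "s < r n" using st by (simp add: r_def)
    have "(t - s) / real (Suc n) \<le> (t - s) / 1" using s by (intro divide_left_mono) auto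
    then show "r n \<le> t" using s by (simp add: r_def)
    show "0 \<le> r n" using \<open>s < r n\<close> s by simp
  qed
  have rl: "r \<longlonglongrightarrow> s" unfolding r_def by real_asymp
  define B where "B = A \<inter> xi_le s"
  have Be: "B \<in> events" unfolding B_def using sets_H[OF A] by auto
  have eq: "(\<integral>\<omega>. indicator B \<omega> * N t \<omega> \<partial>P) = (\<integral>\<omega>. indicator B \<omega> * N (r n) \<omega> \<partial>P)" for n
  proof -
    \<comment> \<open>A time strictly between, so that \<open>H s\<close> lies below the raw past at \<open>u\<close> and \<open>N\<close> is compared only after \<open>u\<close>.\<close>
    define u where "u = (s + r n) / 2"
    have u: "s < u" "u < r n" "0 \<le> u" using r(1)[of n] s by (auto simp: u_def)
    interpret GA: sigma_algebra "space P" "raw_past u" by (rule sigma_algebra_raw_past)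
    have "A \<in> raw_past u" using H_upper[OF s(1) u(1)] A unfolding raw_past_def by auto
    then have "B \<in> raw_past u" unfolding B_def using xi_le_raw_past[of s u] u by auto
    moreover have "B \<inter> xi_le u = B" unfolding B_def using u by auto
    ultimately show ?thesis using N_increment_raw_past[OF u(3,2) r(2), of B] by simp
  qed
  have "(\<lambda>n. \<integral>\<omega>. indicator B \<omega> * N (r n) \<omega> \<partial>P) \<longlonglongrightarrow> (\<integral>\<omega>. indicator B \<omega> * N s \<omega> \<partial>P)"
    using r by (intro N_integral_LIMSEQ rl s Be AE_I2 tendsto_indicator_atMost_right) (auto intro: less_imp_le)
  then have "(\<lambda>_::nat. \<integral>\<omega>. indicator B \<omega> * N t \<omega> \<partial>P) \<longlonglongrightarrow> (\<integral>\<omega>. indicator B \<omega> * N s \<omega> \<partial>P)" unfolding eq[symmetric] .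
  from LIMSEQ_unique[OF this tendsto_const] show ?thesis unfolding B_def by simp
qed simp

lemma chi_X_adapted: "0 \<le> t \<Longrightarrow> chi W t \<in> borel_measurable (H t)" "0 \<le> t \<Longrightarrow> X t \<in> borel_measurable (H t)"
proof -
  assume t: "0 \<le> t"
  define V where "V p = W (max 0 (min (fst p) t)) (snd p)" for p :: "real \<times> 'a"
  have V: "V \<in> borel_measurable (borel \<Otimes>\<^sub>M H t)"
  proof -
    have "(\<lambda>(u, \<omega>). W (max 0 (min u t)) \<omega>) \<in> borel_measurable (borel \<Otimes>\<^sub>M H t)"
    proof (rule borel_measurable_continuous_process)
      show "W (max 0 (min u t)) \<in> borel_measurable (H t)" for u using t by (intro H_W) auto
      show "continuous_on UNIV (\<lambda>u. W (max 0 (min u t)) \<omega>)" for \<omega>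
        by (rule continuous_on_compose2[OF W_cont]) (auto intro!: continuous_intros)
    qed
    then show ?thesis by (simp add: V_def[abs_def] case_prod_beta')
  qed
  define x where "x \<omega> = min t (xi W \<omega>)" for \<omega>
  have x [measurable]: "x \<in> borel_measurable (H t)"
  proof (rule borel_measurable_iff_le[THEN iffD2], intro allI)
    fix q
    consider "q < 0" | "0 \<le> q" "q < t" | "t \<le> q" by linarith
    then show "{\<omega> \<in> space (H t). x \<omega> \<le> q} \<in> sets (H t)"
    proof cases
      case 1
      then have "{\<omega> \<in> space (H t). x \<omega> \<le> q} = {}" using xi_range(1) t by (auto simp: x_def min_le_iff_disj not_le intro: less_le_trans)
      then show ?thesis by (simp only: sets.empty_sets)
    next
      case 2
      then have e: "{\<omega> \<in> space (H t). x \<omega> \<le> q} = xi_le q" by (auto simp: x_def min_le_iff_disj)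
      show ?thesis unfolding e using 2 by (intro H_xi) auto
    next
      case 3
      then have "{\<omega> \<in> space (H t). x \<omega> \<le> q} = space (H t)" by (auto simp: x_def min_le_iff_disj)
      then show ?thesis by (simp only: sets.top)
    qed
  qed
  define Z where "Z \<omega> = W (x \<omega>) \<omega>" for \<omega>
  have Z [measurable]: "Z \<in> borel_measurable (H t)"
  proof -
    have "(\<lambda>\<omega>. (x \<omega>, \<omega>)) \<in> measurable (H t) (borel \<Otimes>\<^sub>M H t)" by measurable
    from measurable_compose[OF this V] have "(\<lambda>\<omega>. W (max 0 (min (x \<omega>) t)) \<omega>) \<in> borel_measurable (H t)" by (simp add: V_def)
    moreover have "max 0 (min (x \<omega>) t) = x \<omega>" for \<omega> using xi_range(1)[of \<omega>] t by (auto simp: x_def)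
    ultimately show ?thesis by (simp add: Z_def[abs_def])
  qed
  have [measurable]: "W t \<in> borel_measurable (H t)" using t by (intro H_W) auto
  have "(\<lambda>\<omega>. W t \<omega> - Z \<omega>) \<in> borel_measurable (H t)" by measurable
  then show "X t \<in> borel_measurable (H t)" by (simp add: X_def[abs_def] Z_def x_def)
  define V' where "V' p = V (snd p, fst p)" for p
  have [measurable]: "V' \<in> borel_measurable (H t \<Otimes>\<^sub>M borel)"
    unfolding V'_def[abs_def] by (rule measurable_compose[OF _ V]) measurable
  define \<theta> where "\<theta> p = (if x (fst p) < snd p \<and> snd p < 1 \<and> snd p \<le> t then 1 else 0) * (kern' (2 * Z (fst p)) (snd p) (V' p) / kern (2 * Z (fst p)) (snd p) (V' p))" for p
  have \<theta>: "\<theta> \<in> borel_measurable (H t \<Otimes>\<^sub>M borel)" unfolding \<theta>_def[abs_def] by measurable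
  have \<theta>': "\<theta> \<in> borel_measurable (H t \<Otimes>\<^sub>M lborel)"
    using \<theta> by (subst measurable_cong_sets[OF sets_pair_measure_cong[OF refl sets_lborel] refl])
  have eq: "indicator {..t} u * chi_density W u \<omega> = \<theta> (\<omega>, u)" for u \<omega>
  proof (cases "xi W \<omega> < u \<and> u < 1 \<and> u \<le> t")
    case True
    then have "x \<omega> = xi W \<omega>" "0 \<le> u" using xi_range(1)[of \<omega>] by (auto simp: x_def)
    moreover have "2 * Z \<omega> = W 1 \<omega>" using W_xi[of \<omega>] \<open>x \<omega> = xi W \<omega>\<close> by (simp add: Z_def)
    ultimately show ?thesis using True by (simp add: chi_density_eq \<theta>_def V'_def V_def)
  next
    case False
    then have "\<not> (x \<omega> < u \<and> u < 1 \<and> u \<le> t)" by (auto simp: x_def)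
    then show ?thesis using False by (auto simp: chi_density_eq \<theta>_def indicator_def)
  qed
  have "(\<lambda>\<omega>. \<integral>u. \<theta> (\<omega>, u) \<partial>lborel) \<in> borel_measurable (H t)"
    by (rule lborel.borel_measurable_lebesgue_integral) (use \<theta>' in \<open>simp add: case_prod_beta'\<close>)
  then show "chi W t \<in> borel_measurable (H t)"
    by (simp add: chi_eq[abs_def] eq)
qed

lemma N_adapted: "0 \<le> t \<Longrightarrow> N t \<in> borel_measurable (H t)"
  unfolding N_def[abs_def] using chi_X_adapted[of t] by measurable

lemma X_continuous: "continuous_on {0..} (\<lambda>t. X t \<omega>)"
  unfolding X_def
  by (intro continuous_intros continuous_on_compose2[OF W_cont]) (use xi_range(1) in \<open>auto intro!: continuous_on_compose2[OF W_cont] continuous_intros\<close>)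

lemma N_continuous:
  assumes I: "integrable lborel (\<lambda>u. chi_density W u \<omega>)"
  shows "continuous_on {0..} (\<lambda>t. N t \<omega>)"
  unfolding N_def
  by (intro continuous_on_diff X_continuous continuous_at_imp_continuous_on ballI chi_isCont I)

text \<open>Cut \<open>(s, t]\<close> into small pieces. On the event that \<open>\<xi>\<close> falls into a given piece, the value of \<open>N\<close> at the right end point
of that piece may replace \<open>N\<^sub>t\<close>, because the martingale property holds after \<open>\<xi>\<close>. As the mesh tends to \<open>0\<close> this
value tends to \<open>N\<^sub>\<xi> = 0\<close>.\<close>

lemma N_integral_xi_between:
  assumes s: "0 \<le> s" "s < t" and A: "A \<in> sets (H s)"
  shows "(\<integral>\<omega>. indicator (A \<inter> {\<omega>\<in>space P. s < xi W \<omega> \<and> xi W \<omega> \<le> t}) \<omega> * N t \<omega> \<partial>P) = 0"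
proof -
  define r where "r n k = s + real k * ((t - s) / real (Suc n))" for n k :: nat
  define D where "D n k = {\<omega>\<in>space P. r n k < xi W \<omega> \<and> xi W \<omega> \<le> r n (Suc k)}" for n k
  \<comment> \<open>Truncation: where the value at the grid point is large, \<open>N\<^sub>t\<close> is kept. This provides the dominating function \<open>1 + |N\<^sub>t|\<close>; near \<open>\<xi>\<close> the small value is used eventually.\<close>
  define T where "T a b = (if \<bar>a\<bar> \<le> 1 then a else b)" for a b :: real
  define V where "V n \<omega> = (\<Sum>k<Suc n. indicator (D n k) \<omega> * T (N (r n (Suc k)) \<omega>) (N t \<omega>))" for n \<omega>
  define L where "L = {\<omega>\<in>space P. s < xi W \<omega> \<and> xi W \<omega> \<le> t}"
  have Ae [measurable]: "A \<in> events" using A by (rule sets_H)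
  have rs: "s \<le> r n k" "0 \<le> r n k" for n k using s by (auto simp: r_def)
  have rmono: "r n k \<le> r n (Suc k)" for n k 
  proof -
    have "r n (Suc k) = r n k + (t - s) / real (Suc n)" by (simp add: r_def distrib_right add_divide_distrib)
    then show ?thesis using s by simp
  qed
  have rlast: "r n (Suc n) = t" and r0: "r n 0 = s" for n by (auto simp: r_def)
  have rt: "r n k \<le> t" if "k \<le> Suc n" for n k
  proof -
    have "real k * ((t - s) / real (Suc n)) \<le> real (Suc n) * ((t - s) / real (Suc n))"
      using that s by (intro mult_right_mono) auto
    then show ?thesis by (simp add: r_def)
  qed
  have [measurable]: "D n k \<in> events" "L \<in> events" for n k unfolding D_def L_def by measurable
  have Nm [measurable]: "N u \<in> borel_measurable P" if "0 \<le> u" for u using N_integrable[OF that] by auto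
  have Nm' [measurable]: "N (r n k) \<in> borel_measurable P" "N t \<in> borel_measurable P" for n k using rs s by auto
  have tele: "(\<Sum>k<Suc n. indicator (D n k) \<omega> :: real) = indicator L \<omega>" if \<omega>: "\<omega> \<in> space P" for n \<omega>
  proof -
    have "(\<Sum>k<Suc n. indicator (D n k) \<omega> :: real) = (\<Sum>k<Suc n. indicator {..r n (Suc k)} (xi W \<omega>) - indicator {..r n k} (xi W \<omega>))"
      using rmono \<omega> by (intro sum.cong refl) (auto simp: D_def indicator_def intro: order_trans)
    also have "\<dots> = indicator {..r n (Suc n)} (xi W \<omega>) - indicator {..r n 0} (xi W \<omega>)"
      by (rule sum_lessThan_telescope)
    also have "\<dots> = indicator L \<omega>" unfolding rlast r0 using \<omega> s by (auto simp: L_def indicator_def)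
    finally show ?thesis .
  qed
  have iN: "integrable P (\<lambda>\<omega>. indicator B \<omega> * N u \<omega>)" if "B \<in> events" "0 \<le> u" for B u
    using N_ind_integrable[OF that(2,1)] .
  have step: "integrable P (\<lambda>\<omega>. indicator (A \<inter> D n k) \<omega> * T (N (r n (Suc k)) \<omega>) (N t \<omega>))"
    "(\<integral>\<omega>. indicator (A \<inter> D n k) \<omega> * N t \<omega> \<partial>P) = (\<integral>\<omega>. indicator (A \<inter> D n k) \<omega> * T (N (r n (Suc k)) \<omega>) (N t \<omega>) \<partial>P)"
    if k: "k < Suc n" for n k
  proof -
    define u where "u = r n (Suc k)"
    define S where "S = {\<omega>\<in>space P. \<bar>N u \<omega>\<bar> \<le> 1}"
    have u: "0 \<le> u" "s \<le> u" "u \<le> t" unfolding u_def using rs rt[of "Suc k" n] k by auto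
    have Se [measurable]: "S \<in> events" unfolding S_def using Nm[OF u(1)] by measurable
    have NH [measurable]: "N u \<in> borel_measurable (H u)" using u by (intro N_adapted)
    have SH: "S \<in> sets (H u)"
    proof -
      have "{\<omega>\<in>space (H u). \<bar>N u \<omega>\<bar> \<le> 1} \<in> sets (H u)" by measurable
      then show ?thesis by (simp add: S_def)
    qed
    define B1 where "B1 = A \<inter> S \<inter> D n k"
    define B2 where "B2 = A \<inter> D n k - S"
    have Be: "B1 \<in> events" "B2 \<in> events" unfolding B1_def B2_def by measurable
    have "xi_le (r n k) \<in> sets (H u)" using rmono[of n k] rs(2)[of n k] unfolding u_def by (intro H_xi)
    then have CH: "A \<inter> S - xi_le (r n k) \<in> sets (H u)"
      using A H_mono[OF u(2)] SH by blast
    have "(A \<inter> S - xi_le (r n k)) \<inter> xi_le u = B1"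
      using sets.sets_into_space[OF Ae] by (auto simp: B1_def D_def u_def)
    then have B1: "(\<integral>\<omega>. indicator B1 \<omega> * N t \<omega> \<partial>P) = (\<integral>\<omega>. indicator B1 \<omega> * N u \<omega> \<partial>P)"
      using N_increment_after_xi[OF u(1,3) CH] by simp
    have e1: "indicator (A \<inter> D n k) \<omega> * N t \<omega> = indicator B1 \<omega> * N t \<omega> + indicator B2 \<omega> * N t \<omega>" for \<omega>
      by (auto simp: B1_def B2_def indicator_def)
    have e2: "indicator (A \<inter> D n k) \<omega> * T (N u \<omega>) (N t \<omega>) = indicator B1 \<omega> * N u \<omega> + indicator B2 \<omega> * N t \<omega>" if "\<omega> \<in> space P" for \<omega>
      using that by (auto simp: B1_def B2_def S_def T_def indicator_def)
    have t0: "0 \<le> t" using s by simp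
    have "integrable P (\<lambda>\<omega>. indicator B1 \<omega> * N u \<omega> + indicator B2 \<omega> * N t \<omega>)"
      using u t0 by (intro Bochner_Integration.integrable_add iN Be)
    then have "integrable P (\<lambda>\<omega>. indicator (A \<inter> D n k) \<omega> * T (N u \<omega>) (N t \<omega>))"
      by (rule Bochner_Integration.integrable_cong[OF refl, THEN iffD1, rotated]) (rule e2[symmetric])
    then show "integrable P (\<lambda>\<omega>. indicator (A \<inter> D n k) \<omega> * T (N (r n (Suc k)) \<omega>) (N t \<omega>))"
      unfolding u_def .
    have "(\<integral>\<omega>. indicator (A \<inter> D n k) \<omega> * N t \<omega> \<partial>P) = (\<integral>\<omega>. indicator B1 \<omega> * N t \<omega> \<partial>P) + (\<integral>\<omega>. indicator B2 \<omega> * N t \<omega> \<partial>P)"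
      unfolding e1 by (intro Bochner_Integration.integral_add iN Be t0)
    also have "\<dots> = (\<integral>\<omega>. indicator B1 \<omega> * N u \<omega> + indicator B2 \<omega> * N t \<omega> \<partial>P)"
      unfolding B1 by (intro Bochner_Integration.integral_add[symmetric] iN Be t0 u)
    also have "\<dots> = (\<integral>\<omega>. indicator (A \<inter> D n k) \<omega> * T (N u \<omega>) (N t \<omega>) \<partial>P)"
      by (intro Bochner_Integration.integral_cong refl) (rule e2[symmetric])
    finally show "(\<integral>\<omega>. indicator (A \<inter> D n k) \<omega> * N t \<omega> \<partial>P) = (\<integral>\<omega>. indicator (A \<inter> D n k) \<omega> * T (N (r n (Suc k)) \<omega>) (N t \<omega>) \<partial>P)"
      unfolding u_def .
  qed
  have eq: "(\<integral>\<omega>. indicator (A \<inter> L) \<omega> * N t \<omega> \<partial>P) = (\<integral>\<omega>. indicator A \<omega> * V n \<omega> \<partial>P)" for n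
  proof -
    have "(\<integral>\<omega>. indicator (A \<inter> L) \<omega> * N t \<omega> \<partial>P) = (\<integral>\<omega>. (\<Sum>k<Suc n. indicator (A \<inter> D n k) \<omega> * N t \<omega>) \<partial>P)"
    proof (intro Bochner_Integration.integral_cong refl)
      fix \<omega> assume "\<omega> \<in> space P"
      note tele[OF this, of n]
      moreover have "(\<Sum>k<Suc n. indicator (A \<inter> D n k) \<omega> * N t \<omega>) = indicator A \<omega> * (\<Sum>k<Suc n. indicator (D n k) \<omega>) * N t \<omega>"
        unfolding indicator_inter_arith sum_distrib_right[symmetric] sum_distrib_left[symmetric] ..
      ultimately show "indicator (A \<inter> L) \<omega> * N t \<omega> = (\<Sum>k<Suc n. indicator (A \<inter> D n k) \<omega> * N t \<omega>)"
        by (simp only: indicator_inter_arith)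
    qed
    also have "\<dots> = (\<Sum>k<Suc n. \<integral>\<omega>. indicator (A \<inter> D n k) \<omega> * N t \<omega> \<partial>P)"
    proof (rule Bochner_Integration.integral_sum)
      fix k
      have "A \<inter> D n k \<in> events" by measurable
      moreover have "0 \<le> t" using s by simp
      ultimately show "integrable P (\<lambda>\<omega>. indicator (A \<inter> D n k) \<omega> * N t \<omega>)" by (rule iN)
    qed
    also have "\<dots> = (\<Sum>k<Suc n. \<integral>\<omega>. indicator (A \<inter> D n k) \<omega> * T (N (r n (Suc k)) \<omega>) (N t \<omega>) \<partial>P)"
      by (intro sum.cong refl step(2)) (simp only: lessThan_iff)
    also have "\<dots> = (\<integral>\<omega>. (\<Sum>k<Suc n. indicator (A \<inter> D n k) \<omega> * T (N (r n (Suc k)) \<omega>) (N t \<omega>)) \<partial>P)"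
      by (intro Bochner_Integration.integral_sum[symmetric] step(1)) (simp only: lessThan_iff)
    also have "\<dots> = (\<integral>\<omega>. indicator A \<omega> * V n \<omega> \<partial>P)"
      unfolding V_def sum_distrib_left by (simp add: indicator_inter_arith mult.assoc)
    finally show ?thesis .
  qed
  have sum_le: "\<bar>V n \<omega>\<bar> \<le> b" if \<omega>: "\<omega> \<in> space P" and b: "0 \<le> b" and
      T: "\<And>k. k < Suc n \<Longrightarrow> \<omega> \<in> D n k \<Longrightarrow> \<bar>T (N (r n (Suc k)) \<omega>) (N t \<omega>)\<bar> \<le> b" for n \<omega> b
  proof -
    have "\<bar>V n \<omega>\<bar> \<le> (\<Sum>k<Suc n. \<bar>indicator (D n k) \<omega> * T (N (r n (Suc k)) \<omega>) (N t \<omega>)\<bar>)"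
      unfolding V_def by (rule sum_abs)
    also have "\<dots> \<le> (\<Sum>k<Suc n. indicator (D n k) \<omega> * b)"
      using T by (intro sum_mono) (simp add: indicator_def)
    also have "\<dots> = indicator L \<omega> * b" unfolding sum_distrib_right[symmetric] tele[OF \<omega>] ..
    also have "\<dots> \<le> b" using b by (simp add: indicator_def)
    finally show ?thesis .
  qed
  have "(\<lambda>n. \<integral>\<omega>. indicator A \<omega> * V n \<omega> \<partial>P) \<longlonglongrightarrow> (\<integral>\<omega>. 0 \<partial>P)"
  proof (rule integral_dominated_convergence[where w="\<lambda>\<omega>. 1 + \<bar>N t \<omega>\<bar>"])
    show "(\<lambda>\<omega>. indicator A \<omega> * V n \<omega>) \<in> borel_measurable P" for n
      unfolding V_def T_def by measurable
    show "integrable P (\<lambda>\<omega>. 1 + \<bar>N t \<omega>\<bar>)" using N_integrable[of t] s by auto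
    show "AE \<omega> in P. norm (indicator A \<omega> * V n \<omega>) \<le> 1 + \<bar>N t \<omega>\<bar>" for n
    proof (rule AE_I2)
      fix \<omega> assume "\<omega> \<in> space P"
      then have "\<bar>V n \<omega>\<bar> \<le> 1 + \<bar>N t \<omega>\<bar>" by (intro sum_le) (auto simp: T_def)
      then show "norm (indicator A \<omega> * V n \<omega>) \<le> 1 + \<bar>N t \<omega>\<bar>" by (simp add: indicator_def)
    qed
    show "AE \<omega> in P. (\<lambda>n. indicator A \<omega> * V n \<omega>) \<longlonglongrightarrow> 0"
      using chi_density_AE_integrable
    proof (rule AE_mp, intro AE_I2 impI)
      fix \<omega> assume \<omega>: "\<omega> \<in> space P" and I: "integrable lborel (\<lambda>u. chi_density W u \<omega>)"
      have "(\<lambda>n. V n \<omega>) \<longlonglongrightarrow> 0"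
      proof (rule LIMSEQ_I)
        fix e :: real assume e: "0 < e"
        define e' where "e' = min (e / 2) 1"
        have e': "0 < e'" "e' < e" "e' \<le> 1" using e by (auto simp: e'_def)
        have "xi W \<omega> \<in> {0..}" using xi_range(1) by simp
        then obtain d where d: "0 < d" "\<And>v. v \<in> {0..} \<Longrightarrow> dist v (xi W \<omega>) < d \<Longrightarrow> dist (N v \<omega>) (N (xi W \<omega>) \<omega>) < e'"
          using N_continuous[OF I] e'(1) unfolding continuous_on_iff by meson
        have N0: "N (xi W \<omega>) \<omega> = 0" by (rule N_before) simp
        have "(\<lambda>n. (t - s) / real (Suc n)) \<longlonglongrightarrow> 0" by real_asymp
        then obtain M where M: "\<And>n. M \<le> n \<Longrightarrow> norm ((t - s) / real (Suc n) - 0) < d"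
          using LIMSEQ_D d(1) by blast
        show "\<exists>M. \<forall>n\<ge>M. norm (V n \<omega> - 0) < e"
        proof (intro exI allI impI)
          fix n assume "M \<le> n"
          then have dn: "(t - s) / real (Suc n) < d" using M[of n] s by simp
          have "\<bar>V n \<omega>\<bar> \<le> e'"
          proof (rule sum_le[OF \<omega>])
            fix k assume k: "\<omega> \<in> D n k"
            have "r n (Suc k) - r n k = (t - s) / real (Suc n)" by (simp add: r_def distrib_right add_divide_distrib)
            then have "dist (r n (Suc k)) (xi W \<omega>) < d" using k dn by (auto simp: D_def dist_real_def)
            then have "dist (N (r n (Suc k)) \<omega>) (N (xi W \<omega>) \<omega>) < e'" using rs(2) by (intro d(2)) auto
            then have "\<bar>N (r n (Suc k)) \<omega>\<bar> < e'" unfolding N0 by (simp add: dist_real_def)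
            then show "\<bar>T (N (r n (Suc k)) \<omega>) (N t \<omega>)\<bar> \<le> e'" using e' by (simp add: T_def)
          qed (use e' in simp)
          then show "norm (V n \<omega> - 0) < e" using e' by simp
        qed
      qed
      then show "(\<lambda>n. indicator A \<omega> * V n \<omega>) \<longlonglongrightarrow> 0" by (rule tendsto_mult_right_zero)
    qed
  qed simp
  then have "(\<lambda>n::nat. \<integral>\<omega>. indicator (A \<inter> L) \<omega> * N t \<omega> \<partial>P) \<longlonglongrightarrow> 0" unfolding eq[symmetric] by simp
  from LIMSEQ_unique[OF this tendsto_const] show ?thesis unfolding L_def by simp
qed

lemma N_martingale_sets:
  assumes s: "0 \<le> s" "s \<le> t" and A: "A \<in> sets (H s)"
  shows "(\<integral>\<omega>. indicator A \<omega> * N t \<omega> \<partial>P) = (\<integral>\<omega>. indicator A \<omega> * N s \<omega> \<partial>P)"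
proof (cases "s = t")
  case False
  then have st: "s < t" using s by simp
  have Ae: "A \<in> events" using A by (rule sets_H)
  define B where "B = A \<inter> {\<omega>\<in>space P. s < xi W \<omega> \<and> xi W \<omega> \<le> t}"
  have Be: "B \<in> events" "A \<inter> xi_le s \<in> events" unfolding B_def using Ae by measurable
  have "(\<integral>\<omega>. indicator A \<omega> * N t \<omega> \<partial>P) = (\<integral>\<omega>. indicator (A \<inter> xi_le s) \<omega> * N t \<omega> + indicator B \<omega> * N t \<omega> \<partial>P)"
  proof (intro Bochner_Integration.integral_cong refl)
    fix \<omega> assume "\<omega> \<in> space P"
    then show "indicator A \<omega> * N t \<omega> = indicator (A \<inter> xi_le s) \<omega> * N t \<omega> + indicator B \<omega> * N t \<omega>"
      using N_before[of t \<omega>] by (auto simp: B_def indicator_def)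
  qed
  also have "\<dots> = (\<integral>\<omega>. indicator (A \<inter> xi_le s) \<omega> * N t \<omega> \<partial>P) + (\<integral>\<omega>. indicator B \<omega> * N t \<omega> \<partial>P)"
    using s Be by (intro Bochner_Integration.integral_add N_ind_integrable) auto
  also have "(\<integral>\<omega>. indicator B \<omega> * N t \<omega> \<partial>P) = 0" unfolding B_def by (rule N_integral_xi_between[OF s(1) st A])
  also have "(\<integral>\<omega>. indicator (A \<inter> xi_le s) \<omega> * N t \<omega> \<partial>P) = (\<integral>\<omega>. indicator (A \<inter> xi_le s) \<omega> * N s \<omega> \<partial>P)"
    by (rule N_increment_after_xi[OF s A])
  also have "\<dots> = (\<integral>\<omega>. indicator A \<omega> * N s \<omega> \<partial>P)"
  proof (intro Bochner_Integration.integral_cong refl)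
    fix \<omega> assume "\<omega> \<in> space P"
    then show "indicator (A \<inter> xi_le s) \<omega> * N s \<omega> = indicator A \<omega> * N s \<omega>"
      using N_before[of s \<omega>] by (auto simp: indicator_def)
  qed
  finally show ?thesis by simp
qed simp

end

section \<open>Independence of the increments from the past\<close>

text \<open>Completing a \<open>\<sigma>\<close>-algebra changes its events only by negligible sets, so independence passes to the
completion.\<close>

lemma sigma_sets_null_completion:
  assumes F: "sigma_algebra (space P) F" "F \<subseteq> sets P"
    and A: "A \<in> sigma_sets (space P) (F \<union> null_sets P)"
  shows "\<exists>B\<in>F. (A - B) \<union> (B - A) \<in> null_sets P"
  using A
proof induction
  case (Basic a)
  interpret F: sigma_algebra "space P" F by fact
  show ?case
  proof (cases "a \<in> F")
    case False
    then have "a \<in> null_sets P" using Basic by auto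
    then show ?thesis by (intro bexI[of _ "{}"]) auto
  qed (auto intro!: bexI[of _ a])
next
  case Empty
  interpret F: sigma_algebra "space P" F by fact
  show ?case by (intro bexI[of _ "{}"]) auto
next
  case (Compl a)
  interpret F: sigma_algebra "space P" F by fact
  obtain B where B: "B \<in> F" "(a - B) \<union> (B - a) \<in> null_sets P" using Compl by auto
  have sub: "a \<subseteq> space P" 
    using Compl(1) F(2) sets.space_closed[of P] null_setsD2 by (intro sigma_sets_into_sp[of "F \<union> null_sets P"]) auto
  have "B \<subseteq> space P" using B F.sets_into_space by auto
  then have "((space P - a) - (space P - B)) \<union> ((space P - B) - (space P - a)) = (a - B) \<union> (B - a)"
    using sub by auto
  then show ?case using B by (intro bexI[of _ "space P - B"]) auto
next
  case (Union a)
  interpret F: sigma_algebra "space P" F by fact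
  obtain B where B: "\<And>i. B i \<in> F" "\<And>i::nat. (a i - B i) \<union> (B i - a i) \<in> null_sets P" using Union by metis
  have aP: "a i \<in> sets P" for i
  proof -
    have "sigma_sets (space P) (F \<union> null_sets P) \<subseteq> sets P"
      using F(2) by (intro sets.sigma_sets_subset) auto
    then show ?thesis using Union(1) by auto
  qed
  have BP: "B i \<in> sets P" for i using B F(2) by auto
  have "(\<Union>i. (a i - B i) \<union> (B i - a i)) \<in> null_sets P" using B(2) by (rule null_sets_UN)
  then have "((\<Union>i. a i) - (\<Union>i. B i)) \<union> ((\<Union>i. B i) - (\<Union>i. a i)) \<in> null_sets P"
    by (rule null_sets_subset) (use aP BP in auto)
  then show ?case using B(1) by (intro bexI[of _ "\<Union>i. B i"]) auto
qed

lemma space_natural_filtration [simp]: "space (natural_filtration \<Omega> X t) = \<Omega>"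
  by (auto simp: natural_filtration_def space_measure_of_conv)

lemma sets_natural_filtration:
  "sets (natural_filtration \<Omega> X t) = sigma_sets \<Omega> (\<Union>s\<in>{0..t}. {X s -` B \<inter> \<Omega> | B. B \<in> sets borel})"
  unfolding natural_filtration_def by (rule sets_measure_of) auto

lemma natural_filtration_measurable:
  assumes r: "0 \<le> r" "r \<le> t"
  shows "X r \<in> borel_measurable (natural_filtration \<Omega> X t)"
proof (rule measurableI)
  fix A :: "real set" assume A: "A \<in> sets borel"
  show "X r -` A \<inter> space (natural_filtration \<Omega> X t) \<in> sets (natural_filtration \<Omega> X t)"
    unfolding sets_natural_filtration space_natural_filtration
    using r A by (intro sigma_sets.Basic UN_I[of r] CollectI exI[of _ A]) auto
qed simp

lemma natural_filtration_mono:
  "s \<le> t \<Longrightarrow> sets (natural_filtration \<Omega> X s) \<subseteq> sets (natural_filtration \<Omega> X t)"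
  unfolding sets_natural_filtration by (intro sigma_sets_mono' UN_mono) auto

lemma natural_filtration_sub:
  assumes X: "\<And>r. 0 \<le> r \<Longrightarrow> r \<le> t \<Longrightarrow> X r \<in> borel_measurable K" and K: "space K = \<Omega>"
  shows "sets (natural_filtration \<Omega> X t) \<subseteq> sets K"
proof -
  have "sigma_sets (space K) (\<Union>s\<in>{0..t}. {X s -` B \<inter> space K | B. B \<in> sets borel}) \<subseteq> sets K"
    using X by (intro sets.sigma_sets_subset) (auto intro: measurable_sets)
  then show ?thesis unfolding sets_natural_filtration K .
qed

context
  fixes M :: "'a measure" and W :: "real \<Rightarrow> 'a \<Rightarrow> real"
  assumes prob: "prob_space M" and bm: "standard_brownian_motion M W"
begin

interpretation M: prob_space M by (rule prob)

lemma bm_meas: "0 \<le> t \<Longrightarrow> W t \<in> borel_measurable M"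
  using bm by (simp add: standard_brownian_motion_def)

text \<open>Sort the times: the values of \<open>W\<close> are then partial sums of increments that are independent of the last one. Time
\<open>0\<close> is added because the increments determine the values only up to \<open>W\<^sub>0\<close>, which vanishes almost surely.\<close>

lemma bm_past_tuple:
  assumes st: "0 \<le> s" "s < t" and I: "finite I" "I \<subseteq> {0..s}"
    and B: "\<And>r. r \<in> I \<Longrightarrow> B r \<in> sets borel" and C: "C \<in> sets borel"
  shows "M.prob ({\<omega>\<in>space M. \<forall>r\<in>I. W r \<omega> \<in> B r} \<inter> {\<omega>\<in>space M. W t \<omega> - W s \<omega> \<in> C}) =
    M.prob {\<omega>\<in>space M. \<forall>r\<in>I. W r \<omega> \<in> B r} * M.prob {\<omega>\<in>space M. W t \<omega> - W s \<omega> \<in> C}"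
proof -
  define J where "J = insert 0 (insert s I)"
  have J: "finite J" "J \<subseteq> {0..s}" "0 \<in> J" "s \<in> J" unfolding J_def using I st by auto
  define L where "L = sorted_list_of_set J"
  have L: "set L = J" "sorted L" "distinct L" unfolding L_def using J by auto
  define n where "n = length L - 1"
  have len: "length L = Suc n" unfolding n_def using L(1) J(3) by (cases L) auto
  define u where "u i = (if i \<le> n then L ! i else t)" for i
  have uJ: "u i \<in> J" if "i \<le> n" for i using that L(1) len by (auto simp: u_def intro!: nth_mem)
  have u0: "u 0 = 0"
  proof -
    obtain k where k: "k < length L" "L ! k = 0" using J(3) L(1) by (metis in_set_conv_nth)
    have "L ! 0 \<le> L ! k" using k L(2) by (intro sorted_nth_mono) auto
    moreover have "0 \<le> L ! 0" using uJ[of 0] J(2) by (auto simp: u_def)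
    ultimately show ?thesis using k by (simp add: u_def)
  qed
  have un: "u n = s"
  proof -
    obtain k where k: "k < length L" "L ! k = s" using J(4) L(1) by (metis in_set_conv_nth)
    have "L ! k \<le> L ! n" using k L(2) len by (intro sorted_nth_mono) auto
    moreover have "L ! n \<le> s" using uJ[of n] J(2) by (auto simp: u_def)
    ultimately show ?thesis using k by (simp add: u_def)
  qed
  have uS: "u (Suc n) = t" by (simp add: u_def)
  have umono: "u i \<le> u (Suc i)" if "i < Suc n" for i
  proof (cases "i < n")
    case True
    then show ?thesis using L(2) len by (auto simp: u_def intro!: sorted_nth_mono)
  next
    case False
    then have "i = n" using that by simp
    then show ?thesis using un uS st by simp
  qed
  define D where "D i \<omega> = W (u (Suc i)) \<omega> - W (u i) \<omega>" for i \<omega>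
  have "M.indep_vars (\<lambda>_. borel) D {..<Suc n}"
  proof -
    have "\<forall>n. \<forall>u :: nat \<Rightarrow> real. 0 \<le> u 0 \<longrightarrow> (\<forall>i<n. u i \<le> u (Suc i)) \<longrightarrow>
        M.indep_vars (\<lambda>_. borel) (\<lambda>i \<omega>. W (u (Suc i)) \<omega> - W (u i) \<omega>) {..<n}"
      using bm unfolding standard_brownian_motion_def by blast
    from this[rule_format, of u "Suc n"] show ?thesis unfolding D_def[abs_def] using umono u0 by simp
  qed
  then have iv: "M.indep_var (PiM {..<n} (\<lambda>_. borel)) (\<lambda>\<omega>. restrict (\<lambda>i. D i \<omega>) {..<n}) (PiM {n} (\<lambda>_. borel)) (\<lambda>\<omega>. restrict (\<lambda>i. D i \<omega>) {n})"
    by (rule M.indep_var_restrict) auto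
  have "\<exists>k\<le>n. u k = r" if "r \<in> I" for r
  proof -
    have "r \<in> set L" using that by (simp add: L(1) J_def)
    then obtain k where "k < length L" "L ! k = r" by (metis in_set_conv_nth)
    then show ?thesis using len by (intro exI[of _ k]) (auto simp: u_def)
  qed
  then obtain k where k: "\<And>r. r \<in> I \<Longrightarrow> k r \<le> n" "\<And>r. r \<in> I \<Longrightarrow> u (k r) = r" by metis
  define E where "E = {f \<in> space (PiM {..<n} (\<lambda>_. borel :: real measure)). \<forall>r\<in>I. (\<Sum>j<k r. f j) \<in> B r}"
  have E: "E \<in> sets (PiM {..<n} (\<lambda>_. borel))"
    unfolding E_def
  proof (rule sets.sets_Collect_finite_All)
    fix r assume r: "r \<in> I"
    have "(\<lambda>f. \<Sum>j<k r. f j) \<in> borel_measurable (PiM {..<n} (\<lambda>_. borel :: real measure))"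
      using k(1)[OF r] by (intro borel_measurable_sum measurable_component_singleton) auto
    from measurable_sets[OF this B[OF r]]
    show "{f \<in> space (PiM {..<n} (\<lambda>_. borel :: real measure)). (\<Sum>j<k r. f j) \<in> B r} \<in> sets (PiM {..<n} (\<lambda>_. borel))"
      by (simp add: vimage_def Int_def conj_commute)
  qed (rule I)
  define G where "G = {f \<in> space (PiM {n} (\<lambda>_. borel :: real measure)). f n \<in> C}"
  have G: "G \<in> sets (PiM {n} (\<lambda>_. borel))"
  proof -
    have "(\<lambda>f. f n) \<in> borel_measurable (PiM {n} (\<lambda>_. borel :: real measure))" by (intro measurable_component_singleton) simp
    from measurable_sets[OF this C] show ?thesis by (simp add: G_def vimage_def Int_def conj_commute)
  qed
  define EE where "EE = {\<omega>\<in>space M. \<forall>r\<in>I. (\<Sum>j<k r. D j \<omega>) \<in> B r}"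
  define GG where "GG = {\<omega>\<in>space M. W t \<omega> - W s \<omega> \<in> C}"
  have Ee: "(\<lambda>\<omega>. restrict (\<lambda>i. D i \<omega>) {..<n}) -` E \<inter> space M = EE"
  proof -
    have "(\<Sum>j<k r. restrict (\<lambda>i. D i \<omega>) {..<n} j) = (\<Sum>j<k r. D j \<omega>)" if "r \<in> I" for r \<omega>
      using k(1)[OF that] by (intro sum.cong) auto
    then show ?thesis unfolding E_def EE_def by (auto simp: space_PiM)
  qed
  have Ge: "(\<lambda>\<omega>. restrict (\<lambda>i. D i \<omega>) {n}) -` G \<inter> space M = GG"
    unfolding G_def GG_def by (auto simp: space_PiM D_def un uS)
  have "M.prob (EE \<inter> GG) = M.prob EE * M.prob GG"
  proof -
    have "(\<lambda>\<omega>. (restrict (\<lambda>i. D i \<omega>) {..<n}, restrict (\<lambda>i. D i \<omega>) {n})) -` (E \<times> G) \<inter> space M = EE \<inter> GG"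
      unfolding Ee[symmetric] Ge[symmetric] by auto
    then show ?thesis using M.indep_varD[OF iv E G] unfolding Ee Ge by simp
  qed
  moreover have W0: "AE \<omega> in M. W 0 \<omega> = 0" using bm by (simp add: standard_brownian_motion_def)
  have tel: "(\<Sum>j<k r. D j \<omega>) = W r \<omega> - W 0 \<omega>" if "r \<in> I" for r \<omega>
    unfolding D_def using sum_lessThan_telescope[of "\<lambda>j. W (u j) \<omega>" "k r"] k(2)[OF that] u0 by simp
  define FF where "FF = {\<omega>\<in>space M. \<forall>r\<in>I. W r \<omega> \<in> B r}"
  have um: "W (u i) \<in> borel_measurable M" if "i \<le> Suc n" for i
    using that uJ[of i] J(2) uS st by (cases "i = Suc n") (auto intro!: bm_meas)
  have [measurable]: "GG \<in> sets M"
  proof -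
    have [measurable]: "W t \<in> borel_measurable M" "W s \<in> borel_measurable M" "C \<in> sets borel" using st C by (auto intro: bm_meas)
    show ?thesis unfolding GG_def by measurable
  qed
  have [measurable]: "FF \<in> sets M" unfolding FF_def
  proof (rule sets.sets_Collect_finite_All[OF _ I(1)])
    fix r assume r: "r \<in> I"
    have [measurable]: "W r \<in> borel_measurable M" "B r \<in> sets borel" using r I(2) B by (auto intro!: bm_meas)
    show "{\<omega> \<in> space M. W r \<omega> \<in> B r} \<in> sets M" by measurable
  qed
  have EEs [measurable]: "EE \<in> sets M" unfolding Ee[symmetric]
    using iv E unfolding M.indep_var_eq by (auto intro: measurable_sets)
  have "AE \<omega> in M. \<omega> \<in> EE \<longleftrightarrow> \<omega> \<in> FF"
    using W0 by eventually_elim (auto simp: EE_def FF_def tel)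
  then have "M.prob EE = M.prob FF" "M.prob (EE \<inter> GG) = M.prob (FF \<inter> GG)"
    by (auto intro!: measure_eq_AE sets.Int elim!: AE_mp)
  ultimately show ?thesis unfolding FF_def GG_def by simp
qed

lemma bm_past_indep:
  assumes st: "0 \<le> s" "s < t" and F: "F \<in> sets (natural_filtration (space M) W s)" and C: "C \<in> sets borel"
  shows "M.prob (F \<inter> {\<omega>\<in>space M. W t \<omega> - W s \<omega> \<in> C}) = M.prob F * M.prob {\<omega>\<in>space M. W t \<omega> - W s \<omega> \<in> C}"
proof -
  define GG where "GG = {\<omega>\<in>space M. W t \<omega> - W s \<omega> \<in> C}"
  have [measurable]: "W t \<in> borel_measurable M" "W s \<in> borel_measurable M" "C \<in> sets borel" using st C by (auto intro: bm_meas)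
  have GGs: "GG \<in> sets M" unfolding GG_def by measurable
  define T where "T = {{\<omega>\<in>space M. \<forall>r\<in>I. W r \<omega> \<in> B r} | I B. finite I \<and> I \<subseteq> {0..s} \<and> (\<forall>r. B r \<in> sets (borel :: real measure))}"
  have TI: "{\<omega>\<in>space M. \<forall>r\<in>I. W r \<omega> \<in> B r} \<in> T" if "finite I" "I \<subseteq> {0..s}" "\<And>r. B r \<in> sets borel" for I B
    unfolding T_def using that by blast
  have TM: "T \<subseteq> sets M"
  proof
    fix A assume "A \<in> T"
    then obtain I B where A: "A = {\<omega>\<in>space M. \<forall>r\<in>I. W r \<omega> \<in> B r}" "finite I" "I \<subseteq> {0..s}" "\<And>r. B r \<in> sets borel"
      unfolding T_def by blast
    show "A \<in> sets M" unfolding A(1)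
    proof (rule sets.sets_Collect_finite_All[OF _ A(2)])
      fix r assume r: "r \<in> I"
      have [measurable]: "W r \<in> borel_measurable M" "B r \<in> sets borel" using r A by (auto intro!: bm_meas)
      show "{\<omega> \<in> space M. W r \<omega> \<in> B r} \<in> sets M" by measurable
    qed
  qed
  have stable: "Int_stable T"
  proof (rule Int_stableI)
    fix A A' assume "A \<in> T" "A' \<in> T"
    then obtain I B I' B' where A: "A = {\<omega>\<in>space M. \<forall>r\<in>I. W r \<omega> \<in> B r}" "finite I" "I \<subseteq> {0..s}" "\<And>r. B r \<in> sets borel"
      and A': "A' = {\<omega>\<in>space M. \<forall>r\<in>I'. W r \<omega> \<in> B' r}" "finite I'" "I' \<subseteq> {0..s}" "\<And>r. B' r \<in> sets borel"
      unfolding T_def by blast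
    define B'' where "B'' r = (if r \<in> I then B r else UNIV) \<inter> (if r \<in> I' then B' r else UNIV)" for r
    have "{\<omega>\<in>space M. \<forall>r\<in>I \<union> I'. W r \<omega> \<in> B'' r} \<in> T"
      using A A' by (intro TI) (auto simp: B''_def)
    moreover have "{\<omega>\<in>space M. \<forall>r\<in>I \<union> I'. W r \<omega> \<in> B'' r} = A \<inter> A'"
      unfolding A(1) A'(1) B''_def by (auto split: if_splits)
    ultimately show "A \<inter> A' \<in> T" by simp
  qed
  have "M.indep_set (sigma_sets (space M) T) (sigma_sets (space M) {GG})"
  proof (rule M.indep_set_sigma_sets[OF _ stable])
    show "M.indep_set T {GG}"
    proof (rule M.indep_setI[OF TM])
      fix a b assume "a \<in> T" "b \<in> {GG}"
      then obtain I B where A: "a = {\<omega>\<in>space M. \<forall>r\<in>I. W r \<omega> \<in> B r}" "finite I" "I \<subseteq> {0..s}" "\<And>r. B r \<in> sets borel" and b: "b = GG"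
        unfolding T_def by blast
      show "M.prob (a \<inter> b) = M.prob a * M.prob b"
        unfolding A(1) b GG_def by (rule bm_past_tuple[OF st A(2,3,4) C])
    qed (use GGs in auto)
  qed (auto simp: Int_stable_def)
  moreover have "F \<in> sigma_sets (space M) T"
  proof -
    have "(\<Union>r\<in>{0..s}. {W r -` B \<inter> space M | B. B \<in> sets borel}) \<subseteq> T"
    proof safe
      fix r and B :: "real set" assume r: "r \<in> {0..s}" and B: "B \<in> sets borel"
      have "{\<omega>\<in>space M. \<forall>r'\<in>{r}. W r' \<omega> \<in> B} \<in> T" using r B by (intro TI) auto
      moreover have "{\<omega>\<in>space M. \<forall>r'\<in>{r}. W r' \<omega> \<in> B} = W r -` B \<inter> space M" by auto
      ultimately show "W r -` B \<inter> space M \<in> T" by simp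
    qed
    then show ?thesis using F sigma_sets_mono' unfolding sets_natural_filtration by blast
  qed
  ultimately show ?thesis unfolding GG_def[symmetric] by (rule M.indep_setD) auto
qed

end

section \<open>Predictability\<close>

lemma space_predictable_sigma [simp]: "space (predictable_sigma \<Omega> F) = {0..} \<times> \<Omega>"
  by (simp add: predictable_sigma_def space_measure_of_conv)

context
  fixes \<Omega> :: "'a set" and F :: "real \<Rightarrow> 'a measure"
  assumes F: "filtration \<Omega> F"
begin

lemma pred_gen_subset:
  "({{0} \<times> A | A. A \<in> sets (F 0)} \<union> {{s<..t} \<times> A | s t A. 0 \<le> s \<and> s \<le> t \<and> A \<in> sets (F s)}) \<subseteq> Pow ({0..} \<times> \<Omega>)"
  using sets.sets_into_space[of _ "F _"] filtration.space_F[OF F] by fastforce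

lemma pred_rect:
  assumes "0 \<le> s" "A \<in> sets (F s)"
  shows "{s<..} \<times> A \<in> sets (predictable_sigma \<Omega> F)"
proof -
  have "{s<..s + real n} \<times> A \<in> sets (predictable_sigma \<Omega> F)" for n
    unfolding predictable_sigma_def sets_measure_of[OF pred_gen_subset]
    using assms by (intro sigma_sets.Basic UnI2 CollectI exI[of _ s] exI[of _ "s + real n"] exI[of _ A]) auto
  then have "(\<Union>n. {s<..s + real n} \<times> A) \<in> sets (predictable_sigma \<Omega> F)" by auto
  moreover have "(\<Union>n. {s<..s + real n} \<times> A) = {s<..} \<times> A"
  proof (intro set_eqI iffI)
    fix p assume "p \<in> {s<..} \<times> A"
    moreover obtain n where "fst p - s \<le> real n" using real_arch_simple by blast
    ultimately show "p \<in> (\<Union>n. {s<..s + real n} \<times> A)" by (auto simp: algebra_simps intro!: exI[of _ n])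
  qed auto
  ultimately show ?thesis by simp
qed

lemma pred_zero: "A \<in> sets (F 0) \<Longrightarrow> {0} \<times> A \<in> sets (predictable_sigma \<Omega> F)"
  unfolding predictable_sigma_def sets_measure_of[OF pred_gen_subset] by (intro sigma_sets.Basic) auto

lemma pred_fst [measurable]: "fst \<in> borel_measurable (predictable_sigma \<Omega> F)"
proof (rule borel_measurable_iff_greater[THEN iffD2], intro allI)
  fix a :: real
  show "{p \<in> space (predictable_sigma \<Omega> F). a < fst p} \<in> sets (predictable_sigma \<Omega> F)"
  proof (cases "0 \<le> a")
    case True
    then have "{p \<in> space (predictable_sigma \<Omega> F). a < fst p} = {a<..} \<times> \<Omega>" by auto
    moreover have "\<Omega> \<in> sets (F a)" using sets.top[of "F a"] by (simp add: filtration.space_F[OF F])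
    ultimately show ?thesis using pred_rect[OF True] by simp
  next
    case False
    then have e: "{p \<in> space (predictable_sigma \<Omega> F). a < fst p} = space (predictable_sigma \<Omega> F)" by auto
    show ?thesis unfolding e by (rule sets.top)
  qed
qed

lemma pred_after:
  assumes s: "0 \<le> s" and Y: "Y \<in> borel_measurable (F s)"
  shows "(\<lambda>p. if s < fst p then Y (snd p) else (0::real)) \<in> borel_measurable (predictable_sigma \<Omega> F)"
proof (rule borel_measurable_iff_greater[THEN iffD2], intro allI)
  fix a :: real
  have "{\<omega> \<in> space (F s). a < Y \<omega>} \<in> sets (F s)" using Y by measurable
  then have A: "{s<..} \<times> {\<omega> \<in> \<Omega>. a < Y \<omega>} \<in> sets (predictable_sigma \<Omega> F)"
    using pred_rect[OF s] by (simp add: filtration.space_F[OF F])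
  have B: "{p \<in> space (predictable_sigma \<Omega> F). \<not> s < fst p \<and> a < 0} \<in> sets (predictable_sigma \<Omega> F)" by measurable
  have e: "{p \<in> space (predictable_sigma \<Omega> F). a < (if s < fst p then Y (snd p) else 0)} =
    {s<..} \<times> {\<omega> \<in> \<Omega>. a < Y \<omega>} \<union> {p \<in> space (predictable_sigma \<Omega> F). \<not> s < fst p \<and> a < 0}"
    using s by auto
  show "{p \<in> space (predictable_sigma \<Omega> F). a < (if s < fst p then Y (snd p) else 0)} \<in> sets (predictable_sigma \<Omega> F)"
    unfolding e using A B by (rule sets.Un)
qed

lemma pred_at_0:
  assumes Y: "Y \<in> borel_measurable (F 0)"
  shows "(\<lambda>p. if fst p = 0 then Y (snd p) else (0::real)) \<in> borel_measurable (predictable_sigma \<Omega> F)"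
proof (rule borel_measurable_iff_greater[THEN iffD2], intro allI)
  fix a :: real
  have "{\<omega> \<in> space (F 0). a < Y \<omega>} \<in> sets (F 0)" using Y by measurable
  then have A: "{0} \<times> {\<omega> \<in> \<Omega>. a < Y \<omega>} \<in> sets (predictable_sigma \<Omega> F)"
    using pred_zero by (simp add: filtration.space_F[OF F])
  have B: "{p \<in> space (predictable_sigma \<Omega> F). \<not> fst p = 0 \<and> a < 0} \<in> sets (predictable_sigma \<Omega> F)" by measurable
  have e: "{p \<in> space (predictable_sigma \<Omega> F). a < (if fst p = 0 then Y (snd p) else 0)} =
    {0} \<times> {\<omega> \<in> \<Omega>. a < Y \<omega>} \<union> {p \<in> space (predictable_sigma \<Omega> F). \<not> fst p = 0 \<and> a < 0}"
    by auto
  show "{p \<in> space (predictable_sigma \<Omega> F). a < (if fst p = 0 then Y (snd p) else 0)} \<in> sets (predictable_sigma \<Omega> F)"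
    unfolding e using A B by (rule sets.Un)
qed

lemma pred_F0:
  assumes Y: "Y \<in> borel_measurable (F 0)"
  shows "(\<lambda>p. Y (snd p) :: real) \<in> borel_measurable (predictable_sigma \<Omega> F)"
proof -
  have "(\<lambda>p. (if fst p = 0 then Y (snd p) else 0) + (if 0 < fst p then Y (snd p) else 0)) \<in> borel_measurable (predictable_sigma \<Omega> F)"
    using pred_at_0[OF Y] pred_after[OF order_refl Y] by (rule borel_measurable_add)
  then show ?thesis
    by (rule measurable_cong[THEN iffD1, rotated]) auto
qed

lemma ceiling_grid_LIMSEQ: "(\<lambda>n. (real_of_int \<lceil>real (Suc n) * t\<rceil> - 1) / real (Suc n)) \<longlonglongrightarrow> t"
proof (rule Lim_null_comparison[of _ "\<lambda>n. 1 / real (Suc n)", THEN LIM_zero_cancel])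
  show "\<forall>\<^sub>F n in sequentially. norm ((real_of_int \<lceil>real (Suc n) * t\<rceil> - 1) / real (Suc n) - t) \<le> 1 / real (Suc n)"
  proof (intro always_eventually allI)
    fix n
    have 1: "real_of_int \<lceil>real (Suc n) * t\<rceil> - 1 \<le> real (Suc n) * t" "real (Suc n) * t - 1 \<le> real_of_int \<lceil>real (Suc n) * t\<rceil> - 1"
      by linarith+
    have "(real_of_int \<lceil>real (Suc n) * t\<rceil> - 1) / real (Suc n) - t = (real_of_int \<lceil>real (Suc n) * t\<rceil> - 1 - real (Suc n) * t) / real (Suc n)"
      by (simp add: field_simps)
    moreover have "\<bar>real_of_int \<lceil>real (Suc n) * t\<rceil> - 1 - real (Suc n) * t\<bar> / real (Suc n) \<le> 1 / real (Suc n)"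
      using 1 by (intro divide_right_mono) linarith+
    ultimately show "norm ((real_of_int \<lceil>real (Suc n) * t\<rceil> - 1) / real (Suc n) - t) \<le> 1 / real (Suc n)"
      by (simp add: abs_divide)
  qed
qed (use LIMSEQ_inverse_real_of_nat in \<open>simp add: divide_inverse\<close>)

text \<open>On a grid of mesh \<open>1 / (n + 1)\<close> use the value at the last grid point strictly before \<open>t\<close>.\<close>

lemma predictable_left_continuous:
  fixes Z :: "real \<Rightarrow> 'a \<Rightarrow> real"
  assumes ad: "\<And>t. 0 \<le> t \<Longrightarrow> Z t \<in> borel_measurable (F t)"
    and lc: "\<And>t \<omega>. 0 < t \<Longrightarrow> \<omega> \<in> \<Omega> \<Longrightarrow> ((\<lambda>t. Z t \<omega>) \<longlongrightarrow> Z t \<omega>) (at_left t)"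
  shows "predictable \<Omega> F Z"
  unfolding predictable_def
proof (rule borel_measurable_LIMSEQ_real)
  fix n
  define f where "f i p = (if i = 0 then (if fst p = 0 then Z 0 (snd p) else 0) else
     (if i < 0 then 0 else (if (real_of_int i - 1) / real (Suc n) < fst p then Z ((real_of_int i - 1) / real (Suc n)) (snd p) else 0)))" for i :: int and p
  have "f i \<in> borel_measurable (predictable_sigma \<Omega> F)" for i
  proof -
    consider "i = 0" | "i < 0" | "0 < i" by linarith
    then show ?thesis
    proof cases
      case 1 then show ?thesis unfolding f_def using pred_at_0[OF ad[OF order_refl]] by simp
    next
      case 2 then show ?thesis unfolding f_def by simp
    next
      case 3
      then have "0 \<le> (real_of_int i - 1) / real (Suc n)" by simp
      from pred_after[OF this ad[OF this]] show ?thesis unfolding f_def using 3 by simp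
    qed
  qed
  moreover have "(\<lambda>p. \<lceil>real (Suc n) * fst p\<rceil>) \<in> measurable (predictable_sigma \<Omega> F) (count_space UNIV)" by measurable
  ultimately show "(\<lambda>p. f \<lceil>real (Suc n) * fst p\<rceil> p) \<in> borel_measurable (predictable_sigma \<Omega> F)"
    by (rule measurable_compose_countable)
next
  fix p assume "p \<in> space (predictable_sigma \<Omega> F)"
  then obtain t \<omega> where p: "p = (t, \<omega>)" "0 \<le> t" "\<omega> \<in> \<Omega>" by auto
  show "(\<lambda>n. (if \<lceil>real (Suc n) * fst p\<rceil> = 0 then (if fst p = 0 then Z 0 (snd p) else 0) else
     (if \<lceil>real (Suc n) * fst p\<rceil> < 0 then 0 else (if (real_of_int \<lceil>real (Suc n) * fst p\<rceil> - 1) / real (Suc n) < fst p then Z ((real_of_int \<lceil>real (Suc n) * fst p\<rceil> - 1) / real (Suc n)) (snd p) else 0))))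
    \<longlonglongrightarrow> (case p of (t, \<omega>) \<Rightarrow> Z t \<omega>)"
  proof (cases "t = 0")
    case True then show ?thesis using p by simp
  next
    case False
    then have t: "0 < t" using p by simp
    define g where "g n = (real_of_int \<lceil>real (Suc n) * t\<rceil> - 1) / real (Suc n)" for n
    have pos: "0 < \<lceil>real (Suc n) * t\<rceil>" for n
    proof -
      have "0 < real (Suc n) * t" by (intro mult_pos_pos t) simp
      then show ?thesis by linarith
    qed
    have lt: "g n < t" for n
    proof -
      have "real_of_int \<lceil>real (Suc n) * t\<rceil> - 1 < real (Suc n) * t" by linarith
      then show ?thesis unfolding g_def by (simp add: divide_less_eq mult.commute)
    qed
    have "filterlim g (at_left t) sequentially"
      unfolding filterlim_at
    proof (intro conjI always_eventually allI)
      show "g \<longlonglongrightarrow> t" unfolding g_def[abs_def] by (rule ceiling_grid_LIMSEQ)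
      show "g n \<in> {..<t}" "g n \<noteq> t" for n using lt[of n] by auto
    qed
    from filterlim_compose[OF lc[OF t p(3)] this] have "(\<lambda>n. Z (g n) \<omega>) \<longlonglongrightarrow> Z t \<omega>" .
    moreover have "\<lceil>real (Suc n) * t\<rceil> \<noteq> 0" "\<not> \<lceil>real (Suc n) * t\<rceil> < 0" for n using pos[of n] by linarith+
    ultimately show ?thesis using lt unfolding p(1) g_def by (simp only: fst_conv snd_conv prod.case if_False if_True)
  qed
qed

text \<open>When all values are known at time \<open>0\<close>, looking into the future does no harm to predictability, so approximation
from the right is allowed.\<close>

lemma predictable_right_continuous_F0:
  fixes Z :: "real \<Rightarrow> 'a \<Rightarrow> real"
  assumes ad: "\<And>t. 0 \<le> t \<Longrightarrow> Z t \<in> borel_measurable (F 0)"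
    and rc: "\<And>t \<omega>. 0 \<le> t \<Longrightarrow> \<omega> \<in> \<Omega> \<Longrightarrow> ((\<lambda>t. Z t \<omega>) \<longlongrightarrow> Z t \<omega>) (at_right t)"
  shows "predictable \<Omega> F Z"
  unfolding predictable_def
proof (rule borel_measurable_LIMSEQ_real)
  fix n
  define f where "f i p = (if i < 0 then 0 else Z ((real_of_int i + 1) / real (Suc n)) (snd p))" for i :: int and p :: "real \<times> 'a"
  have "f i \<in> borel_measurable (predictable_sigma \<Omega> F)" for i
    unfolding f_def using pred_F0[OF ad, of "(real_of_int i + 1) / real (Suc n)"] by (cases "i < 0") auto
  moreover have "(\<lambda>p. \<lfloor>real (Suc n) * fst p\<rfloor>) \<in> measurable (predictable_sigma \<Omega> F) (count_space UNIV)" by measurable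
  ultimately show "(\<lambda>p. f \<lfloor>real (Suc n) * fst p\<rfloor> p) \<in> borel_measurable (predictable_sigma \<Omega> F)"
    by (rule measurable_compose_countable)
next
  fix p assume "p \<in> space (predictable_sigma \<Omega> F)"
  then obtain t \<omega> where p: "p = (t, \<omega>)" "0 \<le> t" "\<omega> \<in> \<Omega>" by auto
  define g where "g n = (real_of_int \<lfloor>real (Suc n) * t\<rfloor> + 1) / real (Suc n)" for n
  have nn: "\<not> \<lfloor>real (Suc n) * t\<rfloor> < 0" for n
  proof -
    have "0 \<le> real (Suc n) * t" by (intro mult_nonneg_nonneg p(2)) simp
    then show ?thesis by linarith
  qed
  have gt: "t < g n" for n
  proof -
    have "real (Suc n) * t < real_of_int \<lfloor>real (Suc n) * t\<rfloor> + 1" by linarith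
    then show ?thesis unfolding g_def by (simp add: less_divide_eq mult.commute)
  qed
  have "(\<lambda>n. real_of_int \<lfloor>real (Suc n) * t\<rfloor> / real (Suc n) + 1 / real (Suc n)) \<longlonglongrightarrow> t + 0"
    using LIMSEQ_inverse_real_of_nat by (intro tendsto_add floor_grid_LIMSEQ) (simp add: divide_inverse)
  then have "g \<longlonglongrightarrow> t" by (simp add: g_def[abs_def] add_divide_distrib)
  then have "filterlim g (at_right t) sequentially"
    unfolding filterlim_at
  proof (intro conjI always_eventually allI)
    show "g n \<in> {t<..}" "g n \<noteq> t" for n using gt[of n] by auto
  qed
  from filterlim_compose[OF rc[OF p(2,3)] this] have "(\<lambda>n. Z (g n) \<omega>) \<longlonglongrightarrow> Z t \<omega>" .
  then show "(\<lambda>n. (if \<lfloor>real (Suc n) * fst p\<rfloor> < 0 then 0 else Z ((real_of_int \<lfloor>real (Suc n) * fst p\<rfloor> + 1) / real (Suc n)) (snd p)))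
    \<longlonglongrightarrow> (case p of (t, \<omega>) \<Rightarrow> Z t \<omega>)"
    unfolding p(1) g_def using nn by (simp only: fst_conv snd_conv prod.case if_False)
qed

end

text \<open>The integral over \<open>[0, t]\<close> has the value \<open>0\<close> by convention once the integrand is not integrable there. So \<open>f\<close> is continuous
up to a time of explosion and \<open>0\<close> afterwards, and the side from which it is continuous at that time depends on
whether the integrand is still integrable up to and including it.\<close>

lemma indefinite_integral_one_sided:
  fixes \<theta> :: "real \<Rightarrow> real"
  defines "f \<equiv> (\<lambda>t. LINT u:{0..t}|lborel. \<theta> u)"
  shows "(\<forall>t>0. (f \<longlongrightarrow> f t) (at_left t)) \<or> (\<forall>t\<ge>0. (f \<longlongrightarrow> f t) (at_right t))"
proof (rule disjCI)
  define I where "I t \<longleftrightarrow> set_integrable lborel {0..t} \<theta>" for t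
  have Imono: "I s" if "I t" "s \<le> t" for s t
    using that unfolding I_def by (intro set_integrable_subset[of lborel "{0..t}" \<theta> "{0..s}"]) auto
  have f0: "f t = 0" if "\<not> I t" for t
    using that unfolding I_def f_def set_lebesgue_integral_def set_integrable_def by (intro not_integrable_integral_eq)
  have cont: "continuous_on {..b} f" if b: "I b" for b
  proof -
    define g where "g t = (\<integral>u. indicator {..t} u * (indicator {0..b} u * \<theta> u) \<partial>lborel)" for t
    have "isCont g t" for t
      unfolding g_def using b unfolding I_def set_integrable_def by (intro isCont_indefinite_integral) simp
    then have "continuous_on {..b} g" by (intro continuous_at_imp_continuous_on) auto
    moreover have "g t = f t" if "t \<in> {..b}" for t
      unfolding g_def f_def set_lebesgue_integral_def using that
      by (intro Bochner_Integration.integral_cong) (auto simp: indicator_def)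
    ultimately show ?thesis using continuous_on_cong by metis
  qed
  assume "\<not> (\<forall>t\<ge>0. (f \<longlongrightarrow> f t) (at_right t))"
  then obtain t where t: "0 \<le> t" "\<not> (f \<longlongrightarrow> f t) (at_right t)" by auto
  have It: "I t"
  proof (rule ccontr)
    assume nt: "\<not> I t"
    then have "f x = 0" if "t \<le> x" for x using f0 Imono[of x t] that by blast
    then have "\<forall>\<^sub>F x in at_right t. f x = f t"
      by (intro eventually_at_right_less[THEN eventually_mono]) auto
    then show False using t(2) tendsto_eventually by blast
  qed
  have nI: "\<not> I x" if "t < x" for x
  proof
    assume "I x"
    then have "(f \<longlongrightarrow> f t) (at t within {..x})" using cont[of x] that unfolding continuous_on_def by auto
    moreover have "at t within {t<..<x} = at_right t"
      using that by (intro at_within_nhd[of t "{..<x}"]) auto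
    moreover have "(f \<longlongrightarrow> f t) (at t within {t<..<x})"
      using calculation(1) by (rule tendsto_within_subset) auto
    ultimately show False using t(2) by simp
  qed
  show "\<forall>t>0. (f \<longlongrightarrow> f t) (at_left t)"
  proof (intro allI impI)
    fix x :: real assume x: "0 < x"
    show "(f \<longlongrightarrow> f x) (at_left x)"
    proof (cases "x \<le> t")
      case True
      then have "I x" using It Imono by blast
      then have "(f \<longlongrightarrow> f x) (at x within {..x})" using cont[of x] unfolding continuous_on_def by auto
      then show ?thesis by (rule tendsto_within_subset) auto
    next
      case False
      then have "\<forall>\<^sub>F y in at_left x. t < y" by (intro eventually_at_leftI[of t]) auto
      then have "\<forall>\<^sub>F y in at_left x. f y = f x"
        by eventually_elim (use False nI f0 in auto)
      then show ?thesis by (rule tendsto_eventually)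
    qed
  qed
qed

section \<open>The drift of the enlarged Brownian motion\<close>

text \<open>Functions may be changed on a set all of whose subsets are measurable.\<close>

lemma measurable_modification:
  fixes f g :: "'a \<Rightarrow> real"
  assumes f: "f \<in> borel_measurable K" and N: "\<And>A. A \<subseteq> N \<Longrightarrow> A \<in> sets K"
    and eq: "\<And>\<omega>. \<omega> \<in> space K \<Longrightarrow> \<omega> \<notin> N \<Longrightarrow> f \<omega> = g \<omega>"
  shows "g \<in> borel_measurable K"
proof (rule measurableI)
  fix B :: "real set" assume B: "B \<in> sets borel"
  have e: "g -` B \<inter> space K = (f -` B \<inter> space K - N) \<union> (g -` B \<inter> space K \<inter> N)" using eq by auto
  have "f -` B \<inter> space K \<in> sets K" using f B by (rule measurable_sets)
  moreover have "N \<in> sets K" and 2: "g -` B \<inter> space K \<inter> N \<in> sets K" using N by auto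
  ultimately have "f -` B \<inter> space K - N \<in> sets K" by (intro sets.Diff)
  from sets.Un[OF this 2] show "g -` B \<inter> space K \<in> sets K" by (subst e)
qed simp

lemma set_of_indicator_measurable:
  assumes f: "(\<lambda>\<omega>. indicator {x \<omega>..} q :: real) \<in> borel_measurable K"
  shows "{\<omega>\<in>space K. x \<omega> \<le> q} \<in> sets K"
proof -
  have "{\<omega>\<in>space K. indicator {x \<omega>..} q = (1::real)} \<in> sets K" using f by measurable
  moreover have "{\<omega>\<in>space K. indicator {x \<omega>..} q = (1::real)} = {\<omega>\<in>space K. x \<omega> \<le> q}" by (auto simp: indicator_def)
  ultimately show ?thesis by simp
qed

lemma indicator_of_set_measurable:
  assumes f: "{\<omega>\<in>space K. x \<omega> \<le> q} \<in> sets K"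
  shows "(\<lambda>\<omega>. indicator {x \<omega>..} q :: real) \<in> borel_measurable K"
proof -
  have "(\<lambda>\<omega>. indicator {\<omega>\<in>space K. x \<omega> \<le> q} \<omega> :: real) \<in> borel_measurable K" using f by measurable
  then show ?thesis by (rule measurable_cong[THEN iffD1, rotated]) (auto simp: indicator_def)
qed

context
  fixes M :: "'a measure" and W :: "real \<Rightarrow> 'a \<Rightarrow> real" and N0 :: "'a set"
  assumes prob: "prob_space M" and bm: "standard_brownian_motion M W"
    and N0: "N0 \<in> null_sets M"
    and good: "\<forall>\<omega>\<in>space M - N0. W 0 \<omega> = 0 \<and> continuous_on {0..} (\<lambda>t. W t \<omega>)"
begin

interpretation M: prob_space M by (rule prob)

definition P where "P = completion M"
text \<open>The exceptional paths are replaced by \<open>0\<close>, so that every path is continuous and starts at \<open>0\<close>.\<close>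

definition V where "V t \<omega> = (if \<omega> \<in> N0 \<or> \<omega> \<notin> space M then 0 else W t \<omega>)" for t \<omega>
definition F0 where "F0 = natural_filtration (space M) W"
text \<open>The negligible sets have to be included for \<open>V\<close> to be adapted. Right limits are not taken; they enter only
through \<open>H\<close>.\<close>

definition FF where "FF t = sigma (space M) (sets (F0 t) \<union> null_sets P)" for t
definition H where "H = progressive_enlargement M W (xi W)"

lemma space_P [simp]: "space P = space M" by (simp add: P_def)

lemma prob_P: "prob_space P"
  unfolding P_def by (rule prob_spaceI) (simp add: M.emeasure_space_1)

lemma null_P: "A \<subseteq> N0 \<Longrightarrow> A \<in> null_sets P"
  using N0 unfolding P_def by (intro null_sets_completion_subset[OF _ null_sets_completionI])

lemma sets_M_P: "A \<in> sets M \<Longrightarrow> A \<in> sets P" by (simp add: P_def)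

lemma V_eq: "\<omega> \<in> space M \<Longrightarrow> \<omega> \<notin> N0 \<Longrightarrow> V t \<omega> = W t \<omega>"
  by (simp add: V_def)

lemma xi_V: "\<omega> \<in> space M \<Longrightarrow> \<omega> \<notin> N0 \<Longrightarrow> xi V \<omega> = xi W \<omega>"
  by (simp add: xi_def V_eq)

lemma chi_density_V: "\<omega> \<in> space M \<Longrightarrow> \<omega> \<notin> N0 \<Longrightarrow> chi_density V u \<omega> = chi_density W u \<omega>"
  by (simp add: chi_density_def V_eq xi_V)

lemma chi_V: "\<omega> \<in> space M \<Longrightarrow> \<omega> \<notin> N0 \<Longrightarrow> chi V t \<omega> = chi W t \<omega>"
  by (simp add: chi_def chi_density_V)

lemma W_M: "0 \<le> t \<Longrightarrow> W t \<in> borel_measurable M"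
  using bm by (simp add: standard_brownian_motion_def)

lemma V_M: "0 \<le> t \<Longrightarrow> V t \<in> borel_measurable M"
proof -
  assume t: "0 \<le> t"
  have [measurable]: "W t \<in> borel_measurable M" "N0 \<in> sets M" using t W_M N0 by auto
  have "(\<lambda>\<omega>. if \<omega> \<in> N0 then 0 else W t \<omega>) \<in> borel_measurable M" by measurable
  then show ?thesis by (rule measurable_cong[THEN iffD1, rotated]) (simp add: V_def)
qed

lemma F0_sub: "sets (F0 t) \<subseteq> sets M"
  unfolding F0_def using W_M by (intro natural_filtration_sub) auto

lemma FF_gen: "sets (F0 t) \<union> null_sets P \<subseteq> Pow (space M)"
proof -
  have "sets (F0 t) \<subseteq> Pow (space M)" using F0_sub sets.space_closed[of M] by blast
  moreover have "null_sets P \<subseteq> Pow (space M)" using sets.space_closed[of P] by (auto simp: null_sets_def)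
  ultimately show ?thesis by blast
qed

lemma sets_FF: "sets (FF t) = sigma_sets (space M) (sets (F0 t) \<union> null_sets P)"
  unfolding FF_def by (rule sets_measure_of[OF FF_gen])

lemma space_FF: "space (FF t) = space M"
  unfolding FF_def by (rule space_measure_of[OF FF_gen])

lemma null_FF: "A \<in> null_sets P \<Longrightarrow> A \<in> sets (FF t)"
  unfolding sets_FF by (intro sigma_sets.Basic) auto

lemma F0_FF: "A \<in> sets (F0 t) \<Longrightarrow> A \<in> sets (FF t)"
  unfolding sets_FF by (intro sigma_sets.Basic) auto

lemma FF_P: "sets (FF t) \<subseteq> sets P"
  unfolding sets_FF space_P[symmetric] using F0_sub sets_M_P by (intro sets.sigma_sets_subset) auto

lemma W_FF: "0 \<le> r \<Longrightarrow> r \<le> t \<Longrightarrow> W r \<in> borel_measurable (FF t)"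
proof (rule measurableI)
  fix B :: "real set" assume r: "0 \<le> r" "r \<le> t" and B: "B \<in> sets borel"
  have "W r -` B \<inter> space M \<in> sets (F0 t)"
    using measurable_sets[OF natural_filtration_measurable[OF r, of W "space M"] B] by (simp add: F0_def)
  then show "W r -` B \<inter> space (FF t) \<in> sets (FF t)"
    unfolding space_FF by (rule F0_FF)
qed simp

lemma bm_V: "cont_bm P FF V"
proof (intro cont_bm.intro cont_bm_axioms.intro prob_P)
  interpret P: prob_space P by (rule prob_P)
  show "subalgebra P (FF s)" for s using FF_P by (simp add: subalgebra_def space_FF)
  show "sets (FF s) \<subseteq> sets (FF t)" if "s \<le> t" for s t
    unfolding sets_FF using natural_filtration_mono[OF that, of "space M" W] by (intro sigma_sets_mono') (auto simp: F0_def)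
  show "V s \<in> borel_measurable (FF s)" if s: "0 \<le> s" for s
    by (rule measurable_modification[OF W_FF[OF s order_refl], of N0]) (auto simp: V_eq space_FF intro: null_FF null_P)
  show "continuous_on {0..} (\<lambda>t. V t \<omega>)" for \<omega>
    using good by (cases "\<omega> \<in> N0 \<or> \<omega> \<notin> space M") (auto simp: V_def)
  show "V 0 \<omega> = 0" for \<omega> using good by (auto simp: V_def)
  fix s t :: real assume st: "0 \<le> s" "s < t"
  have [measurable]: "V s \<in> borel_measurable M" "V t \<in> borel_measurable M" "W s \<in> borel_measurable M" "W t \<in> borel_measurable M"
    using st by (auto intro: V_M W_M)
  have d: "distributed M lborel (\<lambda>\<omega>. W t \<omega> - W s \<omega>) (gauss (t - s))"
    using bm st unfolding standard_brownian_motion_def by blast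
  have ae: "AE \<omega> in M. V t \<omega> - V s \<omega> = W t \<omega> - W s \<omega>"
    using AE_not_in[OF N0] by (rule AE_mp) (auto simp: V_eq intro!: AE_I2)
  have "distr P lborel (\<lambda>\<omega>. V t \<omega> - V s \<omega>) = distr M lborel (\<lambda>\<omega>. V t \<omega> - V s \<omega>)"
    unfolding P_def by (rule distr_completion) measurable
  also have "\<dots> = distr M lborel (\<lambda>\<omega>. W t \<omega> - W s \<omega>)"
    by (rule distr_cong_AE[OF refl refl ae]) measurable
  also have "\<dots> = density lborel (gauss (t - s))" by (rule distributed_distr_eq_density[OF d])
  finally have "distr P lborel (\<lambda>\<omega>. V t \<omega> - V s \<omega>) = density lborel (gauss (t - s))" .
  moreover have "(\<lambda>\<omega>. V t \<omega> - V s \<omega>) \<in> measurable P lborel"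
    unfolding P_def by (rule measurable_completion) measurable
  ultimately show "distributed P lborel (\<lambda>\<omega>. V t \<omega> - V s \<omega>) (gauss (t - s))"
    unfolding distributed_def by auto
  fix F and B :: "real set" assume F: "F \<in> sets (FF s)" and B [measurable]: "B \<in> sets borel"
  have "sigma_algebra (space P) (sets (F0 s))"
    using sets.sigma_algebra_axioms[of "F0 s"] by (simp add: F0_def)
  then obtain A where A: "A \<in> sets (F0 s)" "(F - A) \<union> (A - F) \<in> null_sets P"
    using sigma_sets_null_completion[of P "sets (F0 s)" F] F F0_sub sets_M_P unfolding sets_FF space_P by blast
  define E where "E = {\<omega>\<in>space M. V t \<omega> - V s \<omega> \<in> B}"
  define E' where "E' = {\<omega>\<in>space M. W t \<omega> - W s \<omega> \<in> B}"
  have EM: "E \<in> sets M" "E' \<in> sets M" unfolding E_def E'_def by measurable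
  have AM: "A \<in> sets M" using A F0_sub by auto
  have FP: "F \<in> sets P" using F FF_P by auto
  have "AE \<omega> in P. \<omega> \<notin> (F - A) \<union> (A - F)" using A(2) by (rule AE_not_in)
  moreover have "AE \<omega> in P. \<omega> \<notin> N0" using null_P[OF order_refl] by (rule AE_not_in)
  ultimately have ae2: "AE \<omega> in P. (\<omega> \<in> F \<longleftrightarrow> \<omega> \<in> A) \<and> (\<omega> \<in> E \<longleftrightarrow> \<omega> \<in> E')"
    by eventually_elim (auto simp: E_def E'_def V_def)
  have m: "P.prob C = M.prob C" if "C \<in> sets M" for C
    using that by (simp add: P_def measure_def)
  have "P.prob (F \<inter> E) = P.prob (A \<inter> E')"
    using ae2 FP AM EM sets_M_P by (intro measure_eq_AE) (auto elim!: AE_mp)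
  also have "\<dots> = M.prob A * M.prob E'"
    using m[of "A \<inter> E'"] AM EM bm_past_indep[OF prob bm st _ B, of A] A(1) by (simp add: F0_def E'_def)
  also have "M.prob A = P.prob F"
    unfolding m[OF AM, symmetric] using ae2 FP AM sets_M_P by (intro measure_eq_AE) (auto elim!: AE_mp)
  also have "M.prob E' = P.prob E"
    unfolding m[OF EM(2), symmetric] using ae2 EM sets_M_P by (intro measure_eq_AE) (auto elim!: AE_mp)
  finally show "P.prob (F \<inter> {\<omega> \<in> space P. V t \<omega> - V s \<omega> \<in> B}) = P.prob F * P.prob {\<omega> \<in> space P. V t \<omega> - V s \<omega> \<in> B}"
    by (simp add: E_def)
qed

interpretation V: cont_bm P FF V by (rule bm_V)

lemma xi_P: "xi W \<in> borel_measurable P"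
  by (rule measurable_modification[OF V.xi_measurable, of N0]) (auto simp: xi_V null_P intro: null_setsD2)

definition I where "I s \<omega> = (indicator {xi W \<omega>..} s :: real)" for s \<omega>
definition R where "R s = raw_progressive_enlargement (space M) F0 (xi W) s" for s

lemma R_gen: "sets (F0 s) \<union> sets (natural_filtration (space M) I s) \<subseteq> Pow (space M)"
proof -
  have "sets (natural_filtration (space M) I s) \<subseteq> Pow (space M)"
    using sets.space_closed[of "natural_filtration (space M) I s"] by simp
  then show ?thesis using FF_gen by blast
qed

lemma sets_R: "sets (R s) = sigma_sets (space M) (sets (F0 s) \<union> sets (natural_filtration (space M) I s))"
  unfolding R_def raw_progressive_enlargement_def I_def[abs_def, symmetric]
  by (rule sets_measure_of[OF R_gen])

lemma space_R: "space (R s) = space M"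
  unfolding R_def raw_progressive_enlargement_def I_def[abs_def, symmetric]
  by (rule space_measure_of[OF R_gen])

lemma R_sub:
  assumes K: "space K = space M" and F: "sets (F0 s) \<subseteq> sets K"
    and x: "\<And>r. 0 \<le> r \<Longrightarrow> r \<le> s \<Longrightarrow> {\<omega>\<in>space K. xi W \<omega> \<le> r} \<in> sets K"
  shows "sets (R s) \<subseteq> sets K"
proof -
  have "sets (natural_filtration (space M) I s) \<subseteq> sets K"
    using x by (intro natural_filtration_sub K) (auto simp: I_def[abs_def] intro: indicator_of_set_measurable)
  then have "sigma_sets (space K) (sets (F0 s) \<union> sets (natural_filtration (space M) I s)) \<subseteq> sets K"
    using F by (intro sets.sigma_sets_subset) auto
  then show ?thesis unfolding sets_R K .
qed

lemma R_P: "sets (R s) \<subseteq> sets P"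
proof (rule R_sub)
  show "sets (F0 s) \<subseteq> sets P" using F0_sub sets_M_P by auto
  show "{\<omega>\<in>space P. xi W \<omega> \<le> r} \<in> sets P" for r using xi_P by measurable
qed simp

lemma H_gen: "(\<Inter>s\<in>{t<..}. sets (R s)) \<union> null_sets P \<subseteq> Pow (space M)"
proof -
  have "sets (R (t + 1)) \<subseteq> Pow (space M)" using sets.space_closed[of "R (t + 1)"] by (simp add: space_R)
  then have "(\<Inter>s\<in>{t<..}. sets (R s)) \<subseteq> Pow (space M)" by (auto dest!: INT_D[of _ _ _ "t + 1"])
  then show ?thesis using FF_gen by blast
qed

lemma H_eq: "H t = sigma (space M) ((\<Inter>s\<in>{t<..}. sets (R s)) \<union> null_sets P)"
  unfolding H_def progressive_enlargement_def augmentation_def R_def F0_def P_def ..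

lemma sets_H: "sets (H t) = sigma_sets (space M) ((\<Inter>s\<in>{t<..}. sets (R s)) \<union> null_sets P)"
  unfolding H_eq by (rule sets_measure_of[OF H_gen])

lemma space_H: "space (H t) = space M"
  unfolding H_eq by (rule space_measure_of[OF H_gen])

lemma null_H: "A \<in> null_sets P \<Longrightarrow> A \<in> sets (H t)"
  unfolding sets_H by (intro sigma_sets.Basic) auto

lemma R_H: "(\<And>s. t < s \<Longrightarrow> A \<in> sets (R s)) \<Longrightarrow> A \<in> sets (H t)"
  unfolding sets_H by (intro sigma_sets.Basic) auto

lemma H_P: "sets (H t) \<subseteq> sets P"
  unfolding sets_H space_P[symmetric]
proof (rule sets.sigma_sets_subset)
  show "(\<Inter>s\<in>{t<..}. sets (R s)) \<union> null_sets P \<subseteq> sets P" using R_P[of "t + 1"] by (auto dest!: INT_D[of _ _ _ "t + 1"])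
qed

lemma modification_H:
  fixes f g :: "'a \<Rightarrow> real"
  assumes "f \<in> borel_measurable (H t)" "N1 \<in> null_sets P" "\<And>\<omega>. \<omega> \<in> space M \<Longrightarrow> \<omega> \<notin> N1 \<Longrightarrow> f \<omega> = g \<omega>"
  shows "g \<in> borel_measurable (H t)"
  using assms(2,3) by (intro measurable_modification[OF assms(1), of N1])
    (auto simp: space_H intro!: null_H null_sets_completion_subset[of _ N1 M] simp: P_def)

text \<open>The upper bound comes from replacing the right limit at \<open>s\<close> by the raw enlargement at a time \<open>t > s\<close>. Passing between \<open>W\<close> and
\<open>V\<close> costs a negligible set, which belongs to both filtrations.\<close>

lemma enlarged: "enlarged_bm P FF V H"
proof (intro enlarged_bm.intro enlarged_bm_axioms.intro bm_V)
  show "subalgebra P (H t)" for t using H_P by (simp add: subalgebra_def space_H)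
  show "sets (H s) \<subseteq> sets (H t)" if "s \<le> t" for s t
    unfolding sets_H using that by (intro sigma_sets_mono') (auto dest: INT_D)
  show "V r \<in> borel_measurable (H t)" if r: "0 \<le> r" "r \<le> t" for r t
  proof (rule modification_H[OF _ null_P[OF order_refl]])
    show "W r \<in> borel_measurable (H t)"
    proof (rule measurableI)
      fix B :: "real set" assume B: "B \<in> sets borel"
      show "W r -` B \<inter> space (H t) \<in> sets (H t)"
      proof (rule R_H)
        fix s assume "t < s"
        then have "W r \<in> borel_measurable (F0 s)" unfolding F0_def using r by (intro natural_filtration_measurable) auto
        from measurable_sets[OF this B] have "W r -` B \<inter> space M \<in> sets (F0 s)" by (simp add: F0_def)
        then show "W r -` B \<inter> space (H t) \<in> sets (R s)" unfolding space_H sets_R by (intro sigma_sets.Basic) auto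
      qed
    qed simp
  qed (simp add: V_eq)
  show "{\<omega> \<in> space P. xi V \<omega> \<le> q} \<in> sets (H t)" if q: "0 \<le> q" "q \<le> t" for q t
  proof -
    have "{\<omega>\<in>space (H t). xi W \<omega> \<le> q} \<in> sets (H t)"
    proof (rule R_H)
      fix s assume "t < s"
      then have "I q \<in> borel_measurable (natural_filtration (space M) I s)" using q by (intro natural_filtration_measurable) auto
      then have "{\<omega>\<in>space (natural_filtration (space M) I s). xi W \<omega> \<le> q} \<in> sets (natural_filtration (space M) I s)"
        by (intro set_of_indicator_measurable) (simp add: I_def[abs_def])
      then show "{\<omega>\<in>space (H t). xi W \<omega> \<le> q} \<in> sets (R s)" unfolding sets_R by (intro sigma_sets.Basic) (simp add: space_H)
    qed
    then have "(\<lambda>\<omega>. indicator {xi W \<omega>..} q :: real) \<in> borel_measurable (H t)" by (rule indicator_of_set_measurable)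
    then have "(\<lambda>\<omega>. indicator {xi V \<omega>..} q :: real) \<in> borel_measurable (H t)"
      by (rule modification_H[OF _ null_P[OF order_refl]]) (simp add: xi_V)
    from set_of_indicator_measurable[OF this] show ?thesis by (simp add: space_H)
  qed
  show "sets (H s) \<subseteq> sigma_sets (space P) (sets (FF t) \<union> {{\<omega>\<in>space P. xi V \<omega> \<le> q} | q. q \<le> t})" if st: "0 \<le> s" "s < t" for s t
  proof -
    define GG where "GG = sets (FF t) \<union> {{\<omega>\<in>space P. xi V \<omega> \<le> q} | q. q \<le> t}"
    have GP: "GG \<subseteq> Pow (space M)"
      unfolding GG_def using sets.space_closed[of "FF t"] by (auto simp: space_FF)
    define K where "K = sigma (space M) GG"
    have K: "sets K = sigma_sets (space M) GG" "space K = space M"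
      unfolding K_def by (rule sets_measure_of[OF GP], rule space_measure_of[OF GP])
    have FK: "sets (FF t) \<subseteq> sets K" unfolding K GG_def by (auto intro: sigma_sets.Basic)
    have "sets (R t) \<subseteq> sets K"
    proof (rule R_sub[OF K(2)])
      show "sets (F0 t) \<subseteq> sets K" using FK F0_FF by blast
      fix r assume r: "0 \<le> r" "r \<le> t"
      have "{\<omega>\<in>space M. xi V \<omega> \<le> r} \<in> sets K" unfolding K GG_def using r by (intro sigma_sets.Basic) auto
      then have "(\<lambda>\<omega>. indicator {xi V \<omega>..} r :: real) \<in> borel_measurable K"
        by (intro indicator_of_set_measurable) (simp add: K(2))
      then have "(\<lambda>\<omega>. indicator {xi W \<omega>..} r :: real) \<in> borel_measurable K"
        by (rule measurable_modification[of _ _ N0]) (use null_P null_FF[of _ t] FK in \<open>auto simp: xi_V K(2)\<close>)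
      then show "{\<omega>\<in>space K. xi W \<omega> \<le> r} \<in> sets K" by (rule set_of_indicator_measurable)
    qed
    then have "(\<Inter>s\<in>{s<..}. sets (R s)) \<union> null_sets P \<subseteq> sets K"
      using st null_FF[of _ t] FK by (auto dest!: INT_D[of _ _ _ t])
    then have "sigma_sets (space K) ((\<Inter>s\<in>{s<..}. sets (R s)) \<union> null_sets P) \<subseteq> sets K"
      by (rule sets.sigma_sets_subset)
    then show ?thesis unfolding sets_H K space_P GG_def by simp
  qed
qed

interpretation E: enlarged_bm P FF V H by (rule enlarged)

lemma filtration_H: "filtration (space P) H"
  by unfold_locales (use E.H_mono in \<open>auto simp: space_H\<close>)

definition N1 where "N1 = N0 \<union> {\<omega>\<in>space M. \<not> integrable lborel (\<lambda>u. chi_density V u \<omega>)}"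

lemma N1_null: "N1 \<in> null_sets P"
proof -
  have "AE \<omega> in P. integrable lborel (\<lambda>u. chi_density V u \<omega>)" by (rule V.chi_density_AE_integrable)
  then obtain N2 where N2: "{\<omega>\<in>space P. \<not> integrable lborel (\<lambda>u. chi_density V u \<omega>)} \<subseteq> N2" "N2 \<in> null_sets P"
    unfolding eventually_ae_filter by blast
  have "{\<omega>\<in>space M. \<not> integrable lborel (\<lambda>u. chi_density V u \<omega>)} \<in> null_sets P"
    using null_sets_completion_subset[OF N2(1), of M] N2(2) unfolding P_def[symmetric] space_P by blast
  then show ?thesis unfolding N1_def by (rule null_sets.Un[OF null_P[OF order_refl]])
qed

lemma regular_path: "\<omega> \<in> space M \<Longrightarrow> \<omega> \<notin> N1 \<Longrightarrow> \<omega> \<notin> N0 \<and> integrable lborel (\<lambda>u. chi_density V u \<omega>)"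
  by (auto simp: N1_def)

lemma AE_N1: "AE \<omega> in P. \<omega> \<notin> N1" by (rule AE_not_in[OF N1_null])

lemma chi_H: "0 \<le> t \<Longrightarrow> chi W t \<in> borel_measurable (H t)"
  by (rule modification_H[OF E.chi_X_adapted(1) null_P[OF order_refl]]) (auto simp: chi_V)

lemma restrict_null_meas:
  assumes "A \<subseteq> N1" shows "(\<lambda>\<omega>. if \<omega> \<in> A then f \<omega> else (0::real)) \<in> borel_measurable (H t)"
  by (rule modification_H[OF _ N1_null, of "\<lambda>_. 0"]) (use assms in auto)

text \<open>Off a negligible set \<open>\<chi>\<close> is continuous and adapted. On the negligible set every process is measurable at time \<open>0\<close>, but its sections
may be discontinuous. By \<open>indefinite_integral_one_sided\<close> each section is left continuous or right continuous, and these two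
kinds of paths are treated separately.\<close>

lemma chi_predictable: "predictable (space P) H (chi W)"
proof -
  define L where "L = {\<omega>\<in>N1. \<forall>t>0. ((\<lambda>t. chi W t \<omega>) \<longlongrightarrow> chi W t \<omega>) (at_left t)}"
  define Z1 where "Z1 t \<omega> = (if \<omega> \<in> N1 then 0 else chi W t \<omega>)" for t \<omega>
  define Z2 where "Z2 t \<omega> = (if \<omega> \<in> L then chi W t \<omega> else 0)" for t \<omega>
  define Z3 where "Z3 t \<omega> = (if \<omega> \<in> N1 - L then chi W t \<omega> else 0)" for t \<omega>
  have p1: "predictable (space P) H Z1"
  proof (rule predictable_left_continuous[OF filtration_H])
    show "Z1 t \<in> borel_measurable (H t)" if "0 \<le> t" for t
      unfolding Z1_def by (rule modification_H[OF chi_H[OF that] N1_null]) auto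
    fix t \<omega> assume "0 < (t::real)" and \<omega>: "\<omega> \<in> space P"
    show "((\<lambda>t. Z1 t \<omega>) \<longlongrightarrow> Z1 t \<omega>) (at_left t)"
    proof (cases "\<omega> \<in> N1")
      case False
      then have g: "\<omega> \<notin> N0" "integrable lborel (\<lambda>u. chi_density V u \<omega>)" using regular_path \<omega> by auto
      have "isCont (\<lambda>t. chi V t \<omega>) t" by (rule V.chi_isCont[OF g(2)])
      then have "((\<lambda>t. chi V t \<omega>) \<longlongrightarrow> chi V t \<omega>) (at_left t)"
        unfolding isCont_def by (rule tendsto_within_subset) simp
      then show ?thesis using False g(1) \<omega> by (simp add: Z1_def chi_V)
    qed (simp add: Z1_def)
  qed
  have p2: "predictable (space P) H Z2"
  proof (rule predictable_left_continuous[OF filtration_H])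
    show "Z2 t \<in> borel_measurable (H t)" for t
      unfolding Z2_def by (rule restrict_null_meas) (auto simp: L_def)
    show "((\<lambda>t. Z2 t \<omega>) \<longlongrightarrow> Z2 t \<omega>) (at_left t)" if "0 < t" for t \<omega>
    proof (cases "\<omega> \<in> L")
      case True
      then have "((\<lambda>t. chi W t \<omega>) \<longlongrightarrow> chi W t \<omega>) (at_left t)" using that by (auto simp: L_def)
      then show ?thesis using True by (simp add: Z2_def)
    qed (simp add: Z2_def)
  qed
  have p3: "predictable (space P) H Z3"
  proof (rule predictable_right_continuous_F0[OF filtration_H])
    show "Z3 t \<in> borel_measurable (H 0)" for t
      unfolding Z3_def by (rule restrict_null_meas) auto
    show "((\<lambda>t. Z3 t \<omega>) \<longlongrightarrow> Z3 t \<omega>) (at_right t)" if "0 \<le> t" for t \<omega>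
    proof (cases "\<omega> \<in> N1 - L")
      case True
      then have "\<not> (\<forall>t>0. ((\<lambda>t. chi W t \<omega>) \<longlongrightarrow> chi W t \<omega>) (at_left t))" by (auto simp: L_def)
      then have "\<forall>t\<ge>0. ((\<lambda>t. chi W t \<omega>) \<longlongrightarrow> chi W t \<omega>) (at_right t)"
        unfolding chi_def using indefinite_integral_one_sided[of "\<lambda>u. chi_density W u \<omega>"] by blast
      then show ?thesis using that True by (simp add: Z3_def)
    next
      case False
      then have "Z3 t \<omega> = 0" for t by (auto simp: Z3_def)
      then show ?thesis by simp
    qed
  qed
  have "(\<lambda>p. (case p of (t, \<omega>) \<Rightarrow> Z1 t \<omega>) + (case p of (t, \<omega>) \<Rightarrow> Z2 t \<omega>) + (case p of (t, \<omega>) \<Rightarrow> Z3 t \<omega>)) \<in> borel_measurable (predictable_sigma (space P) H)"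
    using p1 p2 p3 unfolding predictable_def by (intro borel_measurable_add)
  moreover have "Z1 t \<omega> + Z2 t \<omega> + Z3 t \<omega> = chi W t \<omega>" for t \<omega>
    by (auto simp: Z1_def Z2_def Z3_def L_def)
  ultimately show ?thesis unfolding predictable_def by (simp add: case_prod_beta')
qed

lemma cadlag_continuous:
  assumes "continuous_on {0..} f" shows "cadlag f"
  unfolding cadlag_def
proof (intro conjI allI impI)
  fix t :: real assume t: "0 \<le> t"
  have "continuous (at t within {0..}) f" using assms t by (auto simp: continuous_on_eq_continuous_within)
  then show "continuous (at_right t) f" by (rule continuous_within_subset) (use t in auto)
next
  fix t :: real assume t: "0 < t"
  have "(f \<longlongrightarrow> f t) (at t within {0..})" using assms t by (auto simp: continuous_on_def)
  then have "(f \<longlongrightarrow> f t) (at t within {0<..<t})" by (rule tendsto_within_subset) auto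
  moreover have "at t within {0<..<t} = at_left t" using t by (intro at_within_nhd[of t "{0<..}"]) auto
  ultimately show "\<exists>l. (f \<longlongrightarrow> l) (at_left t)" by auto
qed

lemma chi_variation:
  assumes I: "integrable lborel (\<lambda>u. chi_density V u \<omega>)"
  shows "locally_finite_variation (\<lambda>t. chi V t \<omega>)"
  unfolding locally_finite_variation_def
proof (intro allI impI exI)
  fix t :: real and n and u :: "nat \<Rightarrow> real"
  assume u: "\<forall>i<n. u i \<le> u (Suc i)"
  have Ii: "integrable lborel (\<lambda>x. indicator S x * \<bar>chi_density V x \<omega>\<bar>)" if "S \<in> sets borel" for S
    using integrable_real_mult_indicator[of S lborel, OF _ integrable_abs[OF I]] that by (simp add: mult.commute)
  have "(\<Sum>i<n. \<bar>chi V (u (Suc i)) \<omega> - chi V (u i) \<omega>\<bar>) \<le> (\<integral>x. indicator {u 0<..u n} x * \<bar>chi_density V x \<omega>\<bar> \<partial>lborel) \<and> u 0 \<le> u n"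
    using u
  proof (induction n)
    case (Suc n)
    then have IH: "(\<Sum>i<n. \<bar>chi V (u (Suc i)) \<omega> - chi V (u i) \<omega>\<bar>) \<le> (\<integral>x. indicator {u 0<..u n} x * \<bar>chi_density V x \<omega>\<bar> \<partial>lborel)" "u 0 \<le> u n"
      and le: "u n \<le> u (Suc n)" by auto
    have "\<bar>chi V (u (Suc n)) \<omega> - chi V (u n) \<omega>\<bar> \<le> (\<integral>x. indicator {u n<..u (Suc n)} x * \<bar>chi_density V x \<omega>\<bar> \<partial>lborel)"
      unfolding V.chi_diff[OF I le] by (rule order_trans[OF integral_abs_bound]) (simp add: abs_mult)
    then have "(\<Sum>i<Suc n. \<bar>chi V (u (Suc i)) \<omega> - chi V (u i) \<omega>\<bar>) \<le>
      (\<integral>x. indicator {u 0<..u n} x * \<bar>chi_density V x \<omega>\<bar> \<partial>lborel) + (\<integral>x. indicator {u n<..u (Suc n)} x * \<bar>chi_density V x \<omega>\<bar> \<partial>lborel)"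
      using IH by simp
    also have "\<dots> = (\<integral>x. indicator {u 0<..u n} x * \<bar>chi_density V x \<omega>\<bar> + indicator {u n<..u (Suc n)} x * \<bar>chi_density V x \<omega>\<bar> \<partial>lborel)"
      by (intro Bochner_Integration.integral_add[symmetric] Ii) auto
    also have "\<dots> = (\<integral>x. indicator {u 0<..u (Suc n)} x * \<bar>chi_density V x \<omega>\<bar> \<partial>lborel)"
      using IH(2) le by (intro Bochner_Integration.integral_cong) (auto simp: indicator_def)
    finally show ?case using IH(2) le by simp
  qed simp
  then have "(\<Sum>i<n. \<bar>chi V (u (Suc i)) \<omega> - chi V (u i) \<omega>\<bar>) \<le> (\<integral>x. indicator {u 0<..u n} x * \<bar>chi_density V x \<omega>\<bar> \<partial>lborel)" by simp
  also have "\<dots> \<le> (\<integral>x. \<bar>chi_density V x \<omega>\<bar> \<partial>lborel)"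
    using integrable_abs[OF I] by (intro integral_mono') (auto simp: indicator_def)
  finally show "(\<Sum>i<n. \<bar>chi V (u (Suc i)) \<omega> - chi V (u i) \<omega>\<bar>) \<le> (\<integral>x. \<bar>chi_density V x \<omega>\<bar> \<partial>lborel)" .
qed

definition D where "D t \<omega> = W t \<omega> - W (min t (xi W \<omega>)) \<omega> - chi W t \<omega>" for t \<omega>

lemma D_eq: "\<omega> \<in> space M \<Longrightarrow> \<omega> \<notin> N0 \<Longrightarrow> V.N t \<omega> = D t \<omega>"
  by (simp add: D_def V.N_def V.X_def V_eq xi_V chi_V)

lemma D_H: "0 \<le> t \<Longrightarrow> D t \<in> borel_measurable (H t)"
  by (rule modification_H[OF E.N_adapted null_P[OF order_refl]]) (auto simp: D_eq)

lemma H_P_meas: "f \<in> borel_measurable (H t) \<Longrightarrow> f \<in> borel_measurable P"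
  using H_P[of t] by (auto simp: measurable_def space_H)

lemma AE_D: "AE \<omega> in P. \<forall>t. V.N t \<omega> = D t \<omega>"
  using AE_not_in[OF null_P[OF order_refl]] by (rule AE_mp) (auto simp: D_eq intro!: AE_I2)

lemma D_integrable: "0 \<le> t \<Longrightarrow> integrable P (D t)"
  using AE_D by (intro integrable_cong_AE_imp[OF V.N_integrable[of t] H_P_meas[OF D_H]]) auto

lemma D_set_integral:
  assumes s: "0 \<le> s" "s \<le> t" and A: "A \<in> sets (H s)"
  shows "(LINT \<omega>:A|P. D t \<omega>) = (LINT \<omega>:A|P. D s \<omega>)"
proof -
  have [measurable]: "A \<in> sets P" using A H_P by auto
  have [measurable]: "V.N t \<in> borel_measurable P" "V.N s \<in> borel_measurable P" "D t \<in> borel_measurable P" "D s \<in> borel_measurable P"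
    using s V.N_integrable D_integrable by (auto intro!: borel_measurable_integrable)
  have "(LINT \<omega>:A|P. D u \<omega>) = (\<integral>\<omega>. indicator A \<omega> * V.N u \<omega> \<partial>P)" if "u \<in> {s, t}" for u
    unfolding set_lebesgue_integral_def
  proof (rule integral_cong_AE)
    show "AE \<omega> in P. indicat_real A \<omega> *\<^sub>R D u \<omega> = indicat_real A \<omega> * V.N u \<omega>"
      by (rule AE_mp[OF AE_D], rule AE_I2) simp
  qed (use that in \<open>elim insertE emptyE; simp\<close>)+
  from this[of s] this[of t] show ?thesis using E.N_martingale_sets[OF s A] by simp
qed

text \<open>The localizing times are the constants \<open>n\<close>. Their common factor is \<open>1\<close>, except that for \<open>n = 0\<close> the whole process is \<open>0\<close>.\<close>

lemma D_martingale: "martingale P H (\<lambda>t \<omega>. indicator {\<omega>. 0 < real n} \<omega> * D (min t (real n)) \<omega>)"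
proof (cases "n = 0")
  case True
  have "AE \<omega> in P. real_cond_exp P (H s) (\<lambda>_. 0) \<omega> = 0" for s
  proof -
    interpret finite_measure_subalgebra P "H s" by unfold_locales (rule E.H_sub)
    show ?thesis by (rule real_cond_exp_charact) auto
  qed
  then show ?thesis using True filtration_H E.H_sub by (simp add: martingale_def adapted_def)
next
  case False
  then have n: "0 < real n" by simp
  have eq: "(\<lambda>t \<omega>. indicator {\<omega>. 0 < real n} \<omega> * D (min t (real n)) \<omega>) = (\<lambda>t. D (min t (real n)))"
    using n by (simp add: fun_eq_iff)
  show ?thesis unfolding eq martingale_def adapted_def
  proof (intro conjI allI impI filtration_H E.H_sub)
    fix t :: real assume t: "0 \<le> t"
    show "D (min t (real n)) \<in> borel_measurable (H t)"
      using D_H[of "min t (real n)"] t n E.H_mono[of "min t (real n)" t] by (auto simp: measurable_def space_H)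
    show "integrable P (D (min t (real n)))" using t n by (intro D_integrable) auto
  next
    fix s t :: real assume s: "0 \<le> s" "s \<le> t"
    interpret finite_measure_subalgebra P "H s" by unfold_locales (rule E.H_sub)
    show "AE \<omega> in P. real_cond_exp P (H s) (D (min t (real n))) \<omega> = D (min s (real n)) \<omega>"
    proof (rule real_cond_exp_charact)
      fix A assume A: "A \<in> sets (H s)"
      show "(LINT \<omega>:A|P. D (min t (real n)) \<omega>) = (LINT \<omega>:A|P. D (min s (real n)) \<omega>)"
      proof (cases "s \<le> real n")
        case True
        then show ?thesis using D_set_integral[of s "min t (real n)" A] s A by (simp add: min_absorb1)
      next
        case False
        then show ?thesis using s by (simp add: min_def)
      qed
    next
      show "integrable P (D (min t (real n)))" "integrable P (D (min s (real n)))" using s n by (auto intro!: D_integrable)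
      show "D (min s (real n)) \<in> borel_measurable (H s)"
        using D_H[of "min s (real n)"] s n E.H_mono[of "min s (real n)" s] by (auto simp: measurable_def space_H)
    qed
  qed
qed

lemma D_local_martingale: "local_martingale P H D"
  unfolding local_martingale_def
proof (intro conjI)
  show "adapted H D" unfolding adapted_def using D_H by auto
  show "AE \<omega> in P. cadlag (\<lambda>t. D t \<omega>)"
    using AE_N1 AE_D
  proof (rule AE_mp[OF AE_conjI], intro AE_I2 impI)
    fix \<omega> assume \<omega>: "\<omega> \<in> space P" and *: "\<omega> \<notin> N1 \<and> (\<forall>t. V.N t \<omega> = D t \<omega>)"
    then have "continuous_on {0..} (\<lambda>t. V.N t \<omega>)" using regular_path by (intro E.N_continuous) auto
    then show "cadlag (\<lambda>t. D t \<omega>)" using * by (intro cadlag_continuous) simp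
  qed
  show "\<exists>T :: nat \<Rightarrow> 'a \<Rightarrow> real. (\<forall>n. stopping_time H (T n) \<and> (\<forall>\<omega>\<in>space P. 0 \<le> T n \<omega>)) \<and>
        (AE \<omega> in P. incseq (\<lambda>n. T n \<omega>) \<and> filterlim (\<lambda>n. T n \<omega>) at_top sequentially) \<and>
        (\<forall>n. martingale P H (\<lambda>t \<omega>. indicator {\<omega>. 0 < T n \<omega>} \<omega> * D (min t (T n \<omega>)) \<omega>))"
  proof (intro exI[of _ "\<lambda>n _. real n"] conjI allI D_martingale)
    show "stopping_time H (\<lambda>_. real n)" for n unfolding stopping_time_def by simp
    show "AE \<omega> in P. incseq real \<and> filterlim real at_top sequentially"
      using filterlim_real_sequentially by (intro AE_I2) (auto simp: incseq_def)
  qed auto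
qed

lemma semimartingale:
  "special_semimartingale_with_drift P H (\<lambda>t \<omega>. W t \<omega> - W (min t (xi W \<omega>)) \<omega>) (chi W)"
  unfolding special_semimartingale_with_drift_def
proof (intro conjI chi_predictable exI[of _ D] D_local_martingale)
  show "AE \<omega> in P. chi W 0 \<omega> = 0 \<and> cadlag (\<lambda>t. chi W t \<omega>) \<and> locally_finite_variation (\<lambda>t. chi W t \<omega>)"
    using AE_N1
  proof (rule AE_mp, intro AE_I2 impI)
    fix \<omega> assume \<omega>: "\<omega> \<in> space P" "\<omega> \<notin> N1"
    then have g: "\<omega> \<notin> N0" "integrable lborel (\<lambda>u. chi_density V u \<omega>)" using regular_path by auto
    have c: "(\<lambda>t. chi W t \<omega>) = (\<lambda>t. chi V t \<omega>)" using chi_V[of \<omega>] g \<omega> by auto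
    have "chi V 0 \<omega> = 0" by (rule V.chi_before) (rule V.xi_range)
    then have "chi W 0 \<omega> = 0" using chi_V[of \<omega> 0] g \<omega> by simp
    moreover have "cadlag (\<lambda>t. chi W t \<omega>)"
      unfolding c by (intro cadlag_continuous continuous_at_imp_continuous_on ballI V.chi_isCont g)
    moreover have "locally_finite_variation (\<lambda>t. chi W t \<omega>)"
      unfolding c by (intro chi_variation g)
    ultimately show "chi W 0 \<omega> = 0 \<and> cadlag (\<lambda>t. chi W t \<omega>) \<and> locally_finite_variation (\<lambda>t. chi W t \<omega>)" by simp
  qed
  show "AE \<omega> in P. \<forall>t\<ge>0. W t \<omega> - W (min t (xi W \<omega>)) \<omega> = D t \<omega> + chi W t \<omega>"
    by (simp add: D_def)
qed

lemma density_integrable: "AE \<omega> in M. \<forall>t\<ge>0. set_integrable lborel {0..t} (\<lambda>s. chi_density W s \<omega>)"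
proof -
  have "AE \<omega> in P. \<forall>t\<ge>0. set_integrable lborel {0..t} (\<lambda>s. chi_density W s \<omega>)"
    using AE_N1
  proof (rule AE_mp, intro AE_I2 impI allI)
    fix \<omega> t assume \<omega>: "\<omega> \<in> space P" "\<omega> \<notin> N1"
    then have g: "\<omega> \<notin> N0" "integrable lborel (\<lambda>u. chi_density V u \<omega>)" using regular_path by auto
    have "(\<lambda>u. chi_density V u \<omega>) = (\<lambda>u. chi_density W u \<omega>)" using chi_density_V[of \<omega>] \<omega> g(1) by auto
    with g(2) have "integrable lborel (\<lambda>u. chi_density W u \<omega>)" by simp
    then show "set_integrable lborel {0..t} (\<lambda>s. chi_density W s \<omega>)"
      unfolding set_integrable_def by (intro integrable_mult_indicator) auto
  qed
  then show ?thesis unfolding P_def AE_completion_iff .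
qed

end

theorem mainTheorem2:
  fixes M :: "'a::polish_space measure" and W :: "real \<Rightarrow> 'a \<Rightarrow> real"
  assumes "prob_space M" and "sets M = sets borel"
    and "standard_brownian_motion M W"
  shows "(AE \<omega> in M. \<forall>t\<ge>0. set_integrable lborel {0..t} (\<lambda>s. chi_density W s \<omega>)) \<and>
    special_semimartingale_with_drift (completion M) (progressive_enlargement M W (xi W))
      (\<lambda>t \<omega>. W t \<omega> - W (min t (xi W \<omega>)) \<omega>) (chi W)"
proof -
  have "AE \<omega> in M. W 0 \<omega> = 0 \<and> continuous_on {0..} (\<lambda>t. W t \<omega>)"
    using assms(3) unfolding standard_brownian_motion_def by auto
  then obtain N0 where N0: "N0 \<in> null_sets M"
    and good: "\<forall>\<omega>\<in>space M - N0. W 0 \<omega> = 0 \<and> continuous_on {0..} (\<lambda>t. W t \<omega>)"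
    unfolding eventually_ae_filter by blast
  show ?thesis
    using density_integrable[OF assms(1,3) N0 good] semimartingale[OF assms(1,3) N0 good]
    unfolding P_def[OF assms(1,3) N0 good] H_def[OF assms(1,3) N0 good] by blast
qed

end
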